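(* Let $I\subseteq\mathbb{R}$ be an open interval and let $P_a(t)(Z)=Z^n+\sum_{j=1}^n a_j(t)Z^{n-j}$, $t\in I$, be a $C^p$-curve of hyperbolic polynomials of degree $n$, where $p$ is the maximal multiplicity of the roots of $P_a$. Then: (1) Any continuous root $\lambda$ of $P_a$ has both one-sided derivatives $\lambda'^-(t)$ and $\lambda'^+(t)$ at every $t\in I$. (2) These derivatives are continuous in the following sense: for every continuous root $\lambda$ and every $t_0\in I$, $$\lim_{t\to t_0^-}\lambda'^{\pm}(t)=\lambda'^-(t_0),\qquad \lim_{t\to t_0^+}\lambda'^{\pm}(t)=\lambda'^+(t_0).$$ (3) There exists a differentiable system of the roots of $P_a$ on $I$. (4) Any differentiable root of $P_a$ is $C^1$.
   Context: A monic real polynomial is hyperbolic if all its roots are real. $P_a(t)$, $t\in I$, is a $C^p$-curve of hyperbolic polynomials if $a_1,\dots,a_n\in C^p(I,\mathbb{R})$ and $P_a(t)$ is hyperbolic for each $t\in I$. The maximal multiplicity of the roots of $P_a$ is the maximum over $t\in I$ of the multiplicities of the roots of $P_a(t)$. A continuous (resp. differentiable) root is a continuous (resp. differentiable) function $\lambda:I\to\mathbb{R}$ with $P_a(t)(\lambda(t))=0$ for all $t\in I$. A system of the roots is an $n$-tuple $(\lambda_j)_{j=1}^n:I\to\mathbb{R}^n$ with $P_a(t)(Z)=\prod_{j=1}^n(Z-\lambda_j(t))$ for all $t\in I$; it is differentiable if each $\lambda_j$ is differentiable on $I$. $f'^-(t_0)$ and $f'^+(t_0)$ denote the left and right derivative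 of $f$ at $t_0$. *)

theory Defs
  imports "HOL-Analysis.Analysis" "HOL-Computational_Algebra.Computational_Algebra"
begin

(* The coefficients a 1, ..., a n are functions of the parameter t; a 0 and a j with j > n
   play no role. *)
definition monic_curve :: "nat \<Rightarrow> (nat \<Rightarrow> real \<Rightarrow> real) \<Rightarrow> real \<Rightarrow> real poly" where
  "monic_curve n a t = monom 1 n + (\<Sum>j=1..n. monom (a j t) (n - j))"

(* "All roots are real" refers to the complex roots. *)
definition hyperbolic :: "real poly \<Rightarrow> bool" where
  "hyperbolic q \<longleftrightarrow> lead_coeff q = 1 \<and>
     (\<forall>z::complex. poly (map_poly complex_of_real q) z = 0 \<longrightarrow> z \<in> \<real>)"

(* Intended for open S only: deriv is the two-sided derivative, so on an open set the
   iterated derivatives do not depend on the values of f outside S. *)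
definition Ck_on :: "nat \<Rightarrow> (real \<Rightarrow> real) \<Rightarrow> real set \<Rightarrow> bool" where
  "Ck_on k f S \<longleftrightarrow>
     (\<forall>i<k. \<forall>t\<in>S. ((deriv ^^ i) f) field_differentiable (at t)) \<and>
     continuous_on S ((deriv ^^ k) f)"

definition hyperbolic_curve ::
    "nat \<Rightarrow> real set \<Rightarrow> nat \<Rightarrow> (nat \<Rightarrow> real \<Rightarrow> real) \<Rightarrow> bool" where
  "hyperbolic_curve p I n a \<longleftrightarrow>
     (\<forall>j\<in>{1..n}. Ck_on p (a j) I) \<and> (\<forall>t\<in>I. hyperbolic (monic_curve n a t))"

(* All multiplicities are at most n, so the maximum exists whenever there is a root at all,
   that is, whenever I is nonempty and n is positive. *)
definition max_multiplicity :: "real set \<Rightarrow> nat \<Rightarrow> (nat \<Rightarrow> real \<Rightarrow> real) \<Rightarrow> nat" where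
  "max_multiplicity I n a =
     Max {order x (monic_curve n a t) | t x. t \<in> I \<and> poly (monic_curve n a t) x = 0}"

definition is_root_on ::
    "real set \<Rightarrow> nat \<Rightarrow> (nat \<Rightarrow> real \<Rightarrow> real) \<Rightarrow> (real \<Rightarrow> real) \<Rightarrow> bool" where
  "is_root_on I n a l \<longleftrightarrow> (\<forall>t\<in>I. poly (monic_curve n a t) (l t) = 0)"

definition continuous_root ::
    "real set \<Rightarrow> nat \<Rightarrow> (nat \<Rightarrow> real \<Rightarrow> real) \<Rightarrow> (real \<Rightarrow> real) \<Rightarrow> bool" where
  "continuous_root I n a l \<longleftrightarrow> is_root_on I n a l \<and> continuous_on I l"

definition differentiable_root ::
    "real set \<Rightarrow> nat \<Rightarrow> (nat \<Rightarrow> real \<Rightarrow> real) \<Rightarrow> (real \<Rightarrow> real) \<Rightarrow> bool" where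
  "differentiable_root I n a l \<longleftrightarrow> is_root_on I n a l \<and> l differentiable_on I"

definition root_system ::
    "real set \<Rightarrow> nat \<Rightarrow> (nat \<Rightarrow> real \<Rightarrow> real) \<Rightarrow> (nat \<Rightarrow> real \<Rightarrow> real) \<Rightarrow> bool" where
  "root_system I n a L \<longleftrightarrow> (\<forall>t\<in>I. monic_curve n a t = (\<Prod>j=1..n. [:- L j t, 1:]))"

definition differentiable_root_system ::
    "real set \<Rightarrow> nat \<Rightarrow> (nat \<Rightarrow> real \<Rightarrow> real) \<Rightarrow> (nat \<Rightarrow> real \<Rightarrow> real) \<Rightarrow> bool" where
  "differentiable_root_system I n a L \<longleftrightarrow>
     root_system I n a L \<and> (\<forall>j\<in>{1..n}. (L j) differentiable_on I)"

(* Unspecified where the one-sided derivative does not exist. *)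
definition left_deriv :: "(real \<Rightarrow> real) \<Rightarrow> real \<Rightarrow> real" where
  "left_deriv f t = (THE d. (f has_real_derivative d) (at_left t))"

definition right_deriv :: "(real \<Rightarrow> real) \<Rightarrow> real \<Rightarrow> real" where
  "right_deriv f t = (THE d. (f has_real_derivative d) (at_right t))"

lemma left_deriv_eq:
  assumes "(f has_real_derivative d) (at_left t)"
  shows "left_deriv f t = d"
  unfolding left_deriv_def
  using assms by (intro the_equality has_field_derivative_unique[of f _ t "{..<t}" d]) auto

lemma right_deriv_eq:
  assumes "(f has_real_derivative d) (at_right t)"
  shows "right_deriv f t = d"
  unfolding right_deriv_def
  using assms by (intro the_equality has_field_derivative_unique[of f _ t "{t<..}" d]) auto

lemma Ck_on_1_iff: "Ck_on 1 f S \<longleftrightarrow> f C1_differentiable_on S"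
proof
  assume "Ck_on 1 f S"
  then show "f C1_differentiable_on S"
    unfolding Ck_on_def C1_differentiable_on_def
    by (intro exI[of _ "deriv f"])
       (auto simp: field_differentiable_derivI has_real_derivative_iff_has_vector_derivative[symmetric])
next
  assume "f C1_differentiable_on S"
  then obtain D where D: "\<And>x. x \<in> S \<Longrightarrow> (f has_real_derivative D x) (at x)" "continuous_on S D"
    unfolding C1_differentiable_on_def has_real_derivative_iff_has_vector_derivative by blast
  have "continuous_on S (deriv f)"
    using D(2) by (rule continuous_on_eq) (metis D(1) DERIV_imp_deriv)
  then show "Ck_on 1 f S"
    using D(1) by (auto simp: Ck_on_def field_differentiable_def)
qed

end

theory Submission
  imports Defs "HOL-Combinatorics.Permutations"
begin

text \<open>
  Everything rests on an a-priori bound of Bronshtein's type for the slopes of a cluster of m roots,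
  proved by induction on m without splitting off the cluster as a factor. The critical points
  interlace the roots and are Lipschitz by induction. They trap the roots, which bounds
  f(t) = P(t, x) around a root x on suitable time scales, and since f has m bounded derivatives its
  derivative at the root is at most a multiple of \<open>\<partial>P/\<partial>z\<close>.

  Hence m roots that meet at \<open>(t0, x0)\<close> stay within O(h) of x0 at time t0 + h, and
  \<open>P(t0 + h, x0 + h w) / h^m\<close> converges to a polynomial in w. Its roots are the one-sided derivatives,
  on either side of t0. Applying the slope bound to suitably rescaled roots that are o(h) gives the
  continuity of the one-sided derivatives.

  A continuous system of roots can be made differentiable at finitely many points by permuting it to
  the right of each of them. By Tychonoff's theorem there is a system that is differentiable everywhere.
\<close>

section \<open>Real-rooted polynomials\<close>

text \<open>The slope constant may depend on the degree, the cluster size, the window, the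
  coefficient bounds and the lower bound for the m-th derivative, but never on distances between
  roots. The continuity of the one-sided derivatives relies on this: the rescaled curves at
  parameters tending to t0 form an infinite family that must share one constant, and the scale
  \<eta> of the rescaling is fixed only after that constant is known. It also explains why no factor
  is split off. The coefficients of a factor would need derivative bounds of their own, whereas the
  mean value form of a divided difference controls the cofactor directly, and \<open>pderiv\<close>
  turns a cluster into a smaller one with data of the same kind.

  Compactness enters at the end because the parameters at which branches have to be permuted may
  accumulate, so that corrections made one after another need not settle down. A finite set of
  parameters suffices for the finite intersection property, provided that differentiability of a
  root at one parameter is a closed condition for pointwise convergence.\<close>

lemma size_filter_proots:
  assumes "p \<noteq> 0"
  shows "size (filter_mset (\<lambda>x. x \<in> S) (proots p)) = (\<Sum>x\<in>{x\<in>S. poly p x = 0}. order x p)"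
  using assms by (auto simp: size_multiset_overloaded_eq intro!: sum.cong)

text \<open>Rolle's theorem with multiplicities. Passing to the derivative costs each root in S one
  unit of multiplicity, and each gap between consecutive roots returns a new critical point. There
  is one gap fewer than there are distinct roots, hence the single unit of loss.\<close>

lemma size_filter_proots_pderiv:
  fixes p :: "real poly"
  assumes S: "is_interval S" and p': "pderiv p \<noteq> 0"
  shows "size (filter_mset (\<lambda>x. x \<in> S) (proots p))
           \<le> size (filter_mset (\<lambda>x. x \<in> S) (proots (pderiv p))) + 1"
proof -
  define R where "R = {x\<in>S. poly p x = 0}"
  have p0: "p \<noteq> 0" using p' by auto
  have fR: "finite R" unfolding R_def using poly_roots_finite[OF p0] by auto
  show ?thesis
  proof (cases "R = {}")
    case True
    then show ?thesis unfolding size_filter_proots[OF p0, of S] R_def[symmetric] by simp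
  next
    case False
    \<comment> \<open>\<open>nx x\<close> is the next root to the right of x. \<open>R'\<close>
      omits the largest root, which has no successor.\<close>
    define nx where "nx x = Min {u\<in>R. x < u}" for x
    define R' where "R' = R - {Max R}"
    have MaxR: "Max R \<in> R" using False fR by simp
    have nx: "nx x \<in> R \<and> x < nx x \<and> (\<forall>u\<in>R. x < u \<longrightarrow> nx x \<le> u)" if "x \<in> R'" for x
    proof -
      have "x \<le> Max R" "x \<noteq> Max R" using that Max_ge[OF fR, of x] by (simp_all add: R'_def)
      then have ne: "{u\<in>R. x < u} \<noteq> {}" using MaxR by force
      have "nx x \<in> {u\<in>R. x < u}" unfolding nx_def by (intro Min_in) (use fR ne in auto)
      moreover have "nx x \<le> u" if "u \<in> R" "x < u" for u
        unfolding nx_def by (intro Min_le) (use fR that in auto)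
      ultimately show ?thesis by auto
    qed
    have "\<exists>y. x < y \<and> y < nx x \<and> poly (pderiv p) y = 0" if "x \<in> R'" for x
    proof -
      have "poly p x = 0" "poly p (nx x) = 0" "x < nx x"
        using nx[OF that] that by (auto simp: R'_def R_def)
      then show ?thesis using poly_MVT[of x "nx x" p] by auto
    qed
    then obtain y where y: "\<And>x. x \<in> R' \<Longrightarrow> x < y x \<and> y x < nx x \<and> poly (pderiv p) (y x) = 0"
      by metis
    have yR: "y x \<notin> R" if "x \<in> R'" for x
      using y[OF that] nx[OF that] by force
    have yS: "y x \<in> S" if "x \<in> R'" for x
      using y[OF that] nx[OF that] that S mem_is_interval_1_I[of S x "nx x" "y x"]
      by (auto simp: R'_def R_def)
    have inj: "inj_on y R'"
    proof (rule linorder_inj_onI)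
      fix x x' assume x: "x < x'" "x \<in> R'" "x' \<in> R'"
      have "x' \<in> R" using x by (simp add: R'_def)
      then have "nx x \<le> x'" using nx[OF x(2)] x(1) by blast
      moreover have "y x < nx x" "x' < y x'" using y x by blast+
      ultimately show "y x \<noteq> y x'" by linarith
    qed (rule linear)
    have fR': "finite R'" using fR by (simp add: R'_def)
    have cR: "card R = Suc (card R')" unfolding R'_def using card_Suc_Diff1[OF fR MaxR] by simp
    let ?o = "\<lambda>x. order x (pderiv p)"
    have "(\<Sum>x\<in>R. order x p) = (\<Sum>x\<in>R. ?o x + 1)"
      by (intro sum.cong) (auto simp: R_def order_pderiv[OF p0])
    also have "\<dots> = (\<Sum>x\<in>R. ?o x) + card R"
      by (simp only: sum.distrib) simp
    finally have 1: "(\<Sum>x\<in>R. order x p) = (\<Sum>x\<in>R. ?o x) + card R" .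
    have "card R' \<le> (\<Sum>x\<in>R'. ?o (y x))"
    proof -
      have "(\<Sum>x\<in>R'. 1) \<le> (\<Sum>x\<in>R'. ?o (y x))"
        using y p' by (intro sum_mono) (auto simp: Suc_le_eq order_gt_0_iff)
      then show ?thesis by simp
    qed
    also have "\<dots> = (\<Sum>x\<in>y ` R'. ?o x)" using inj by (simp add: sum.reindex)
    finally have 2: "card R' \<le> (\<Sum>x\<in>y ` R'. ?o x)" .
    have 3: "(\<Sum>x\<in>R. ?o x) + (\<Sum>x\<in>y ` R'. ?o x) = (\<Sum>x\<in>R \<union> y ` R'. ?o x)"
      using yR fR fR' by (intro sum.union_disjoint[symmetric]) auto
    define T where "T = {x\<in>S. poly (pderiv p) x = 0}"
    have fT: "finite T" unfolding T_def using poly_roots_finite[OF p'] by auto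
    have "(\<Sum>x\<in>R \<union> y ` R'. ?o x) \<le> (\<Sum>x\<in>T. ?o x)"
    proof -
      have "(\<Sum>x\<in>R \<union> y ` R'. ?o x) \<le> (\<Sum>x\<in>(R \<union> y ` R') \<union> T. ?o x)"
        by (rule sum_mono2) (use fR fR' fT in auto)
      also have "\<dots> = (\<Sum>x\<in>T. ?o x)"
      proof (rule sum.mono_neutral_right)
        show "\<forall>i\<in>R \<union> y ` R' \<union> T - T. ?o i = 0"
          using yS p' by (auto simp: R_def T_def order_eq_0_iff)
        show "T \<subseteq> R \<union> y ` R' \<union> T" by auto
      qed (use fR fR' fT in auto)
      finally show ?thesis .
    qed
    then show ?thesis
      using 1 2 3 cR by (simp add: size_filter_proots p0 p' R_def[symmetric] T_def[symmetric])
  qed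
qed

section \<open>Sorted roots of real-rooted polynomials\<close>

text \<open>Realness is expressed by counting real roots with multiplicity, which suits arguments by
  Rolle; complex roots occur only in the passage from \<open>hyperbolic\<close>.\<close>

definition real_rooted :: "real poly \<Rightarrow> bool" where
  "real_rooted p \<longleftrightarrow> p \<noteq> 0 \<and> size (proots p) = degree p"

text \<open>Sorting makes the i-th root a function of the polynomial alone. Along a curve these
  functions are continuous, but where they meet they may fail to be differentiable.\<close>

definition sroot :: "real poly \<Rightarrow> nat \<Rightarrow> real" where
  "sroot p i = sorted_list_of_multiset (proots p) ! i"

lemma length_proots: "real_rooted p \<Longrightarrow> length (sorted_list_of_multiset (proots p)) = degree p"
  by (metis mset_sorted_list_of_multiset real_rooted_def size_mset)

lemma sroot_mono:
  "real_rooted p \<Longrightarrow> i \<le> j \<Longrightarrow> j < degree p \<Longrightarrow> sroot p i \<le> sroot p j"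
  unfolding sroot_def by (intro sorted_nth_mono) (auto simp: length_proots)

lemma proots_sroot:
  assumes "real_rooted p"
  shows "proots p = image_mset (sroot p) (mset_set {..<degree p})"
proof -
  have "proots p = mset (sorted_list_of_multiset (proots p))" by simp
  also have "sorted_list_of_multiset (proots p) = map (sroot p) [0..<degree p]"
    by (intro nth_equalityI) (auto simp: sroot_def length_proots[OF assms])
  finally show ?thesis by (simp add: lessThan_atLeast0)
qed

text \<open>The product of the linear factors divides p and has the same degree, so the quotient is
  a constant, the leading coefficient.\<close>

lemma real_rooted_prod_mset:
  assumes "real_rooted p"
  shows "p = smult (lead_coeff p) (\<Prod>x\<in>#proots p. [:-x, 1:])"
proof -
  have p0: "p \<noteq> 0" using assms by (simp add: real_rooted_def)
  define r where "r = (\<Prod>x\<in>#proots p. [:-x, 1:])"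
  have pr: "proots (\<Prod>x\<in>#M. [:-x, 1:]) = M" for M :: "real multiset"
  proof (induction M)
    case (add x M)
    have "0 \<notin># image_mset (\<lambda>x. [:-x, 1:]) M" by auto
    then have "(\<Prod>x\<in>#M. [:-x, 1:]) \<noteq> 0" by (simp add: prod_mset_zero_iff)
    then show ?case using add by (simp add: proots_mult del: mult_pCons_left)
  qed auto
  have r0: "r \<noteq> 0" unfolding r_def by (auto simp: prod_mset_zero_iff)
  have lr: "lead_coeff (\<Prod>x\<in>#M. [:-x, 1:]) = 1 \<and> degree (\<Prod>x\<in>#M. [:-x, 1:]) = size M" for M :: "real multiset"
  proof (induction M)
    case (add x M)
    then have nz: "(\<Prod>x\<in>#M. [:-x, 1:]) \<noteq> 0" by auto
    have "lead_coeff (\<Prod>x\<in>#add_mset x M. [:-x, 1:]) = 1"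
      unfolding image_mset_add_mset prod_mset.add_mset lead_coeff_mult by (simp only: add[THEN conjunct1]) simp
    moreover have "degree (\<Prod>x\<in>#add_mset x M. [:-x, 1:]) = size (add_mset x M)"
      unfolding image_mset_add_mset prod_mset.add_mset using add nz by (subst degree_mult_eq) auto
    ultimately show ?case by blast
  qed auto
  have "r dvd p"
  proof -
    have "M \<subseteq># proots q \<Longrightarrow> q \<noteq> 0 \<Longrightarrow> (\<Prod>x\<in>#M. [:-x, 1:]) dvd q" for M and q :: "real poly"
    proof (induction M arbitrary: q)
      case (add x M)
      then have "x \<in># proots q" by (meson insert_subset_eq_iff)
      then have "[:-x, 1:] dvd q" using add.prems by (simp add: poly_eq_0_iff_dvd)
      then obtain s where s: "q = [:-x, 1:] * s" by blast
      then have s0: "s \<noteq> 0" using add by auto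
      then have "proots q = add_mset x (proots s)"
        unfolding s by (subst proots_mult) auto
      then have "M \<subseteq># proots s" using add.prems by auto
      then have "(\<Prod>x\<in>#M. [:-x, 1:]) dvd s" using add.IH s0 by blast
      then show ?case unfolding s by (simp add: mult_dvd_mono del: mult_pCons_left)
    qed auto
    then show ?thesis unfolding r_def using p0 by blast
  qed
  then obtain s where s: "p = r * s" by blast
  have "degree r = degree p" using lr[of "proots p"] assms by (simp add: r_def real_rooted_def)
  then have "degree s = 0" using s p0 degree_mult_eq[of r s] r0 by auto
  then obtain c where c: "s = [:c:]" using degree_eq_zeroE by blast
  have "lead_coeff r = 1" unfolding r_def using lr by blast
  then have "lead_coeff p = c" unfolding s c lead_coeff_mult by simp
  moreover have "p = smult c r" using s c by simp
  ultimately show ?thesis unfolding r_def by metis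
qed

lemma real_rooted_factor:
  assumes "real_rooted p"
  shows "p = smult (lead_coeff p) (\<Prod>i<degree p. [:-sroot p i, 1:])"
  by (subst real_rooted_prod_mset[OF assms], subst proots_sroot[OF assms])
     (simp add: image_mset.compositionality o_def prod_unfold_prod_mset)

lemma poly_real_rooted:
  assumes "real_rooted p"
  shows "poly p z = lead_coeff p * (\<Prod>i<degree p. z - sroot p i)"
  by (subst real_rooted_factor[OF assms]) (simp add: poly_prod)

lemma poly_real_rooted_eq_0_iff:
  assumes "real_rooted p"
  shows "poly p z = 0 \<longleftrightarrow> (\<exists>i<degree p. z = sroot p i)"
  using assms by (auto simp: poly_real_rooted real_rooted_def)

lemma poly_sroot: "real_rooted p \<Longrightarrow> i < degree p \<Longrightarrow> poly p (sroot p i) = 0"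
  using poly_real_rooted_eq_0_iff by blast

lemma
  fixes x :: "nat \<Rightarrow> real"
  assumes p: "p = smult c (\<Prod>i<n. [:- x i, 1:])" and c: "c \<noteq> 0"
  shows degree_prod_linear: "degree p = n"
    and lead_coeff_prod_linear: "lead_coeff p = c"
    and proots_prod_linear: "proots p = image_mset x (mset_set {..<n})"
    and real_rooted_prod_linear: "real_rooted p"
proof -
  have dl: "degree (\<Prod>i<n. [:- x i, 1:]) = n \<and> lead_coeff (\<Prod>i<n. [:- x i, 1:]) = 1"
  proof (induction n)
    case (Suc n)
    have nz: "(\<Prod>i<n. [:- x i, 1:]) \<noteq> 0" by auto
    have "lead_coeff (\<Prod>i<Suc n. [:- x i, 1:]) = 1"
      unfolding prod.lessThan_Suc lead_coeff_mult by (simp only: Suc[THEN conjunct2]) simp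
    moreover have "degree (\<Prod>i<Suc n. [:- x i, 1:]) = Suc n"
      unfolding prod.lessThan_Suc using Suc nz by (subst degree_mult_eq) auto
    ultimately show ?case by blast
  qed auto
  then show d: "degree p = n" and "lead_coeff p = c"
    using p c dl by (simp, metis lead_coeff_smult mult_1_right)
  have "proots p = (\<Sum>i<n. proots [:- x i, 1:])"
    using p c by (simp add: proots_prod)
  also have "\<dots> = image_mset x (mset_set {..<n})"
    by (induction n) (auto simp: lessThan_Suc)
  finally show "proots p = image_mset x (mset_set {..<n})" .
  then show "real_rooted p" using d p c
    by (auto simp: real_rooted_def)
qed

text \<open>An increasing factorization determines the sorted roots. Limits of root vectors and
  affine changes of variable are traced back to \<open>sroot\<close> in this way.\<close>

lemma sroot_prod_linear:
  fixes x :: "nat \<Rightarrow> real"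
  assumes p: "p = smult c (\<Prod>i<n. [:- x i, 1:])" and c: "c \<noteq> 0"
    and mono: "\<And>i j. i \<le> j \<Longrightarrow> j < n \<Longrightarrow> x i \<le> x j" and i: "i < n"
  shows "sroot p i = x i"
proof -
  have "proots p = mset (map x [0..<n])"
    using proots_prod_linear[OF p c] by (simp add: lessThan_atLeast0)
  then have "sorted_list_of_multiset (proots p) = sort (map x [0..<n])"
    by (simp only: sorted_list_of_multiset_mset)
  also have "\<dots> = map x [0..<n]"
    by (intro sorted_sort_id) (auto simp: sorted_iff_nth_mono intro: mono)
  finally show ?thesis using i by (simp add: sroot_def)
qed

lemma size_filter_sroot:
  assumes "real_rooted p"
  shows "size (filter_mset (\<lambda>x. x \<in> S) (proots p)) = card {i. i < degree p \<and> sroot p i \<in> S}"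
proof -
  have "filter_mset (\<lambda>x. x \<in> S) (proots p)
    = image_mset (sroot p) (filter_mset (\<lambda>i. sroot p i \<in> S) (mset_set {..<degree p}))"
    by (subst proots_sroot[OF assms]) (simp add: filter_mset_image_mset)
  then show ?thesis by (simp add: conj_commute)
qed

section \<open>Interlacing of roots and critical points\<close>

lemma real_rooted_pderiv:
  assumes p: "real_rooted p" and d: "degree p > 0"
  shows "real_rooted (pderiv p)"
proof -
  have p': "pderiv p \<noteq> 0" using d by (auto simp: pderiv_eq_0_iff)
  have "degree p \<le> size (proots (pderiv p)) + 1"
    using size_filter_proots_pderiv[OF is_interval_univ p'] p by (simp add: real_rooted_def)
  moreover have "size (proots (pderiv p)) \<le> degree (pderiv p)" by (rule size_proots_le)
  ultimately show ?thesis using p' d by (auto simp: real_rooted_def degree_pderiv)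
qed

lemma card_sroot_bound:
  assumes p: "real_rooted p" and d: "degree p > 0" and S: "is_interval S"
  shows "card {i. i < degree p \<and> sroot p i \<in> S} \<le>
         card {i. i < degree (pderiv p) \<and> sroot (pderiv p) i \<in> S} + 1"
proof -
  have p': "pderiv p \<noteq> 0" using d by (auto simp: pderiv_eq_0_iff)
  show ?thesis using size_filter_proots_pderiv[OF S p']
    by (simp add: size_filter_sroot p d real_rooted_pderiv)
qed

text \<open>By counting on half-lines: if a critical point were out of order, the half-line bounded
  by the neighbouring root of p would contain at least two more roots than critical points, against
  Rolle.\<close>

lemma sroot_interlace:
  assumes p: "real_rooted p" and i: "Suc i < degree p"
  shows "sroot p i \<le> sroot (pderiv p) i" "sroot (pderiv p) i \<le> sroot p (Suc i)"
proof -
  let ?q = "pderiv p" and ?n = "degree p - 1"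
  have d: "degree p > 0" using i by simp
  have q: "real_rooted ?q" using p d by (rule real_rooted_pderiv)
  have dq: "degree ?q = ?n" by (rule degree_pderiv)
  show "sroot ?q i \<le> sroot p (Suc i)"
  proof (rule ccontr)
    assume H: "\<not> ?thesis"
    have "{..Suc i} \<subseteq> {j. j < degree p \<and> sroot p j \<in> {..sroot p (Suc i)}}"
      using i by (auto intro!: sroot_mono p)
    then have 1: "Suc (Suc i) \<le> card {j. j < degree p \<and> sroot p j \<in> {..sroot p (Suc i)}}"
      by (metis card_atMost card_mono finite_Collect_conjI finite_Collect_less_nat)
    have "{j. j < degree ?q \<and> sroot ?q j \<in> {..sroot p (Suc i)}} \<subseteq> {..<i}"
    proof safe
      fix j assume j: "j < degree ?q" "sroot ?q j \<le> sroot p (Suc i)"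
      show "j < i"
      proof (rule ccontr)
        assume "\<not> j < i"
        then have "sroot ?q i \<le> sroot ?q j" using j by (intro sroot_mono q) auto
        then show False using j H by simp
      qed
    qed
    then have "card {j. j < degree ?q \<and> sroot ?q j \<in> {..sroot p (Suc i)}} \<le> i"
      by (metis card_lessThan card_mono finite_lessThan)
    then show False using 1 card_sroot_bound[OF p d, of "{..sroot p (Suc i)}"] by auto
  qed
  show "sroot p i \<le> sroot ?q i"
  proof (rule ccontr)
    assume H: "\<not> ?thesis"
    have "{i..<degree p} \<subseteq> {j. j < degree p \<and> sroot p j \<in> {sroot p i..}}"
      using i by (auto intro!: sroot_mono p)
    then have 1: "degree p - i \<le> card {j. j < degree p \<and> sroot p j \<in> {sroot p i..}}"
      by (metis card_atLeastLessThan card_mono finite_Collect_conjI finite_Collect_less_nat)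
    have "{j. j < degree ?q \<and> sroot ?q j \<in> {sroot p i..}} \<subseteq> {Suc i..<?n}"
    proof safe
      fix j assume j: "j < degree ?q" "sroot p i \<le> sroot ?q j"
      show "j \<in> {Suc i..<?n}"
      proof (rule ccontr)
        assume "\<not> ?thesis"
        then have "sroot ?q j \<le> sroot ?q i" using j i dq by (intro sroot_mono q) auto
        then show False using j H by simp
      qed
    qed
    then have "card {j. j < degree ?q \<and> sroot ?q j \<in> {sroot p i..}} \<le> ?n - Suc i"
      by (metis card_atLeastLessThan card_mono finite_atLeastLessThan)
    then show False using 1 i card_sroot_bound[OF p d, of "{sroot p i..}"] by auto
  qed
qed

text \<open>The fundamental theorem of algebra supplies a root, hyperbolicity makes it real, and the
  quotient by its linear factor is again hyperbolic.\<close>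

lemma hyperbolic_imp_real_rooted: "hyperbolic p \<Longrightarrow> real_rooted p"
proof (induction "degree p" arbitrary: p)
  case 0
  then obtain c where c: "p = [:c:]" using degree_eq_zeroE[of p] by metis
  then have "c = 1" using 0 by (simp add: hyperbolic_def)
  then show ?case using c by (simp add: real_rooted_def)
next
  case (Suc n)
  let ?c = "map_poly complex_of_real"
  have "\<not> constant (poly (?c p))"
    using Suc.hyps(2)[symmetric] by (simp add: constant_degree degree_map_poly)
  then obtain z where z: "poly (?c p) z = 0"
    using fundamental_theorem_of_algebra by blast
  then have "z \<in> \<real>" using Suc.prems unfolding hyperbolic_def by blast
  then obtain x where x: "z = complex_of_real x" by (rule Reals_cases)
  moreover have "poly (?c s) (of_real x) = of_real (poly s x)" for s
    by (induction s) (simp_all add: map_poly_pCons)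
  ultimately have "poly p x = 0" using z by simp
  then obtain r where r: "p = [:-x, 1:] * r" by (auto simp: poly_eq_0_iff_dvd)
  have p0: "p \<noteq> 0" using Suc by auto
  then have r0: "r \<noteq> 0" using r by auto
  have dr: "degree p = Suc (degree r)" unfolding r using r0 by (subst degree_mult_eq) auto
  have "lead_coeff r = 1" using Suc.prems unfolding hyperbolic_def r lead_coeff_mult by simp
  moreover have "poly (?c r) w = 0 \<Longrightarrow> poly (?c p) w = 0" for w
  proof -
    have "?c p = ?c [:-x, 1:] * ?c r"
      unfolding r by (intro poly_eqI) (simp add: coeff_map_poly coeff_mult del: mult_pCons_left)
    then show "poly (?c r) w = 0 \<Longrightarrow> poly (?c p) w = 0" by simp
  qed
  ultimately have "hyperbolic r" using Suc.prems unfolding hyperbolic_def by blast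
  then have rr: "real_rooted r" using Suc dr by auto
  have "proots p = add_mset x (proots r)" unfolding r using r0 by (subst proots_mult) auto
  then show ?case using rr p0 dr by (simp add: real_rooted_def)
qed

section \<open>Zeros of higher derivatives and divided differences\<close>

lemma size_filter_proots_higher_pderiv:
  fixes p :: "real poly"
  assumes "is_interval S" "(pderiv ^^ k) p \<noteq> 0"
  shows "size (filter_mset (\<lambda>x. x \<in> S) (proots p))
           \<le> size (filter_mset (\<lambda>x. x \<in> S) (proots ((pderiv ^^ k) p))) + k"
  using assms(2)
proof (induction k)
  case (Suc k)
  have "(pderiv ^^ k) p \<noteq> 0" using Suc.prems by auto
  then show ?case using Suc size_filter_proots_pderiv[OF assms(1), of "(pderiv ^^ k) p"] by simp
qed simp

lemma higher_pderiv_monic: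
  fixes p :: "real poly"
  assumes "degree p = k" "coeff p k = 1"
  shows "(pderiv ^^ k) p = [:fact k:]"
proof (rule poly_eqI)
  fix n
  show "coeff ((pderiv ^^ k) p) n = coeff [:fact k:] n"
    using assms coeff_eq_0[of p "n + k"]
    by (cases n) (auto simp: coeff_higher_pderiv pochhammer_fact)
qed

text \<open>The value at z of the cofactor of a block of k roots is a divided difference of g, hence
  a value of the k-th derivative over k!. It is thus bounded above and below without any information
  on the roots outside the block.\<close>

lemma divided_difference:
  assumes g: "real_rooted g" and k: "i0 + k \<le> degree g" and Z: "is_interval Z" "z \<in> Z"
    and block: "\<And>i. i0 \<le> i \<Longrightarrow> i < i0 + k \<Longrightarrow> sroot g i \<in> Z"
  shows "\<exists>\<xi>\<in>Z. poly g z = (\<Prod>i=i0..<i0+k. z - sroot g i) * (poly ((pderiv ^^ k) g) \<xi> / fact k)"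
proof -
  define B where "B = (\<Prod>i=i0..<i0+k. [:- sroot g i, 1:])"
  define G where "G = smult (lead_coeff g) (\<Prod>i\<in>{..<degree g} - {i0..<i0+k}. [:- sroot g i, 1:])"
  have B': "B = smult 1 (\<Prod>i<k. [:- sroot g (i + i0), 1:])"
    unfolding B_def using prod.shift_bounds_nat_ivl[of "\<lambda>i. [:- sroot g i, 1:]" 0 i0 k]
    by (simp add: add.commute atLeast0LessThan)
  have dB: "degree B = k" and lB: "lead_coeff B = 1"
    and pB: "proots B = image_mset (\<lambda>i. sroot g (i + i0)) (mset_set {..<k})"
    using degree_prod_linear[OF B'] lead_coeff_prod_linear[OF B'] proots_prod_linear[OF B'] by auto
  have B0: "B \<noteq> 0" using lB by auto
  have gBG: "g = B * G"
  proof -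
    have *: "(\<Prod>i<degree g. [:- sroot g i, 1:]) =
        (\<Prod>i\<in>{..<degree g} - {i0..<i0+k}. [:- sroot g i, 1:]) * B"
      unfolding B_def by (rule prod.subset_diff) (use k in auto)
    have "B * G = smult (lead_coeff g) (\<Prod>i<degree g. [:- sroot g i, 1:])"
      by (simp only: * G_def mult_smult_right mult.commute[of B])
    also have "\<dots> = g" using real_rooted_factor[OF g] by (rule sym)
    finally show ?thesis by (rule sym)
  qed
  define c where "c = poly G z"
  \<comment> \<open>h is g minus the multiple of B that agrees with g at z. The factored form counts
    z in addition to the k block roots even if z is itself one of them, so h has k + 1 zeros in Z
    and its k-th derivative still has one.\<close>
  define h where "h = B * (G - [:c:])"
  have hg: "h = g - smult c B" unfolding h_def gBG by (simp add: right_diff_distrib mult.commute)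
  have dk: "(pderiv ^^ k) B = [:fact k:]" using higher_pderiv_monic[OF dB] lB dB by simp
  have gz: "poly g z = (\<Prod>i=i0..<i0+k. z - sroot g i) * c"
  proof -
    have "poly g z = poly (B * G) z" by (rule arg_cong[OF gBG])
    then show ?thesis by (simp add: c_def B_def poly_prod)
  qed
  have dh: "(pderiv ^^ k) h = (pderiv ^^ k) g - [:c * fact k:]"
  proof -
    have "h = g + smult (-c) B" using hg by simp
    then have "(pderiv ^^ k) h = (pderiv ^^ k) g + smult (-c) [:fact k:]"
      by (simp only: higher_pderiv_add higher_pderiv_smult dk)
    then show ?thesis by simp
  qed
  have "\<exists>\<xi>\<in>Z. poly ((pderiv ^^ k) h) \<xi> = 0"
  proof (cases "h = 0")
    case False
    then have G0: "G - [:c:] \<noteq> 0" by (auto simp: h_def)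
    have ph: "proots h = proots B + proots (G - [:c:])" unfolding h_def by (rule proots_mult[OF B0 G0])
    have "filter_mset (\<lambda>x. x \<in> Z) (proots B) = proots B"
      unfolding pB using block by (auto simp: filter_mset_eq_conv)
    then have 1: "size (filter_mset (\<lambda>x. x \<in> Z) (proots B)) = k" by (simp add: pB)
    have "z \<in># filter_mset (\<lambda>x. x \<in> Z) (proots (G - [:c:]))"
      using G0 Z by (simp add: c_def)
    then have "size (filter_mset (\<lambda>x. x \<in> Z) (proots (G - [:c:]))) > 0"
      by (metis count_empty gr0I not_in_iff size_eq_0_iff_empty)
    then have 2: "size (filter_mset (\<lambda>x. x \<in> Z) (proots h)) > k" using 1 by (simp add: ph)
    have "size (filter_mset (\<lambda>x. x \<in> Z) (proots h)) \<le> size (proots h)"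
      by (intro size_mset_mono) simp
    then have "degree h > k" using 2 size_proots_le[of h] by linarith
    then have "degree ((pderiv ^^ k) h) > 0" by (simp add: degree_higher_pderiv)
    then have nz: "(pderiv ^^ k) h \<noteq> 0" by auto
    then have "filter_mset (\<lambda>x. x \<in> Z) (proots ((pderiv ^^ k) h)) \<noteq> {#}"
      using size_filter_proots_higher_pderiv[OF Z(1) nz] 2 by force
    then obtain \<xi> where "\<xi> \<in># filter_mset (\<lambda>x. x \<in> Z) (proots ((pderiv ^^ k) h))" by blast
    then show ?thesis using nz by auto
  qed (use Z in auto)
  then obtain \<xi> where "\<xi> \<in> Z" "poly ((pderiv ^^ k) g) \<xi> = c * fact k" using dh by auto
  then show ?thesis using gz by (intro bexI[of _ \<xi>]) auto
qed

section \<open>Bounds and continuity of the roots\<close>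

lemma root_bound:
  fixes p :: "real poly"
  assumes x: "poly p x = 0" and p0: "p \<noteq> 0"
  shows "\<bar>x\<bar> \<le> 1 + (\<Sum>k<degree p. \<bar>coeff p k\<bar>) / \<bar>lead_coeff p\<bar>"
proof (cases "\<bar>x\<bar> \<le> 1")
  case True
  moreover have "0 \<le> (\<Sum>k<degree p. \<bar>coeff p k\<bar>) / \<bar>lead_coeff p\<bar>"
    by (intro divide_nonneg_nonneg sum_nonneg) auto
  ultimately show ?thesis by linarith
next
  case False
  have "degree p \<noteq> 0" using x p0 by (metis degree_eq_zeroE mult_zero_right pCons_0_0 poly_0 poly_pCons add.right_neutral)
  then obtain n where n: "degree p = Suc n" by (metis not0_implies_Suc)
  have l: "\<bar>lead_coeff p\<bar> > 0" using p0 by simp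
  have "lead_coeff p * x ^ degree p = - (\<Sum>k<degree p. coeff p k * x ^ k)"
    using x by (simp add: poly_altdef lessThan_Suc_atMost[symmetric])
  then have "\<bar>lead_coeff p\<bar> * \<bar>x\<bar> ^ degree p = \<bar>\<Sum>k<degree p. coeff p k * x ^ k\<bar>"
    by (metis abs_minus_cancel abs_mult power_abs)
  also have "\<dots> \<le> (\<Sum>k<degree p. \<bar>coeff p k\<bar> * \<bar>x\<bar> ^ k)"
    by (rule order_trans[OF sum_abs]) (simp add: abs_mult power_abs)
  also have "\<dots> \<le> (\<Sum>k<degree p. \<bar>coeff p k\<bar> * \<bar>x\<bar> ^ n)"
    using False n by (intro sum_mono mult_left_mono power_increasing) auto
  finally have "\<bar>lead_coeff p\<bar> * \<bar>x\<bar> ^ degree p \<le> (\<Sum>k<degree p. \<bar>coeff p k\<bar>) * \<bar>x\<bar> ^ n"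
    by (simp add: sum_distrib_right)
  then have "(\<bar>lead_coeff p\<bar> * \<bar>x\<bar>) * \<bar>x\<bar> ^ n \<le> (\<Sum>k<degree p. \<bar>coeff p k\<bar>) * \<bar>x\<bar> ^ n"
    by (simp add: n mult_ac)
  then have "\<bar>lead_coeff p\<bar> * \<bar>x\<bar> \<le> (\<Sum>k<degree p. \<bar>coeff p k\<bar>)"
    using False by (simp add: mult_le_cancel_right)
  then have "\<bar>x\<bar> \<le> (\<Sum>k<degree p. \<bar>coeff p k\<bar>) / \<bar>lead_coeff p\<bar>"
    using l by (simp add: pos_le_divide_eq mult.commute)
  then show ?thesis by linarith
qed

lemma convergent_subseq_finite:
  fixes x :: "nat \<Rightarrow> nat \<Rightarrow> real"
  assumes "\<And>i. i < n \<Longrightarrow> Bseq (\<lambda>k. x k i)"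
  shows "\<exists>r. strict_mono r \<and> (\<forall>i<n. convergent (\<lambda>k. x (r k) i))"
  using assms
proof (induction n)
  case 0
  show ?case by (intro exI[of _ id]) (auto simp: strict_mono_def)
next
  case (Suc n)
  then obtain r where r: "strict_mono r" "\<forall>i<n. convergent (\<lambda>k. x (r k) i)" by auto
  have "Bseq (\<lambda>k. x (r k) n)" using Suc.prems[of n] Bseq_subseq[of "\<lambda>k. x k n" r] by simp
  then have "bounded (range (\<lambda>k. x (r k) n))" by (simp add: Bseq_eq_bounded)
  then obtain l s where s: "strict_mono s" "((\<lambda>k. x (r k) n) \<circ> s) \<longlonglongrightarrow> l"
    using bounded_imp_convergent_subsequence by blast
  have "convergent (\<lambda>k. x (r (s k)) i)" if "i < Suc n" for i
  proof (cases "i = n")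
    case True
    then show ?thesis using s by (auto simp: convergent_def o_def)
  next
    case False
    then have "convergent (\<lambda>k. x (r k) i)" using r(2) that by simp
    then obtain l where "(\<lambda>k. x (r k) i) \<longlonglongrightarrow> l" by (auto simp: convergent_def)
    then have "((\<lambda>k. x (r k) i) \<circ> s) \<longlonglongrightarrow> l" using s(1) by (rule LIMSEQ_subseq_LIMSEQ)
    then show ?thesis by (auto simp: convergent_def o_def)
  qed
  moreover have "strict_mono (r \<circ> s)" using r(1) s(1) by (rule strict_mono_o)
  ultimately show ?case by (intro exI[of _ "r \<circ> s"]) (simp add: o_def)
qed

text \<open>By sequential compactness: root vectors along a convergent sequence of parameters are
  bounded, and every limit of a subsequence is an increasing list of the roots of the limit
  polynomial. There is only one such list.\<close>

lemma continuous_on_sroot: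
  fixes q :: "real \<Rightarrow> real poly"
  assumes q: "\<And>t. t \<in> S \<Longrightarrow> real_rooted (q t)" "\<And>t. t \<in> S \<Longrightarrow> degree (q t) = n"
      "\<And>t. t \<in> S \<Longrightarrow> lead_coeff (q t) = e"
    and cont: "\<And>k. continuous_on S (\<lambda>t. coeff (q t) k)" and i: "i < n"
  shows "continuous_on S (\<lambda>t. sroot (q t) i)"
  unfolding continuous_on_sequentially
proof (intro allI ballI impI)
  fix u t assume t: "t \<in> S" and u: "(\<forall>k. u k \<in> S) \<and> u \<longlonglongrightarrow> t"
  have e: "e \<noteq> 0" using q(1,3)[OF t] by (auto simp: real_rooted_def)
  have co: "(\<lambda>k. coeff (q (u k)) j) \<longlonglongrightarrow> coeff (q t) j" for j
    using cont[of j] t u unfolding continuous_on_sequentially o_def by blast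
  show "((\<lambda>t. sroot (q t) i) \<circ> u) \<longlonglongrightarrow> sroot (q t) i"
  proof (rule ccontr)
    assume "\<not> ?thesis"
    then obtain d where d: "d > 0"
      "\<not> eventually (\<lambda>k. dist (sroot (q (u k)) i) (sroot (q t) i) < d) sequentially"
      unfolding tendsto_iff o_def by blast
    obtain r :: "nat \<Rightarrow> nat" where r: "strict_mono r" "\<And>k. \<not> dist (sroot (q (u (r k))) i) (sroot (q t) i) < d"
      using not_eventually_sequentiallyD[OF d(2)] by metis
    have "Bseq (\<lambda>k. sroot (q (u (r k))) j)" if j: "j < n" for j
    proof -
      have "Bseq (\<lambda>k. 1 + (\<Sum>m<n. \<bar>coeff (q (u k)) m\<bar>) / \<bar>e\<bar>)"
      proof (intro convergent_imp_Bseq convergentI)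
        show "(\<lambda>k. 1 + (\<Sum>m<n. \<bar>coeff (q (u k)) m\<bar>) / \<bar>e\<bar>) \<longlonglongrightarrow> 1 + (\<Sum>m<n. \<bar>coeff (q t) m\<bar>) / \<bar>e\<bar>"
          by (intro tendsto_intros co) (use e in auto)
      qed
      then obtain K where K: "\<And>k. norm (1 + (\<Sum>m<n. \<bar>coeff (q (u k)) m\<bar>) / \<bar>e\<bar>) \<le> K"
        unfolding Bseq_def by blast
      have "\<bar>sroot (q (u k)) j\<bar> \<le> K" for k
      proof -
        have uk: "u k \<in> S" using u by blast
        have "\<bar>sroot (q (u k)) j\<bar> \<le> 1 + (\<Sum>m<degree (q (u k)). \<bar>coeff (q (u k)) m\<bar>) / \<bar>lead_coeff (q (u k))\<bar>"
          using q(1,2)[OF uk] j by (intro root_bound) (auto intro: poly_sroot simp: real_rooted_def)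
        also have "\<dots> = 1 + (\<Sum>m<n. \<bar>coeff (q (u k)) m\<bar>) / \<bar>e\<bar>"
          using q(2,3)[OF uk] by simp
        finally show ?thesis using K[of k] by simp
      qed
      then show ?thesis by (intro BseqI'[of _ K]) auto
    qed
    then obtain s where s: "strict_mono s" "\<forall>j<n. convergent (\<lambda>k. sroot (q (u (r (s k)))) j)"
      using convergent_subseq_finite[of n "\<lambda>k. sroot (q (u (r k)))"] by blast
    then obtain y where y: "\<And>j. j < n \<Longrightarrow> (\<lambda>k. sroot (q (u (r (s k)))) j) \<longlonglongrightarrow> y j"
      unfolding convergent_def by metis
    have rs: "strict_mono (r \<circ> s)" using r(1) s(1) by (rule strict_mono_o)
    have co': "(\<lambda>k. coeff (q (u (r (s k)))) j) \<longlonglongrightarrow> coeff (q t) j" for j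
      using LIMSEQ_subseq_LIMSEQ[OF co rs, of j] by (simp add: o_def)
    have uS: "u k \<in> S" for k using u by blast
    \<comment> \<open>The limit vector y factors \<open>q t\<close>. As y is also increasing, it is
      the vector of sorted roots, which contradicts the choice of the subsequence r.\<close>
    have "q t = smult e (\<Prod>j<n. [:- y j, 1:])"
    proof (rule poly_ext)
      fix z
      have 1: "(\<lambda>k. poly (q (u (r (s k)))) z) \<longlonglongrightarrow> poly (q t) z"
        unfolding poly_altdef q(2)[OF uS] q(2)[OF t] by (intro tendsto_intros co')
      have "poly (q (u (r (s k)))) z = e * (\<Prod>j<n. z - sroot (q (u (r (s k)))) j)" for k
        using poly_real_rooted[OF q(1)[OF uS]] q(2,3)[OF uS] by simp
      then have "(\<lambda>k. poly (q (u (r (s k)))) z) \<longlonglongrightarrow> e * (\<Prod>j<n. z - y j)"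
        by (simp only:) (intro tendsto_intros y, auto)
      then show "poly (q t) z = poly (smult e (\<Prod>j<n. [:- y j, 1:])) z"
        using LIMSEQ_unique[OF 1] by (simp add: poly_prod)
    qed
    moreover have "y j \<le> y l" if "j \<le> l" "l < n" for j l
      using that q(1,2)[OF uS] by (intro LIMSEQ_le[OF y y] exI[of _ 0]) (auto intro: sroot_mono)
    ultimately have "sroot (q t) i = y i" using e i by (intro sroot_prod_linear) auto
    then have "eventually (\<lambda>k. dist (sroot (q (u (r (s k)))) i) (sroot (q t) i) < d) sequentially"
      using y[OF i] d(1) by (auto simp: tendsto_iff)
    then show False using r(2) by auto
  qed
qed

section \<open>Taylor and Lipschitz estimates\<close>

(* Induction step: T(x) - 2^r T(x/2) has degree below r. *)
lemma coeff_bound_interval: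
  "\<exists>C\<ge>0. \<forall>c B. (\<forall>x\<in>{0..1::real}. \<bar>\<Sum>j<r. c j * x ^ j\<bar> \<le> B) \<longrightarrow> (\<forall>j<r. \<bar>c j\<bar> \<le> C * B)"
proof (induction r)
  case 0
  show ?case by (intro exI[of _ 0]) auto
next
  case (Suc r)
  then obtain C where C: "C \<ge> 0"
    "\<And>c B. (\<forall>x\<in>{0..1::real}. \<bar>\<Sum>j<r. c j * x ^ j\<bar> \<le> B) \<Longrightarrow> (\<forall>j<r. \<bar>c j\<bar> \<le> C * B)" by blast
  define C' where "C' = C * (1 + 2 ^ r)"
  have C'0: "C' \<ge> 0" using C(1) by (simp add: C'_def)
  have main: "\<bar>c j\<bar> \<le> (1 + r * C' + C') * B"
    if T: "\<forall>x\<in>{0..1::real}. \<bar>\<Sum>j<Suc r. c j * x ^ j\<bar> \<le> B" and j: "j < Suc r" for c B j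
  proof -
    have "0 \<le> \<bar>\<Sum>j<Suc r. c j * 1 ^ j\<bar>" by simp
    also have "\<dots> \<le> B" by (rule T[THEN bspec]) simp
    finally have B0: "0 \<le> B" .
    have S: "\<bar>\<Sum>j<r. (c j * (1 - 2 ^ r / 2 ^ j)) * x ^ j\<bar> \<le> (1 + 2 ^ r) * B" if x: "x \<in> {0..1}" for x :: real
    proof -
      have "(\<Sum>j<r. (c j * (1 - 2 ^ r / 2 ^ j)) * x ^ j)
          = (\<Sum>j<Suc r. c j * x ^ j) - 2 ^ r * (\<Sum>j<Suc r. c j * (x/2) ^ j)"
        by (simp add: sum_distrib_left sum_subtractf[symmetric] power_divide algebra_simps)
      also have "\<bar>\<dots>\<bar> \<le> \<bar>\<Sum>j<Suc r. c j * x ^ j\<bar> + \<bar>2 ^ r * (\<Sum>j<Suc r. c j * (x/2) ^ j)\<bar>"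
        by (rule abs_triangle_ineq4)
      also have "\<dots> \<le> B + 2 ^ r * B"
        unfolding abs_mult using T[THEN bspec, of x] T[THEN bspec, of "x/2"] x
        by (intro add_mono mult_mono) auto
      finally show ?thesis by (simp add: algebra_simps)
    qed
    have lower: "\<bar>c j\<bar> \<le> C' * B" if j: "j < r" for j
    proof -
      have "2 ^ r = 2 ^ (r - j) * (2::real) ^ j" using j by (simp flip: power_add)
      then have "2 ^ r / 2 ^ j = (2::real) ^ (r - j)" by simp
      moreover have "(2::real) ^ 1 \<le> 2 ^ (r - j)" using j by (intro power_increasing) auto
      \<comment> \<open>For j < r the factor 1 - 2^(r - j) has absolute value at least 1, so the
        coefficients of T are no larger than those of the combination of lower degree.\<close>
      ultimately have "1 \<le> \<bar>1 - 2 ^ r / 2 ^ j :: real\<bar>" by simp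
      then have "\<bar>c j\<bar> * 1 \<le> \<bar>c j\<bar> * \<bar>1 - 2 ^ r / 2 ^ j\<bar>" by (intro mult_left_mono) auto
      also have "\<dots> \<le> C * ((1 + 2 ^ r) * B)" using C(2)[of "\<lambda>j. c j * (1 - 2 ^ r / 2 ^ j)"] S j
        by (simp add: abs_mult)
      finally show ?thesis by (simp add: C'_def mult_ac)
    qed
    show ?thesis
    proof (cases "j < r")
      case True
      have "C' * B \<le> (1 + r * C' + C') * B" using B0 C'0 by (intro mult_right_mono) auto
      then show ?thesis using lower[OF True] by linarith
    next
      case False
      then have "j = r" using j by simp
      \<comment> \<open>The eliminated top coefficient is recovered from the value of the polynomial
        at 1.\<close>
      have "c r = (\<Sum>j<Suc r. c j * 1 ^ j) - (\<Sum>j<r. c j)" by simp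
      also have "\<bar>\<dots>\<bar> \<le> \<bar>\<Sum>j<Suc r. c j * 1 ^ j\<bar> + \<bar>\<Sum>j<r. c j\<bar>" by (rule abs_triangle_ineq4)
      also have "\<bar>\<Sum>j<Suc r. c j * 1 ^ j\<bar> \<le> B" by (rule T[THEN bspec]) simp
      also have "\<bar>\<Sum>j<r. c j\<bar> \<le> (\<Sum>j<r. C' * B)" by (rule order_trans[OF sum_abs]) (intro sum_mono lower, simp)
      finally have "\<bar>c r\<bar> \<le> (1 + r * C') * B" by (simp add: algebra_simps)
      also have "\<dots> \<le> (1 + r * C' + C') * B" using B0 C'0 by (intro mult_right_mono) auto
      finally show ?thesis using \<open>j = r\<close> by simp
    qed
  qed
  show ?case
    by (intro exI[of _ "1 + r * C' + C'"]) (use main C'0 in auto)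
qed

text \<open>An interpolation inequality of Landau type: bounds for a function and its m-th
  derivative control the derivatives in between. In the variable h / \<delta> the Taylor polynomial
  is bounded on [0, 1] by B + A \<delta>^m, so \<open>coeff_bound_interval\<close> bounds its
  coefficients, and all terms beyond the linear one are at most a multiple of (h / \<delta>)^2. C
  depends on m only.\<close>

lemma taylor_quadratic_bound:
  "\<exists>C>0. \<forall>D (t1::real) \<delta> A B. 0 < \<delta> \<longrightarrow>
     (\<forall>j<m. \<forall>t. \<bar>t - t1\<bar> \<le> \<delta> \<longrightarrow> (D j has_real_derivative D (Suc j) t) (at t)) \<longrightarrow>
     (\<forall>t. \<bar>t - t1\<bar> \<le> \<delta> \<longrightarrow> \<bar>D m t\<bar> \<le> A) \<longrightarrow> (\<forall>t. \<bar>t - t1\<bar> \<le> \<delta> \<longrightarrow> \<bar>D 0 t\<bar> \<le> B) \<longrightarrow> 2 \<le> m \<longrightarrow>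
     (\<forall>h. \<bar>h\<bar> \<le> \<delta> \<longrightarrow> \<bar>D 0 (t1 + h) - D 0 t1 - D 1 t1 * h\<bar> \<le> C * (B + A * \<delta> ^ m) * (h / \<delta>)\<^sup>2)"
proof -
  obtain C where C: "C \<ge> 0"
    "\<And>c B. (\<forall>x\<in>{0..1::real}. \<bar>\<Sum>j<m. c j * x ^ j\<bar> \<le> B) \<Longrightarrow> (\<forall>j<m. \<bar>c j\<bar> \<le> C * B)"
    using coeff_bound_interval[of m] by blast
  have main: "\<bar>D 0 (t1 + h) - D 0 t1 - D 1 t1 * h\<bar> \<le> (m * C + 1) * (B + A * \<delta> ^ m) * (h / \<delta>)\<^sup>2"
    if \<delta>: "0 < \<delta>" and D: "\<And>j t. j < m \<Longrightarrow> \<bar>t - t1\<bar> \<le> \<delta> \<Longrightarrow> (D j has_real_derivative D (Suc j) t) (at t)"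
    and A: "\<And>t. \<bar>t - t1\<bar> \<le> \<delta> \<Longrightarrow> \<bar>D m t\<bar> \<le> A" and B: "\<And>t. \<bar>t - t1\<bar> \<le> \<delta> \<Longrightarrow> \<bar>D 0 t\<bar> \<le> B"
    and m: "2 \<le> m" and h: "\<bar>h\<bar> \<le> \<delta>" for D :: "nat \<Rightarrow> real \<Rightarrow> real" and t1 \<delta> A B h :: real
  proof -
    define c where "c j = D j t1 / fact j * \<delta> ^ j" for j
    define B' where "B' = B + A * \<delta> ^ m"
    have A0: "0 \<le> A" using A[of t1] \<delta> by simp
    have B0: "0 \<le> B" using B[of t1] \<delta> by simp
    have taylor: "\<bar>D 0 (t1 + h) - (\<Sum>j<m. c j * (h / \<delta>) ^ j)\<bar> \<le> A * \<bar>h\<bar> ^ m" if h: "\<bar>h\<bar> \<le> \<delta>" for h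
    proof (cases "h = 0")
      case True
      obtain m' where m': "m = Suc m'" using m by (cases m) auto
      show ?thesis unfolding m' True sum.lessThan_Suc_shift by (simp add: c_def)
    next
      case False
      have "\<exists>t. (if t1 + h < t1 then t1 + h < t \<and> t < t1 else t1 < t \<and> t < t1 + h) \<and>
        D 0 (t1 + h) = (\<Sum>j<m. (D j t1 / fact j) * (t1 + h - t1) ^ j) + (D m t / fact m) * (t1 + h - t1) ^ m"
        by (rule Taylor[of m D "D 0" "t1 - \<delta>" "t1 + \<delta>"]) (use False h m D \<delta> in auto)
      then obtain t where t': "if t1 + h < t1 then t1 + h < t \<and> t < t1 else t1 < t \<and> t < t1 + h"
        and t2: "D 0 (t1 + h) = (\<Sum>j<m. (D j t1 / fact j) * (t1 + h - t1) ^ j) + (D m t / fact m) * (t1 + h - t1) ^ m"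
        by blast
      have t: "\<bar>t - t1\<bar> \<le> \<delta>"
        "D 0 (t1 + h) = (\<Sum>j<m. (D j t1 / fact j) * h ^ j) + (D m t / fact m) * h ^ m"
        using h t' t2 by (auto split: if_splits)
      have "(\<Sum>j<m. (D j t1 / fact j) * h ^ j) = (\<Sum>j<m. c j * (h / \<delta>) ^ j)"
        using \<delta> by (intro sum.cong) (auto simp: c_def power_divide)
      moreover have "\<bar>(D m t / fact m) * h ^ m\<bar> \<le> A * \<bar>h\<bar> ^ m"
      proof -
        have "\<bar>D m t\<bar> / fact m \<le> A / 1" using A[OF t(1)] A0 by (intro frac_le) (auto simp: fact_ge_1)
        then have "\<bar>D m t\<bar> / fact m * \<bar>h\<bar> ^ m \<le> A / 1 * \<bar>h\<bar> ^ m" by (rule mult_right_mono) simp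
        then show ?thesis by (simp add: abs_mult power_abs)
      qed
      ultimately show ?thesis using t(2) by simp
    qed
    have "\<bar>\<Sum>j<m. c j * x ^ j\<bar> \<le> B'" if x: "x \<in> {0..1}" for x
    proof -
      have dx: "\<bar>\<delta> * x\<bar> \<le> \<delta>" using x \<delta> by (auto simp: abs_mult mult_le_cancel_left1)
      have "\<bar>D 0 (t1 + \<delta> * x) - (\<Sum>j<m. c j * x ^ j)\<bar> \<le> A * \<bar>\<delta> * x\<bar> ^ m"
        using taylor[OF dx] \<delta> by simp
      also have "\<dots> \<le> A * \<delta> ^ m" using dx A0 by (intro mult_left_mono power_mono) auto
      finally show ?thesis using B[of "t1 + \<delta> * x"] dx by (simp add: B'_def)
    qed
    then have c: "\<bar>c j\<bar> \<le> C * B'" if "j < m" for j using C(2) that by blast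
    define x where "x = h / \<delta>"
    have x: "\<bar>x\<bar> \<le> 1" using h \<delta> by (simp add: x_def)
    have B'0: "B' \<ge> 0" using A0 B0 \<delta> by (simp add: B'_def)
    obtain m' where m': "m = Suc (Suc m')" using m by (metis Suc_le_D numeral_2_eq_2 Suc_le_mono)
    have "(\<Sum>j<m. c j * x ^ j) = D 0 t1 + D 1 t1 * h + (\<Sum>j<m'. c (Suc (Suc j)) * x ^ Suc (Suc j))"
      unfolding m' sum.lessThan_Suc_shift using \<delta> by (simp add: c_def x_def)
    moreover have "\<bar>\<Sum>j<m'. c (Suc (Suc j)) * x ^ Suc (Suc j)\<bar> \<le> m * (C * B' * x\<^sup>2)"
    proof -
      have "\<bar>\<Sum>j<m'. c (Suc (Suc j)) * x ^ Suc (Suc j)\<bar> \<le> (\<Sum>j<m'. C * B' * x\<^sup>2)"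
      proof (rule order_trans[OF sum_abs], rule sum_mono)
        fix j assume "j \<in> {..<m'}"
        have "\<bar>x\<bar> ^ Suc (Suc j) \<le> \<bar>x\<bar> ^ 2" using x by (intro power_decreasing) auto
        then show "\<bar>c (Suc (Suc j)) * x ^ Suc (Suc j)\<bar> \<le> C * B' * x\<^sup>2"
          unfolding abs_mult power_abs power2_abs using c[of "Suc (Suc j)"] m' \<open>j \<in> _\<close> C(1) B'0
          by (intro mult_mono) auto
      qed
      also have "\<dots> = m' * (C * B' * x\<^sup>2)" by simp
      also have "\<dots> \<le> m * (C * B' * x\<^sup>2)" using C(1) B'0 m' by (intro mult_right_mono) auto
      finally show ?thesis .
    qed
    moreover have "A * \<bar>h\<bar> ^ m \<le> B' * x\<^sup>2"
    proof -
      have "\<bar>h\<bar> = \<delta> * \<bar>x\<bar>" using \<delta> by (simp add: x_def)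
      then have "A * \<bar>h\<bar> ^ m = A * \<delta> ^ m * \<bar>x\<bar> ^ m" by (simp add: power_mult_distrib)
      also have "\<dots> \<le> B' * \<bar>x\<bar> ^ 2"
        using x m A0 B0 \<delta> by (intro mult_mono power_decreasing) (auto simp: B'_def)
      finally show ?thesis by simp
    qed
    ultimately have "\<bar>D 0 (t1 + h) - D 0 t1 - D 1 t1 * h\<bar> \<le> m * (C * B' * x\<^sup>2) + B' * x\<^sup>2"
      using taylor[OF h] unfolding x_def[symmetric] by linarith
    then show ?thesis unfolding x_def B'_def by (simp add: algebra_simps)
  qed
  show ?thesis
    by (rule exI[of _ "m * C + 1"]) (use main C(1) in \<open>auto intro: add_nonneg_pos\<close>)
qed

text \<open>The local hypothesis only compares with the centre x. In a bisection this suffices,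
  because a small interval around x is split at x and the two bounds add up.\<close>

lemma lipschitz_of_local:
  fixes g :: "real \<Rightarrow> real"
  assumes ab: "a \<le> b"
    and loc: "\<And>x. a \<le> x \<Longrightarrow> x \<le> b \<Longrightarrow> eventually (\<lambda>y. \<bar>g y - g x\<bar> \<le> L * \<bar>y - x\<bar>) (at x)"
  shows "\<bar>g b - g a\<bar> \<le> L * (b - a)"
  using ab
proof (induction rule: Bolzano[where P = "\<lambda>u v. \<bar>g v - g u\<bar> \<le> L * (v - u)"])
  case (trans u v w)
  then show ?case by (simp add: algebra_simps)
next
  case (local x)
  then obtain d where d: "d > 0" "\<And>y. y \<noteq> x \<Longrightarrow> dist y x < d \<Longrightarrow> \<bar>g y - g x\<bar> \<le> L * \<bar>y - x\<bar>"
    using loc unfolding eventually_at by (metis UNIV_I)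
  then have d': "\<bar>g y - g x\<bar> \<le> L * \<bar>y - x\<bar>" if "dist y x < d" for y
    using that by (cases "y = x") auto
  have "\<bar>g v - g u\<bar> \<le> L * (v - u)" if "u \<le> x \<and> x \<le> v \<and> v - u < d" for u v
  proof -
    have "\<bar>g u - g x\<bar> \<le> L * (x - u)" "\<bar>g v - g x\<bar> \<le> L * (v - x)"
      using d'[of u] d'[of v] that by (auto simp: dist_real_def)
    then show ?thesis by (simp add: algebra_simps)
  qed
  then show ?case using d(1) by blast
qed

(* A root can fail to be simple only where it coincides with one of the Lipschitz functions \<mu> k. *)
lemma lipschitz_glue:
  fixes g :: "real \<Rightarrow> real" and \<mu> :: "'k \<Rightarrow> real \<Rightarrow> real"
  assumes g: "continuous_on J g" and J: "open J" "is_interval J" and K: "finite K"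
    and \<mu>: "\<And>k. k \<in> K \<Longrightarrow> continuous_on J (\<mu> k)"
    and Lip: "\<And>k s t. k \<in> K \<Longrightarrow> s \<in> J \<Longrightarrow> t \<in> J \<Longrightarrow> \<bar>\<mu> k s - \<mu> k t\<bar> \<le> L * \<bar>s - t\<bar>"
    and off: "\<And>t. t \<in> J \<Longrightarrow> \<forall>k\<in>K. g t \<noteq> \<mu> k t \<Longrightarrow> eventually (\<lambda>s. \<bar>g s - g t\<bar> \<le> L * \<bar>s - t\<bar>) (at t)"
    and t: "t \<in> J"
  shows "eventually (\<lambda>s. \<bar>g s - g t\<bar> \<le> L * \<bar>s - t\<bar>) (at t)"
proof -
  define K0 where "K0 = {k\<in>K. \<mu> k t = g t}"
  have cg: "isCont g s" if "s \<in> J" for s using g J that by (simp add: continuous_on_eq_continuous_at)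
  have c\<mu>: "isCont (\<mu> k) s" if "s \<in> J" "k \<in> K" for s k
    using \<mu> J that by (simp add: continuous_on_eq_continuous_at)
  have "eventually (\<lambda>s. \<forall>k\<in>K - K0. g s \<noteq> \<mu> k s) (nhds t)"
  proof (intro eventually_ball_finite ballI)
    fix k assume k: "k \<in> K - K0"
    have "isCont (\<lambda>s. g s - \<mu> k s) t" using cg c\<mu> k t by (intro continuous_intros) auto
    moreover have "g t - \<mu> k t \<noteq> 0" using k by (auto simp: K0_def)
    ultimately have "eventually (\<lambda>s. g s - \<mu> k s \<noteq> 0) (nhds t)"
      using tendsto_imp_eventually_ne[of "\<lambda>s. g s - \<mu> k s" "g t - \<mu> k t" "at t" 0]
      by (simp add: isCont_def eventually_nhds_conv_at)
    then show "eventually (\<lambda>s. g s \<noteq> \<mu> k s) (nhds t)" by simp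
  qed (use K in simp)
  moreover have "eventually (\<lambda>s. s \<in> J) (nhds t)" using J(1) t by (rule eventually_nhds_in_open)
  ultimately have "eventually (\<lambda>s. s \<in> J \<and> (\<forall>k\<in>K - K0. g s \<noteq> \<mu> k s)) (nhds t)"
    by eventually_elim auto
  then obtain d where d: "d > 0" "\<And>s. dist s t < d \<Longrightarrow> s \<in> J \<and> (\<forall>k\<in>K - K0. g s \<noteq> \<mu> k s)"
    unfolding eventually_nhds_metric by blast
  show ?thesis
  proof (cases "K0 = {}")
    case True
    then have "\<forall>k\<in>K. g t \<noteq> \<mu> k t" unfolding K0_def by force
    then show ?thesis by (rule off[OF t])
  next
    case False
    have main: "\<bar>g s - g t\<bar> \<le> L * \<bar>s - t\<bar>" if s: "dist s t < d" for s
    proof -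
      define lo hi where "lo = min s t" and "hi = max s t"
      have near: "dist r t < d" if "lo \<le> r" "r \<le> hi" for r
        using that s by (auto simp: lo_def hi_def dist_real_def min_def max_def split: if_splits)
      have inJ: "{lo..hi} \<subseteq> J" using near d by auto
      \<comment> \<open>E collects the parameters between s and t at which g meets one of the \<mu>
        k that pass through \<open>g t\<close>. Its point r nearest to s splits the way: between t
        and r both values of g lie on one \<mu> k, and strictly between r and s the hypothesis
        \<open>off\<close> applies.\<close>
      define E where "E = (\<Union>k\<in>K0. {r\<in>{lo..hi}. g r - \<mu> k r = 0})"
      have "compact E" unfolding E_def
      proof (intro compact_UN)
        show "finite K0" using K by (simp add: K0_def)
        fix k assume k: "k \<in> K0"
        have "continuous_on {lo..hi} (\<lambda>r. g r - \<mu> k r)"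
          using g \<mu>[of k] k inJ by (intro continuous_intros) (auto simp: K0_def intro: continuous_on_subset)
        then have "closed {r\<in>{lo..hi}. g r - \<mu> k r = 0}"
          by (intro continuous_closed_preimage_constant) auto
        then have "compact ({lo..hi} \<inter> {r\<in>{lo..hi}. g r - \<mu> k r = 0})" by (intro compact_Int_closed) auto
        moreover have "{lo..hi} \<inter> {r\<in>{lo..hi}. g r - \<mu> k r = 0} = {r\<in>{lo..hi}. g r - \<mu> k r = 0}" by blast
        ultimately show "compact {r\<in>{lo..hi}. g r - \<mu> k r = 0}" by simp
      qed
      moreover have "t \<in> E" using False by (auto simp: E_def K0_def lo_def hi_def)
      ultimately obtain r where r: "r \<in> E" "\<And>r'. r' \<in> E \<Longrightarrow> \<bar>r - s\<bar> \<le> \<bar>r' - s\<bar>"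
        using continuous_attains_inf[of E "\<lambda>r. \<bar>r - s\<bar>"] by (force intro: continuous_intros)
      obtain k where k: "k \<in> K0" "g r = \<mu> k r" "lo \<le> r" "r \<le> hi" using r(1) by (auto simp: E_def)
      have rJ: "r \<in> J" using k inJ by auto
      have 1: "\<bar>g r - g t\<bar> \<le> L * \<bar>r - t\<bar>" using Lip[of k r t] k t rJ by (auto simp: K0_def)
      have 2: "\<bar>g s - g r\<bar> \<le> L * \<bar>s - r\<bar>"
      proof (cases "r = s")
        case False
        have step: "\<bar>g s - g (r + \<theta> * (s - r))\<bar> \<le> L * \<bar>s - (r + \<theta> * (s - r))\<bar>" if \<theta>: "0 < \<theta>" "\<theta> < 1" for \<theta>
        proof -
          define r' where "r' = r + \<theta> * (s - r)"
          have r's: "\<bar>r' - s\<bar> < \<bar>r - s\<bar>"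
          proof -
            have "r' - s = (1 - \<theta>) * (r - s)" by (simp add: r'_def algebra_simps)
            then show ?thesis using \<theta> False by (simp add: abs_mult)
          qed
          have "r' \<in> closed_segment r s"
            unfolding in_segment using \<theta> by (intro exI[of _ \<theta>]) (simp add: r'_def algebra_simps)
          then have "min r' s \<ge> lo \<and> max r' s \<le> hi"
            unfolding closed_segment_eq_real_ivl using k by (auto simp: lo_def hi_def min_def max_def abs_if split: if_splits)
          then have *: "eventually (\<lambda>y. \<bar>g y - g x\<bar> \<le> L * \<bar>y - x\<bar>) (at x)"
            if "min r' s \<le> x" "x \<le> max r' s" for x
          proof -
            assume H: "min r' s \<ge> lo \<and> max r' s \<le> hi"
            have x: "lo \<le> x" "x \<le> hi" using H that by auto
            have "\<bar>x - s\<bar> < \<bar>r - s\<bar>" using r's that by (auto simp: min_def max_def abs_if split: if_splits)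
            then have "x \<notin> E" using r(2) by force
            then have "\<forall>k\<in>K0. g x \<noteq> \<mu> k x" using x by (auto simp: E_def)
            moreover have "x \<in> J" "\<forall>k\<in>K - K0. g x \<noteq> \<mu> k x" using d(2)[OF near[OF x]] by auto
            ultimately show ?thesis by (intro off) auto
          qed
          have "\<bar>g (max r' s) - g (min r' s)\<bar> \<le> L * (max r' s - min r' s)"
            by (rule lipschitz_of_local) (use * in auto)
          then show ?thesis unfolding r'_def[symmetric] by (auto simp: min_def max_def abs_minus_commute split: if_splits)
        qed
        have c: "((\<lambda>\<theta>. r + \<theta> * (s - r)) \<longlongrightarrow> r + 0 * (s - r)) (at_right 0)" by (intro tendsto_intros)
        then have "((\<lambda>\<theta>. g (r + \<theta> * (s - r))) \<longlongrightarrow> g r) (at_right 0)"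
          using isCont_tendsto_compose[OF cg[OF rJ]] by simp
        then have "((\<lambda>\<theta>. \<bar>g s - g (r + \<theta> * (s - r))\<bar>) \<longlongrightarrow> \<bar>g s - g r\<bar>) (at_right 0)"
          by (intro tendsto_intros)
        moreover have "((\<lambda>\<theta>. L * \<bar>s - (r + \<theta> * (s - r))\<bar>) \<longlongrightarrow> L * \<bar>s - (r + 0 * (s - r))\<bar>) (at_right 0)"
          by (intro tendsto_intros)
        moreover have "eventually (\<lambda>\<theta>::real. \<bar>g s - g (r + \<theta> * (s - r))\<bar> \<le> L * \<bar>s - (r + \<theta> * (s - r))\<bar>) (at_right 0)"
          using eventually_at_right_less[of 0] eventually_at_right[of 0 "1::real"]
          unfolding eventually_at_right_field by (intro exI[of _ 1]) (use step in auto)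
        ultimately have "\<bar>g s - g r\<bar> \<le> L * \<bar>s - (r + 0 * (s - r))\<bar>"
          by (intro tendsto_le) auto
        then show ?thesis by simp
      qed auto
      have "\<bar>s - r\<bar> + \<bar>r - t\<bar> = \<bar>s - t\<bar>" using k(3,4) by (auto simp: lo_def hi_def)
      then have "L * \<bar>s - t\<bar> = L * \<bar>s - r\<bar> + L * \<bar>r - t\<bar>" by (metis distrib_left)
      then show ?thesis using 1 2 by linarith
    qed
    then show ?thesis unfolding eventually_at using d(1) by auto
  qed
qed

section \<open>Bronshtein's estimate\<close>

lemma poly_MVT_segment:
  fixes p :: "real poly"
  shows "\<exists>\<xi>\<in>closed_segment a b. poly p b - poly p a = (b - a) * poly (pderiv p) \<xi>"
proof (cases a b rule: linorder_cases)
  case less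
  then show ?thesis using poly_MVT[OF less, of p] by (force simp: closed_segment_eq_real_ivl)
next
  case greater
  then obtain x where "b < x" "x < a" "poly p a - poly p b = (a - b) * poly (pderiv p) x"
    using poly_MVT[OF greater, of p] by blast
  then show ?thesis using greater by (intro bexI[of _ x]) (auto simp: closed_segment_eq_real_ivl algebra_simps)
qed auto

(* The key estimate. Here x1 is a simple root of q at time t2, the \<mu> k are the critical points near
   it, and D 0 is the function t \<mapsto> q t x1. If r is the second smallest distance from x1 to a
   critical point, then the root of q t between two critical points bounds D 0 on a time interval of
   length about r; if \<rho> is the smallest distance, then the sign of q t at the nearest critical point
   bounds D 0 from one side on an interval of length about \<rho>. By Taylor's formula this bounds the
   time derivative of q at x1 by a multiple of its space derivative. *)
lemma critical_point_estimate:
  fixes m :: nat and gl gu L1 \<delta>0 w A1 :: real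
  assumes m: "1 \<le> m" and gl: "0 < gl" and gu: "0 \<le> gu" and L1: "1 \<le> L1"
    and \<delta>0: "0 < \<delta>0" and w: "0 < w" and A1: "0 \<le> A1"
  shows "\<exists>L\<ge>0. \<forall>(q::real \<Rightarrow> real poly) (\<mu>::nat \<Rightarrow> real \<Rightarrow> real) K Z x1 t2 \<sigma> \<nu> D.
     finite K \<longrightarrow> card K = m \<longrightarrow> is_interval Z \<longrightarrow> (\<forall>y\<in>Z. \<forall>z\<in>Z. \<bar>y - z\<bar> \<le> w) \<longrightarrow> x1 \<in> Z \<longrightarrow>
     (\<forall>k\<in>K. x1 \<noteq> \<mu> k t2) \<longrightarrow>
     (\<forall>t z. \<bar>t - t2\<bar> < \<delta>0 \<longrightarrow> z \<in> Z \<longrightarrow>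
        (\<exists>G. gl \<le> \<bar>G\<bar> \<and> \<bar>G\<bar> \<le> gu \<and> poly (pderiv (q t)) z = (\<Prod>k\<in>K. z - \<mu> k t) * G)) \<longrightarrow>
     (\<forall>t k. \<bar>t - t2\<bar> < \<delta>0 \<longrightarrow> k \<in> K \<longrightarrow> \<bar>\<mu> k t - \<mu> k t2\<bar> \<le> L1 * \<bar>t - t2\<bar>) \<longrightarrow>
     (\<forall>t k. \<bar>t - t2\<bar> < \<delta>0 \<longrightarrow> k \<in> K \<longrightarrow> \<mu> k t \<in> Z) \<longrightarrow>
     (\<forall>t k. \<bar>t - t2\<bar> < \<delta>0 \<longrightarrow> k \<in> K \<longrightarrow> 0 \<le> \<sigma> k * poly (q t) (\<mu> k t)) \<longrightarrow> (\<forall>k\<in>K. \<bar>\<sigma> k\<bar> = (1::real)) \<longrightarrow>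
     (\<forall>t a b. \<bar>t - t2\<bar> < \<delta>0 \<longrightarrow> a \<in> K \<longrightarrow> b \<in> K \<longrightarrow> a \<noteq> b \<longrightarrow>
         (\<exists>y\<in>closed_segment (\<mu> a t) (\<mu> b t). poly (q t) y = 0)) \<longrightarrow>
     (\<forall>t. \<bar>t - t2\<bar> < \<delta>0 \<longrightarrow> \<nu> t \<in> Z \<and> poly (q t) (\<nu> t) = 0) \<longrightarrow> \<nu> t2 = x1 \<longrightarrow> isCont \<nu> t2 \<longrightarrow>
     (\<forall>t. \<bar>t - t2\<bar> < \<delta>0 \<longrightarrow> D 0 t = poly (q t) x1) \<longrightarrow>
     (\<forall>j<Suc m. \<forall>t. \<bar>t - t2\<bar> < \<delta>0 \<longrightarrow> (D j has_real_derivative D (Suc j) t) (at t)) \<longrightarrow>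
     (\<forall>t. \<bar>t - t2\<bar> < \<delta>0 \<longrightarrow> \<bar>D (Suc m) t\<bar> \<le> A1) \<longrightarrow>
     eventually (\<lambda>t. \<bar>\<nu> t - \<nu> t2\<bar> \<le> L * \<bar>t - t2\<bar>) (at t2)"
proof -
  obtain C where C: "C > 0" "\<And>D (t1::real) \<delta> A B h. 0 < \<delta> \<Longrightarrow>
     (\<forall>j<Suc m. \<forall>t. \<bar>t - t1\<bar> \<le> \<delta> \<longrightarrow> (D j has_real_derivative D (Suc j) t) (at t)) \<Longrightarrow>
     (\<forall>t. \<bar>t - t1\<bar> \<le> \<delta> \<longrightarrow> \<bar>D (Suc m) t\<bar> \<le> A) \<Longrightarrow> (\<forall>t. \<bar>t - t1\<bar> \<le> \<delta> \<longrightarrow> \<bar>D 0 t\<bar> \<le> B) \<Longrightarrow> 2 \<le> Suc m \<Longrightarrow>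
     \<bar>h\<bar> \<le> \<delta> \<Longrightarrow> \<bar>D 0 (t1 + h) - D 0 t1 - D 1 t1 * h\<bar> \<le> C * (B + A * \<delta> ^ Suc m) * (h / \<delta>)\<^sup>2"
    using taylor_quadratic_bound[of "Suc m"] by metis
  \<comment> \<open>During a time \<epsilon> s a critical point moves by at most s, because L1
    \<epsilon> \<le> 1. The second term keeps the times \<epsilon> s with s \<le> w inside the
    radius \<delta>0.\<close>
  define \<epsilon> where "\<epsilon> = min (1 / L1) (\<delta>0 / (2 * w))"
  have \<epsilon>: "0 < \<epsilon>" "\<epsilon> \<le> 1" "L1 * \<epsilon> \<le> 1" "\<epsilon> * w < \<delta>0"
  proof -
    show "0 < \<epsilon>" using L1 \<delta>0 w by (simp add: \<epsilon>_def)
    have 1: "\<epsilon> \<le> 1 / L1" "\<epsilon> \<le> \<delta>0 / (2 * w)" by (simp_all add: \<epsilon>_def)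
    show "L1 * \<epsilon> \<le> 1" using 1(1) L1 by (simp add: pos_le_divide_eq mult.commute)
    have "1 / L1 \<le> 1" using L1 by simp
    then show "\<epsilon> \<le> 1" using 1(1) by linarith
    have "\<epsilon> * (2 * w) \<le> \<delta>0" using 1(2) w by (simp add: pos_le_divide_eq)
    moreover have "0 < \<epsilon> * w" using \<open>0 < \<epsilon>\<close> w by simp
    ultimately show "\<epsilon> * w < \<delta>0" by linarith
  qed
  \<comment> \<open>C1 bounds the variation of q over a distance 2 s, C4 is the second-order Taylor
    error at time scale \<epsilon> r, C6 results from the one-sided comparison at time scale
    \<epsilon> \<rho> a, and L from division by the lower bound of the space derivative.\<close>
  define C1 where "C1 = 2 * 4 ^ m * gu"
  define C4 where "C4 = C * (C1 + A1) / \<epsilon>\<^sup>2"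
  define C6 where "C6 = (C1 + C4 * \<epsilon>\<^sup>2) / \<epsilon>"
  define L where "L = (C6 + 1) * 2 ^ m / gl"
  have pos: "0 \<le> C1" "0 \<le> C4" "0 \<le> C6" "0 \<le> L"
    using gu C(1) A1 \<epsilon>(1) gl by (simp_all add: C1_def C4_def C6_def L_def)
  have "eventually (\<lambda>t. \<bar>\<nu> t - \<nu> t2\<bar> \<le> L * \<bar>t - t2\<bar>) (at t2)"
    if K: "finite K" "card K = m" and Z: "is_interval Z" and diam: "\<forall>y\<in>Z. \<forall>z\<in>Z. \<bar>y - z\<bar> \<le> w"
    and x1: "x1 \<in> Z" and off: "\<forall>k\<in>K. x1 \<noteq> \<mu> k t2"
    and fac: "\<forall>t z. \<bar>t - t2\<bar> < \<delta>0 \<longrightarrow> z \<in> Z \<longrightarrow>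
        (\<exists>G. gl \<le> \<bar>G\<bar> \<and> \<bar>G\<bar> \<le> gu \<and> poly (pderiv (q t)) z = (\<Prod>k\<in>K. z - \<mu> k t) * G)"
    and lip: "\<forall>t k. \<bar>t - t2\<bar> < \<delta>0 \<longrightarrow> k \<in> K \<longrightarrow> \<bar>\<mu> k t - \<mu> k t2\<bar> \<le> L1 * \<bar>t - t2\<bar>"
    and \<mu>Z: "\<forall>t k. \<bar>t - t2\<bar> < \<delta>0 \<longrightarrow> k \<in> K \<longrightarrow> \<mu> k t \<in> Z"
    and sign: "\<forall>t k. \<bar>t - t2\<bar> < \<delta>0 \<longrightarrow> k \<in> K \<longrightarrow> 0 \<le> \<sigma> k * poly (q t) (\<mu> k t)"
    and \<sigma>: "\<forall>k\<in>K. \<bar>\<sigma> k\<bar> = (1::real)"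
    and between: "\<forall>t a b. \<bar>t - t2\<bar> < \<delta>0 \<longrightarrow> a \<in> K \<longrightarrow> b \<in> K \<longrightarrow> a \<noteq> b \<longrightarrow>
         (\<exists>y\<in>closed_segment (\<mu> a t) (\<mu> b t). poly (q t) y = 0)"
    and \<nu>: "\<forall>t. \<bar>t - t2\<bar> < \<delta>0 \<longrightarrow> \<nu> t \<in> Z \<and> poly (q t) (\<nu> t) = 0" and \<nu>t2: "\<nu> t2 = x1" and \<nu>c: "isCont \<nu> t2"
    and D0: "\<forall>t. \<bar>t - t2\<bar> < \<delta>0 \<longrightarrow> D 0 t = poly (q t) x1"
    and D: "\<forall>j<Suc m. \<forall>t. \<bar>t - t2\<bar> < \<delta>0 \<longrightarrow> (D j has_real_derivative D (Suc j) t) (at t)"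
    and DA: "\<forall>t. \<bar>t - t2\<bar> < \<delta>0 \<longrightarrow> \<bar>D (Suc m) t\<bar> \<le> A1"
    for q :: "real \<Rightarrow> real poly" and \<mu> :: "nat \<Rightarrow> real \<Rightarrow> real" and K Z x1 t2 \<sigma> \<nu> and D :: "nat \<Rightarrow> real \<Rightarrow> real"
  proof -
    define \<rho> where "\<rho> k = \<bar>x1 - \<mu> k t2\<bar>" for k
    have \<rho>0: "0 < \<rho> k" if "k \<in> K" for k using off that by (simp add: \<rho>_def)
    have \<rho>w: "\<rho> k \<le> w" if "k \<in> K" for k using diam x1 \<mu>Z that \<delta>0 by (simp add: \<rho>_def)
    have Kne: "K \<noteq> {}" using K m by auto
    obtain a where a: "a \<in> K" "\<And>k. k \<in> K \<Longrightarrow> \<rho> a \<le> \<rho> k"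
      using ex_min_if_finite[of "\<rho> ` K"] K Kne by (metis (no_types, lifting) arg_min_if_finite(1) arg_min_least)
    define K' where "K' = K - {a}"
    have K': "finite K'" "card K' = m - 1" using K a by (simp_all add: K'_def)
    \<comment> \<open>Up to the cofactor G, the space derivative at x1 has size
      \<open>\<rho> a * \<Psi>\<close>. The estimates below carry the factor \<Psi>, which cancels
      at the end, so that no distance between roots enters L.\<close>
    define \<Psi> where "\<Psi> = (\<Prod>k\<in>K'. \<rho> k)"
    have \<Psi>0: "0 < \<Psi>" unfolding \<Psi>_def by (intro prod_pos) (use \<rho>0 K'_def in auto)
    have seg: "z \<in> Z" if "z \<in> closed_segment x y" "x \<in> Z" "y \<in> Z" for x y z
      using that Z is_interval_convex[OF Z] by (meson closed_segment_subset subsetD)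
    \<comment> \<open>With a single critical point there is no second smallest distance. Then w
      takes its place and \<nu> t itself is the root near x1.\<close>
    obtain r where r: "\<rho> a \<le> r" "r \<le> w" "\<And>k. k \<in> K' \<Longrightarrow> r \<le> \<rho> k"
      and yex: "\<And>t. \<bar>t - t2\<bar> \<le> \<epsilon> * r \<Longrightarrow> \<bar>t - t2\<bar> < \<delta>0 \<Longrightarrow> \<exists>y\<in>Z. poly (q t) y = 0 \<and> \<bar>y - x1\<bar> \<le> 2 * r"
    proof (cases "K' = {}")
      case True
      show ?thesis
      proof (rule that[of w])
        fix t assume t: "\<bar>t - t2\<bar> < \<delta>0"
        have "\<nu> t \<in> Z" "poly (q t) (\<nu> t) = 0" using \<nu> t by auto
        moreover have "\<bar>\<nu> t - x1\<bar> \<le> 2 * w" using diam[rule_format, OF calculation(1) x1] w by simp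
        ultimately show "\<exists>y\<in>Z. poly (q t) y = 0 \<and> \<bar>y - x1\<bar> \<le> 2 * w" by blast
      qed (use True \<rho>w[OF a(1)] in auto)
    next
      case False
      obtain b where b: "b \<in> K'" "\<And>k. k \<in> K' \<Longrightarrow> \<rho> b \<le> \<rho> k"
        using K' False by (metis (no_types, lifting) arg_min_if_finite(1) arg_min_least)
      have bK: "b \<in> K" "b \<noteq> a" using b by (auto simp: K'_def)
      show ?thesis
      proof (rule that[of "\<rho> b"])
        fix t assume t: "\<bar>t - t2\<bar> \<le> \<epsilon> * \<rho> b" "\<bar>t - t2\<bar> < \<delta>0"
        obtain y where y: "y \<in> closed_segment (\<mu> a t) (\<mu> b t)" "poly (q t) y = 0"
          using between t(2) a(1) bK by blast
        have "L1 * \<bar>t - t2\<bar> \<le> L1 * (\<epsilon> * \<rho> b)" using t(1) L1 by (intro mult_left_mono) auto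
        also have "\<dots> \<le> 1 * \<rho> b" using \<epsilon>(3) \<rho>0[OF bK(1)] by (simp only: mult.assoc[symmetric]) (intro mult_right_mono, auto)
        finally have "\<bar>\<mu> k t - \<mu> k t2\<bar> \<le> \<rho> b" if "k \<in> K" for k using lip t(2) that by force
        then have "\<bar>\<mu> a t - x1\<bar> \<le> 2 * \<rho> b" "\<bar>\<mu> b t - x1\<bar> \<le> 2 * \<rho> b"
          using a bK unfolding \<rho>_def by (smt (verit))+
        then have "\<bar>y - x1\<bar> \<le> 2 * \<rho> b"
          using y(1) by (auto simp: closed_segment_eq_real_ivl split: if_splits)
        moreover have "y \<in> Z" using seg[OF y(1)] \<mu>Z t(2) a(1) bK by blast
        ultimately show "\<exists>y\<in>Z. poly (q t) y = 0 \<and> \<bar>y - x1\<bar> \<le> 2 * \<rho> b" using y(2) by blast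
      qed (use a b bK \<rho>w in auto)
    qed
    have r0: "0 < r" using r(1) \<rho>0[OF a(1)] by linarith
    have \<epsilon>r: "\<epsilon> * r < \<delta>0"
    proof -
      have "\<epsilon> * r \<le> \<epsilon> * w" using r(2) \<epsilon>(1) by simp
      then show ?thesis using \<epsilon>(4) by linarith
    qed
    have prodK: "\<bar>\<Prod>k\<in>K. g k\<bar> = \<bar>g a\<bar> * (\<Prod>k\<in>K'. \<bar>g k\<bar>)" for g :: "nat \<Rightarrow> real"
      unfolding K'_def using K(1) a(1) by (simp add: prod.remove abs_mult abs_prod)
    have prod4: "(\<Prod>k\<in>K'. 4 * \<rho> k) \<le> 4 ^ m * \<Psi> / 4"
    proof -
      have "(4::real) ^ m = 4 * 4 ^ (m - 1)" using m by (cases m) auto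
      then show ?thesis by (simp add: prod.distrib \<Psi>_def K'(2))
    qed
    \<comment> \<open>The factor of the nearest critical point is at most 4 s, and each other factor
      is at most 4 \<rho> k because s \<le> r \<le> \<rho> k. This is why r is the second smallest
      distance and not a larger one.\<close>
    have Pzb: "\<bar>poly (pderiv (q t)) z\<bar> \<le> 4 ^ m * gu * s * \<Psi>"
      if t: "\<bar>t - t2\<bar> \<le> \<epsilon> * r" "L1 * \<bar>t - t2\<bar> \<le> s" and z: "z \<in> Z" "\<bar>z - x1\<bar> \<le> 2 * s" and s: "\<rho> a \<le> s" "s \<le> r" for t z s
    proof -
      have t': "\<bar>t - t2\<bar> < \<delta>0" using t \<epsilon>r by linarith
      obtain G where G: "\<bar>G\<bar> \<le> gu" "poly (pderiv (q t)) z = (\<Prod>k\<in>K. z - \<mu> k t) * G" using fac t' z by blast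
      have s0: "0 < s" using s \<rho>0[OF a(1)] by linarith
      have k: "\<bar>z - \<mu> k t\<bar> \<le> 3 * s + \<rho> k" if "k \<in> K" for k
        using lip[rule_format, OF t' that] t(2) z(2) unfolding \<rho>_def by linarith
      have "\<bar>\<Prod>k\<in>K. z - \<mu> k t\<bar> = \<bar>z - \<mu> a t\<bar> * (\<Prod>k\<in>K'. \<bar>z - \<mu> k t\<bar>)" by (rule prodK)
      also have "\<dots> \<le> (4 * s) * (\<Prod>k\<in>K'. 4 * \<rho> k)"
      proof (intro mult_mono prod_mono conjI)
        show "\<bar>z - \<mu> a t\<bar> \<le> 4 * s" using k[OF a(1)] s by linarith
        show "\<bar>z - \<mu> k t\<bar> \<le> 4 * \<rho> k" if "k \<in> K'" for k
          using k[of k] r(3)[OF that] s that by (auto simp: K'_def)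
      qed (use s0 in \<open>auto intro: prod_nonneg\<close>)
      also have "\<dots> \<le> (4 * s) * (4 ^ m * \<Psi> / 4)" using s0 prod4 by (intro mult_left_mono) auto
      finally have "\<bar>\<Prod>k\<in>K. z - \<mu> k t\<bar> \<le> 4 ^ m * s * \<Psi>" by (simp add: mult_ac)
      then have "\<bar>\<Prod>k\<in>K. z - \<mu> k t\<bar> * \<bar>G\<bar> \<le> (4 ^ m * s * \<Psi>) * gu"
        using G(1) s0 \<Psi>0 by (intro mult_mono) auto
      then show ?thesis unfolding G(2) abs_mult by (simp add: mult_ac)
    qed
    have diffb: "\<bar>poly (q t) x1 - poly (q t) y\<bar> \<le> C1 * s\<^sup>2 * \<Psi>"
      if t: "\<bar>t - t2\<bar> \<le> \<epsilon> * r" "L1 * \<bar>t - t2\<bar> \<le> s" and y: "y \<in> Z" "\<bar>y - x1\<bar> \<le> 2 * s" and s: "\<rho> a \<le> s" "s \<le> r" for t y s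
    proof -
      obtain \<xi> where \<xi>: "\<xi> \<in> closed_segment y x1" "poly (q t) x1 - poly (q t) y = (x1 - y) * poly (pderiv (q t)) \<xi>"
        using poly_MVT_segment by blast
      have s0: "0 < s" using s \<rho>0[OF a(1)] by linarith
      have "\<bar>\<xi> - x1\<bar> \<le> 2 * s" using \<xi>(1) y(2) by (auto simp: closed_segment_eq_real_ivl split: if_splits)
      then have "\<bar>poly (pderiv (q t)) \<xi>\<bar> \<le> 4 ^ m * gu * s * \<Psi>"
        using Pzb[OF t _ _ s] seg[OF \<xi>(1) y(1) x1] by blast
      then have "\<bar>x1 - y\<bar> * \<bar>poly (pderiv (q t)) \<xi>\<bar> \<le> (2 * s) * (4 ^ m * gu * s * \<Psi>)"
        using y(2) s0 by (intro mult_mono) auto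
      then show ?thesis unfolding \<xi>(2) abs_mult by (simp add: C1_def power2_eq_square mult_ac)
    qed
    have L1\<epsilon>: "L1 * h \<le> s" if "h \<le> \<epsilon> * s" "0 \<le> s" for h s
    proof -
      have "L1 * h \<le> L1 * (\<epsilon> * s)" using that L1 by (intro mult_left_mono) auto
      also have "\<dots> \<le> 1 * s" using \<epsilon>(3) that by (simp only: mult.assoc[symmetric]) (intro mult_right_mono, auto)
      finally show ?thesis by simp
    qed
    have fb: "\<bar>D 0 t\<bar> \<le> C1 * r\<^sup>2 * \<Psi>" if t: "\<bar>t - t2\<bar> \<le> \<epsilon> * r" for t
    proof -
      have t': "\<bar>t - t2\<bar> < \<delta>0" using t \<epsilon>r by linarith
      obtain y where "y \<in> Z" "poly (q t) y = 0" "\<bar>y - x1\<bar> \<le> 2 * r" using yex[OF t t'] by blast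
      then show ?thesis using diffb[OF t L1\<epsilon>[OF t] _ _ r(1)] D0 t' r0 by force
    qed
    define f1 where "f1 = D 1 t2"
    have D0t2: "D 0 t2 = 0" using D0 \<nu> \<delta>0 \<nu>t2 by force
    have \<Psi>r: "r ^ (m - 1) \<le> \<Psi>"
    proof -
      have "(\<Prod>k\<in>K'. r) \<le> \<Psi>" unfolding \<Psi>_def by (intro prod_mono) (use r r0 in auto)
      then show ?thesis using K' by simp
    qed
    \<comment> \<open>The m - 1 distances in \<Psi> are all at least r, hence r^(m + 1) \<le> r^2
      \<Psi>. Both parts of the Taylor error therefore carry r^2 \<Psi>, and the division by
      (\<epsilon> r)^2 removes r.\<close>
    have tay: "\<bar>D 0 (t2 + h) - f1 * h\<bar> \<le> C4 * \<Psi> * h\<^sup>2" if h: "\<bar>h\<bar> \<le> \<epsilon> * r" for h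
    proof -
      have "\<bar>D 0 (t2 + h) - D 0 t2 - D 1 t2 * h\<bar> \<le> C * (C1 * r\<^sup>2 * \<Psi> + A1 * (\<epsilon> * r) ^ Suc m) * (h / (\<epsilon> * r))\<^sup>2"
        by (rule C(2)) (use \<epsilon>(1) r0 D DA fb \<epsilon>r m h in auto)
      also have "\<dots> \<le> C * (C1 * r\<^sup>2 * \<Psi> + A1 * (r\<^sup>2 * \<Psi>)) * (h / (\<epsilon> * r))\<^sup>2"
      proof (intro mult_right_mono mult_left_mono add_left_mono)
        have "(\<epsilon> * r) ^ Suc m \<le> r ^ Suc m"
          using \<epsilon>(1,2) r0 by (intro power_mono) (auto simp: mult_le_cancel_right1)
        also have "r ^ Suc m = r\<^sup>2 * r ^ (m - 1)" using m by (simp flip: power_add)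
        also have "\<dots> \<le> r\<^sup>2 * \<Psi>" using \<Psi>r by (intro mult_left_mono) auto
        finally show "(\<epsilon> * r) ^ Suc m \<le> r\<^sup>2 * \<Psi>" .
      qed (use A1 C(1) in auto)
      also have "\<dots> = C4 * \<Psi> * h\<^sup>2" using \<epsilon>(1) r0 by (simp add: C4_def field_simps power2_eq_square)
      finally show ?thesis by (simp add: D0t2 f1_def)
    qed
    have f1b: "\<bar>f1\<bar> \<le> C6 * \<rho> a * \<Psi>"
    proof -
      \<comment> \<open>The direction of time is chosen so that the linear term f1 h opposes the
        sign of q at the nearest critical point. A large f1 would push the value at x1 further to
        the wrong side than the distance to that critical point permits.\<close>
      define h where "h = (if \<sigma> a * f1 \<ge> 0 then - (\<epsilon> * \<rho> a) else \<epsilon> * \<rho> a)"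
      have ha: "\<bar>h\<bar> = \<epsilon> * \<rho> a" using \<epsilon>(1) \<rho>0[OF a(1)] by (simp add: h_def)
      then have hr: "\<bar>h\<bar> \<le> \<epsilon> * r" using r(1) \<epsilon>(1) by simp
      have s1: "\<bar>\<sigma> a\<bar> = 1" using \<sigma> a(1) by blast
      have sf: "\<sigma> a * (f1 * h) = - (\<bar>f1\<bar> * (\<epsilon> * \<rho> a))"
      proof -
        have "\<sigma> a = 1 \<or> \<sigma> a = -1" using s1 by linarith
        then show ?thesis by (auto simp: h_def)
      qed
      have t': "\<bar>(t2 + h) - t2\<bar> < \<delta>0" using hr \<epsilon>r by simp
      have \<mu>a: "\<bar>\<mu> a (t2 + h) - x1\<bar> \<le> 2 * \<rho> a"
      proof -
        have "\<bar>\<mu> a (t2 + h) - \<mu> a t2\<bar> \<le> L1 * \<bar>t2 + h - t2\<bar>" using lip t' a(1) by blast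
        also have "\<dots> \<le> \<rho> a" using L1\<epsilon>[of "\<bar>h\<bar>" "\<rho> a"] ha \<rho>0[OF a(1)] by simp
        finally show ?thesis unfolding \<rho>_def by (smt (verit))
      qed
      have "\<bar>poly (q (t2 + h)) x1 - poly (q (t2 + h)) (\<mu> a (t2 + h))\<bar> \<le> C1 * (\<rho> a)\<^sup>2 * \<Psi>"
        by (rule diffb) (use hr L1\<epsilon>[of "\<bar>h\<bar>" "\<rho> a"] ha \<rho>0[OF a(1)] \<mu>Z[rule_format, OF t' a(1)] \<mu>a r(1) in auto)
      then have "\<bar>\<sigma> a * (D 0 (t2 + h) - poly (q (t2 + h)) (\<mu> a (t2 + h)))\<bar> \<le> C1 * (\<rho> a)\<^sup>2 * \<Psi>"
        using s1 D0 t' by (simp add: abs_mult)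
      moreover have "0 \<le> \<sigma> a * poly (q (t2 + h)) (\<mu> a (t2 + h))" using sign t' a(1) by blast
      ultimately have 1: "- (C1 * (\<rho> a)\<^sup>2 * \<Psi>) \<le> \<sigma> a * D 0 (t2 + h)" by (simp add: right_diff_distrib) 
      have "\<bar>\<sigma> a * (D 0 (t2 + h) - f1 * h)\<bar> \<le> C4 * \<Psi> * h\<^sup>2" using tay[OF hr] s1 by (simp add: abs_mult)
      then have "\<sigma> a * D 0 (t2 + h) \<le> C4 * \<Psi> * h\<^sup>2 - \<bar>f1\<bar> * (\<epsilon> * \<rho> a)" using sf by (simp add: right_diff_distrib)
      moreover have "h\<^sup>2 = \<epsilon>\<^sup>2 * (\<rho> a)\<^sup>2" using ha by (metis power2_abs power_mult_distrib)
      ultimately have "\<bar>f1\<bar> * (\<epsilon> * \<rho> a) \<le> C1 * (\<rho> a)\<^sup>2 * \<Psi> + C4 * \<Psi> * (\<epsilon>\<^sup>2 * (\<rho> a)\<^sup>2)" using 1 by simp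
      also have "\<dots> = (C6 * \<rho> a * \<Psi>) * (\<epsilon> * \<rho> a)" using \<epsilon>(1) by (simp add: C6_def field_simps power2_eq_square)
      finally show ?thesis using \<epsilon>(1) \<rho>0[OF a(1)] by (simp add: mult_le_cancel_right)
    qed
    \<comment> \<open>\<eta> may depend on the distances, since it restricts only the neighbourhood
      of t2 and not L. Within it x1 and the critical points give up at most half of each distance:
      \<xi> and \<mu> k each move by at most \<rho> a / 4.\<close>
    define \<eta> where "\<eta> = min (\<epsilon> * r) (min (\<rho> a / (4 * L1)) (\<rho> a / (C4 + 1)))"
    have \<eta>0: "0 < \<eta>" using \<epsilon>(1) r0 \<rho>0[OF a(1)] L1 pos by (simp add: \<eta>_def)
    have "eventually (\<lambda>t. dist (\<nu> t) x1 < \<rho> a / 4) (at t2)"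
      using \<nu>c \<rho>0[OF a(1)] unfolding isCont_def tendsto_iff \<nu>t2
      by (metis divide_pos_pos zero_less_numeral)
    moreover have "eventually (\<lambda>t. dist t t2 < \<eta>) (at t2)"
      using \<eta>0 unfolding eventually_at by auto
    ultimately show ?thesis
    proof eventually_elim
      case (elim t)
      define h where "h = t - t2"
      have h: "\<bar>h\<bar> < \<eta>" using elim by (simp add: h_def dist_real_def)
      have h1: "\<bar>h\<bar> \<le> \<epsilon> * r" "\<bar>h\<bar> \<le> \<rho> a / (4 * L1)" "\<bar>h\<bar> \<le> \<rho> a / (C4 + 1)" using h by (auto simp: \<eta>_def)
      have h2: "L1 * \<bar>h\<bar> \<le> \<rho> a / 4" using h1(2) L1 by (simp add: field_simps)
      have h3: "C4 * \<bar>h\<bar> \<le> \<rho> a"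
      proof -
        have "(C4 + 1) * \<bar>h\<bar> \<le> \<rho> a" using h1(3) pos(2) by (simp add: pos_le_divide_eq mult.commute)
        then show ?thesis by (simp add: algebra_simps)
      qed
      have t': "\<bar>t - t2\<bar> < \<delta>0" using h1(1) \<epsilon>r by (simp add: h_def)
      obtain \<xi> where \<xi>: "\<xi> \<in> closed_segment (\<nu> t) x1" "poly (q t) x1 - poly (q t) (\<nu> t) = (x1 - \<nu> t) * poly (pderiv (q t)) \<xi>"
        using poly_MVT_segment by blast
      have \<nu>Z: "\<nu> t \<in> Z" "poly (q t) (\<nu> t) = 0" using \<nu> t' by auto
      have \<xi>x: "\<bar>\<xi> - x1\<bar> \<le> \<rho> a / 4"
        using \<xi>(1) elim(1) by (auto simp: closed_segment_eq_real_ivl dist_real_def split: if_splits)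
      obtain G where G: "gl \<le> \<bar>G\<bar>" "poly (pderiv (q t)) \<xi> = (\<Prod>k\<in>K. \<xi> - \<mu> k t) * G"
        using fac t' seg[OF \<xi>(1) \<nu>Z(1) x1] by blast
      have k: "\<rho> k / 2 \<le> \<bar>\<xi> - \<mu> k t\<bar>" if "k \<in> K" for k
      proof -
        have "\<bar>\<mu> k t - \<mu> k t2\<bar> \<le> \<rho> a / 4" using lip[rule_format, OF t' that] h2 by (simp add: h_def)
        moreover have "\<rho> k \<le> \<bar>\<xi> - x1\<bar> + \<bar>\<xi> - \<mu> k t\<bar> + \<bar>\<mu> k t - \<mu> k t2\<bar>" unfolding \<rho>_def by arith
        ultimately show ?thesis using \<xi>x a(2)[OF that] by linarith
      qed
      have "\<rho> a * \<Psi> = (\<Prod>k\<in>K. \<rho> k)" unfolding \<Psi>_def K'_def using K(1) a(1) by (simp add: prod.remove)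
      then have "\<rho> a * \<Psi> / 2 ^ m = (\<Prod>k\<in>K. \<rho> k / 2)" using K by (simp add: prod_dividef)
      also have "\<dots> \<le> (\<Prod>k\<in>K. \<bar>\<xi> - \<mu> k t\<bar>)" using k \<rho>0 by (intro prod_mono) (auto simp: less_imp_le)
      also have "\<dots> = \<bar>\<Prod>k\<in>K. \<xi> - \<mu> k t\<bar>" by (simp add: abs_prod)
      finally have "\<rho> a * \<Psi> / 2 ^ m * gl \<le> \<bar>\<Prod>k\<in>K. \<xi> - \<mu> k t\<bar> * \<bar>G\<bar>"
        using G(1) gl \<Psi>0 \<rho>0[OF a(1)] by (intro mult_mono) auto
      then have Pz: "\<rho> a * \<Psi> * (gl / 2 ^ m) \<le> \<bar>poly (pderiv (q t)) \<xi>\<bar>" unfolding G(2) abs_mult by simp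
      have "\<bar>D 0 t\<bar> \<le> \<bar>f1 * h\<bar> + C4 * \<Psi> * h\<^sup>2" using tay[OF h1(1)] by (simp add: h_def)
      also have "\<dots> \<le> C6 * \<rho> a * \<Psi> * \<bar>h\<bar> + \<rho> a * \<Psi> * \<bar>h\<bar>"
      proof (rule add_mono)
        show "\<bar>f1 * h\<bar> \<le> C6 * \<rho> a * \<Psi> * \<bar>h\<bar>" unfolding abs_mult using f1b by (rule mult_right_mono) simp
        have "C4 * \<Psi> * h\<^sup>2 = (C4 * \<bar>h\<bar>) * \<Psi> * \<bar>h\<bar>" by (simp add: power2_eq_square)
        also have "\<dots> \<le> \<rho> a * \<Psi> * \<bar>h\<bar>" using h3 \<Psi>0 by (intro mult_right_mono) auto
        finally show "C4 * \<Psi> * h\<^sup>2 \<le> \<rho> a * \<Psi> * \<bar>h\<bar>" .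
      qed
      finally have "\<bar>D 0 t\<bar> \<le> (\<rho> a * \<Psi>) * ((C6 + 1) * \<bar>h\<bar>)" by (simp add: algebra_simps)
      moreover have "\<bar>D 0 t\<bar> = \<bar>x1 - \<nu> t\<bar> * \<bar>poly (pderiv (q t)) \<xi>\<bar>" using D0 t' \<xi>(2) \<nu>Z(2) by (simp add: abs_mult)
      moreover have "\<bar>x1 - \<nu> t\<bar> * (\<rho> a * \<Psi> * (gl / 2 ^ m)) \<le> \<bar>x1 - \<nu> t\<bar> * \<bar>poly (pderiv (q t)) \<xi>\<bar>"
        using Pz by (intro mult_left_mono) auto
      ultimately have "(\<rho> a * \<Psi>) * (\<bar>x1 - \<nu> t\<bar> * (gl / 2 ^ m)) \<le> (\<rho> a * \<Psi>) * ((C6 + 1) * \<bar>h\<bar>)"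
        by (simp add: mult_ac)
      then have "\<bar>x1 - \<nu> t\<bar> * (gl / 2 ^ m) \<le> (C6 + 1) * \<bar>h\<bar>"
        by (rule mult_left_le_imp_le) (use \<rho>0[OF a(1)] \<Psi>0 in simp)
      then have "\<bar>x1 - \<nu> t\<bar> \<le> L * \<bar>h\<bar>" using gl by (simp add: L_def field_simps)
      then show ?case by (simp add: \<nu>t2 h_def abs_minus_commute)
    qed
  qed
  then show ?thesis using pos(4) by (intro exI[of _ L]) blast
qed

section \<open>Root clusters with quantitative data\<close>

text \<open>The derivatives are explicit witnesses with one common bound A, because the slope
  constant has to be a function of A. The derivatives are two-sided, which fits open J.\<close>

definition smooth_coeffs :: "nat \<Rightarrow> real \<Rightarrow> real set \<Rightarrow> (real \<Rightarrow> real poly) \<Rightarrow> bool" where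
  "smooth_coeffs m A J q \<longleftrightarrow> (\<exists>D :: nat \<Rightarrow> nat \<Rightarrow> real \<Rightarrow> real. \<forall>k.
     (\<forall>t\<in>J. D k 0 t = coeff (q t) k) \<and>
     (\<forall>j<m. \<forall>t\<in>J. (D k j has_real_derivative D k (Suc j) t) (at t)) \<and>
     (\<forall>j\<le>m. \<forall>t\<in>J. \<bar>D k j t\<bar> \<le> A))"

text \<open>A constant positive leading coefficient in place of 1 keeps the class closed under
  \<open>pderiv\<close> and rescaling. It is quantified inside, so that estimates are uniform in e;
  its sign fixes the sign of the polynomial between its roots.\<close>

definition real_rooted_curve :: "nat \<Rightarrow> real set \<Rightarrow> (real \<Rightarrow> real poly) \<Rightarrow> bool" where
  "real_rooted_curve n J q \<longleftrightarrow>
     (\<exists>e>0. \<forall>t\<in>J. real_rooted (q t) \<and> degree (q t) = n \<and> lead_coeff (q t) = e)"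

(* The last condition keeps further roots out of Z, since m + 1 roots in Z would produce a zero of
   the m-th derivative, and it bounds the cofactor of the cluster away from 0. *)
definition root_cluster ::
    "nat \<Rightarrow> nat \<Rightarrow> real \<Rightarrow> real \<Rightarrow> real \<Rightarrow> real set \<Rightarrow> real set \<Rightarrow> nat \<Rightarrow> (real \<Rightarrow> real poly) \<Rightarrow> bool" where
  "root_cluster n m c A W J Z i0 q \<longleftrightarrow>
     Z \<subseteq> {-W..W} \<and> is_interval Z \<and> i0 + m \<le> n \<and> real_rooted_curve n J q \<and> smooth_coeffs m A J q \<and>
     (\<forall>t\<in>J. \<forall>i. i0 \<le> i \<longrightarrow> i < i0 + m \<longrightarrow> sroot (q t) i \<in> Z) \<and>
     (\<forall>t\<in>J. \<forall>z\<in>Z. c \<le> \<bar>poly ((pderiv ^^ m) (q t)) z\<bar>)"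

lemma smooth_coeffsE:
  assumes "smooth_coeffs m A J q"
  obtains D :: "nat \<Rightarrow> nat \<Rightarrow> real \<Rightarrow> real" where "\<And>k t. t \<in> J \<Longrightarrow> D k 0 t = coeff (q t) k"
    "\<And>k j t. j < m \<Longrightarrow> t \<in> J \<Longrightarrow> (D k j has_real_derivative D k (Suc j) t) (at t)"
    "\<And>k j t. j \<le> m \<Longrightarrow> t \<in> J \<Longrightarrow> \<bar>D k j t\<bar> \<le> A"
proof -
  obtain D where D: "\<forall>k. (\<forall>t\<in>J. D k 0 t = coeff (q t) k) \<and>
     (\<forall>j<m. \<forall>t\<in>J. (D k j has_real_derivative D k (Suc j) t) (at t)) \<and>
     (\<forall>j\<le>m. \<forall>t\<in>J. \<bar>D k j t\<bar> \<le> A)"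
    using assms unfolding smooth_coeffs_def by (elim exE)
  show ?thesis by (rule that[of D]) (use D in simp_all)
qed

lemma smooth_coeffs_bound:
  assumes "smooth_coeffs m A J q" "t \<in> J"
  shows "\<bar>coeff (q t) k\<bar> \<le> A"
proof (rule smooth_coeffsE[OF assms(1)])
  fix D :: "nat \<Rightarrow> nat \<Rightarrow> real \<Rightarrow> real"
  assume D: "\<And>k t. t \<in> J \<Longrightarrow> D k 0 t = coeff (q t) k" "\<And>k j t. j \<le> m \<Longrightarrow> t \<in> J \<Longrightarrow> \<bar>D k j t\<bar> \<le> A"
  show ?thesis using D(1)[OF assms(2), of k] D(2)[OF _ assms(2), of 0 k] by simp
qed

lemma smooth_coeffs_subset:
  assumes "smooth_coeffs m A J q" "J' \<subseteq> J"
  shows "smooth_coeffs m A J' q"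
proof (rule smooth_coeffsE[OF assms(1)])
  fix D :: "nat \<Rightarrow> nat \<Rightarrow> real \<Rightarrow> real"
  assume D: "\<And>k t. t \<in> J \<Longrightarrow> D k 0 t = coeff (q t) k"
    "\<And>k j t. j < m \<Longrightarrow> t \<in> J \<Longrightarrow> (D k j has_real_derivative D k (Suc j) t) (at t)"
    "\<And>k j t. j \<le> m \<Longrightarrow> t \<in> J \<Longrightarrow> \<bar>D k j t\<bar> \<le> A"
  show ?thesis unfolding smooth_coeffs_def
    by (intro exI[of _ D] allI conjI ballI impI) (use D assms(2) in \<open>simp_all add: subset_iff\<close>)
qed

lemma smooth_coeffs_pderiv:
  assumes q: "smooth_coeffs (Suc m) A J q" and n: "\<And>t. t \<in> J \<Longrightarrow> degree (q t) = n" and A: "0 \<le> A"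
  shows "smooth_coeffs m (real n * A) J (\<lambda>t. pderiv (q t))"
proof -
  obtain D where D: "\<And>k t. t \<in> J \<Longrightarrow> D k 0 t = coeff (q t) k"
    "\<And>k j t. j < Suc m \<Longrightarrow> t \<in> J \<Longrightarrow> (D k j has_real_derivative D k (Suc j) t) (at t)"
    "\<And>k j t. j \<le> Suc m \<Longrightarrow> t \<in> J \<Longrightarrow> \<bar>D k j t\<bar> \<le> A"
    using q by (rule smooth_coeffsE) blast
  define E where "E k j t = (if Suc k \<le> n then real (Suc k) * D (Suc k) j t else 0)" for k j t
  show ?thesis unfolding smooth_coeffs_def
  proof (intro exI[of _ E] allI conjI ballI impI)
    fix k t assume "t \<in> J"
    then show "E k 0 t = coeff (pderiv (q t)) k"
      using D(1) n by (auto simp: E_def coeff_pderiv intro: coeff_eq_0)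
  next
    fix k j t assume "j < m" "t \<in> J"
    then show "(E k j has_real_derivative E k (Suc j) t) (at t)"
      unfolding E_def by (cases "Suc k \<le> n") (auto intro!: DERIV_cmult D(2) simp del: of_nat_Suc)
  next
    fix k j t assume j: "j \<le> m" "t \<in> J"
    show "\<bar>E k j t\<bar> \<le> real n * A"
    proof (cases "Suc k \<le> n")
      case True
      then have "real (Suc k) * \<bar>D (Suc k) j t\<bar> \<le> real n * A"
        using D(3)[of j t "Suc k"] j by (intro mult_mono) auto
      then show ?thesis using True by (simp add: E_def abs_mult del: of_nat_Suc)
    qed (use A in \<open>simp add: E_def\<close>)
  qed
qed

lemma real_rooted_curve_pderiv:
  assumes "real_rooted_curve n J q" "0 < n"
  shows "real_rooted_curve (n - 1) J (\<lambda>t. pderiv (q t))"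
proof -
  obtain e where e: "e > 0" "\<And>t. t \<in> J \<Longrightarrow> real_rooted (q t) \<and> degree (q t) = n \<and> lead_coeff (q t) = e"
    using assms unfolding real_rooted_curve_def by blast
  have "lead_coeff (pderiv (q t)) = real n * e" if "t \<in> J" for t
  proof -
    have "degree (q t) = n" "coeff (q t) n = e" using e(2)[OF that] by metis+
    then show ?thesis using assms(2) by (simp add: degree_pderiv coeff_pderiv)
  qed
  then show ?thesis unfolding real_rooted_curve_def
    using e assms(2) by (intro exI[of _ "real n * e"]) (auto intro: real_rooted_pderiv simp: degree_pderiv)
qed

text \<open>The step from a cluster to its critical points. Interlacing places m critical points in
  the interval Z, and the constant c survives because the m-th derivative of
  \<open>pderiv (q t)\<close> is the derivative of order m + 1 of \<open>q t\<close>.\<close>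

lemma root_cluster_pderiv:
  assumes "root_cluster n (Suc m) c A W J Z i0 q" "0 \<le> A"
  shows "root_cluster (n - 1) m c (real n * A) W J Z i0 (\<lambda>t. pderiv (q t))"
proof -
  note q = assms(1)[unfolded root_cluster_def]
  have rr: "real_rooted (q t)" "degree (q t) = n" if "t \<in> J" for t
    using q that unfolding real_rooted_curve_def by blast+
  have "sroot (pderiv (q t)) i \<in> Z" if t: "t \<in> J" and i: "i0 \<le> i" "i < i0 + m" for t i
  proof -
    have "sroot (q t) i \<le> sroot (pderiv (q t)) i" "sroot (pderiv (q t)) i \<le> sroot (q t) (Suc i)"
      using sroot_interlace[OF rr(1)[OF t], of i] rr(2)[OF t] q i by auto
    moreover have "sroot (q t) i \<in> Z" "sroot (q t) (Suc i) \<in> Z" using q t i by auto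
    ultimately show ?thesis using q mem_is_interval_1_I by blast
  qed
  moreover have "smooth_coeffs m (real n * A) J (\<lambda>t. pderiv (q t))"
    using q rr assms(2) by (intro smooth_coeffs_pderiv) auto
  moreover have "real_rooted_curve (n - 1) J (\<lambda>t. pderiv (q t))"
    using q by (intro real_rooted_curve_pderiv) auto
  ultimately show ?thesis using q unfolding root_cluster_def by (auto simp: funpow_Suc_right simp del: funpow.simps)
qed

lemma root_cluster_subset:
  "root_cluster n m c A W J Z i0 q \<Longrightarrow> J' \<subseteq> J \<Longrightarrow> root_cluster n m c A W J' Z i0 q"
  unfolding root_cluster_def real_rooted_curve_def smooth_coeffs_def by (smt (verit) subsetD)

lemma continuous_on_sroot_curve:
  assumes "real_rooted_curve n J q" "smooth_coeffs m A J q" "i < n" "open J" "0 < m"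
  shows "continuous_on J (\<lambda>t. sroot (q t) i)"
proof -
  obtain e where e: "e > 0" "\<And>t. t \<in> J \<Longrightarrow> real_rooted (q t) \<and> degree (q t) = n \<and> lead_coeff (q t) = e"
    using assms(1) unfolding real_rooted_curve_def by blast
  obtain D where D: "\<And>k t. t \<in> J \<Longrightarrow> D k 0 t = coeff (q t) k"
    "\<And>k j t. j < m \<Longrightarrow> t \<in> J \<Longrightarrow> (D k j has_real_derivative D k (Suc j) t) (at t)"
    "\<And>k j t. j \<le> m \<Longrightarrow> t \<in> J \<Longrightarrow> \<bar>D k j t\<bar> \<le> A"
    using assms(2) by (rule smooth_coeffsE) blast
  have "continuous_on J (\<lambda>t. coeff (q t) k)" for k
  proof -
    have "continuous_on J (D k 0)"
      using D(2)[OF assms(5)] by (intro DERIV_continuous_on) (auto intro: has_field_derivative_at_within)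
    then show ?thesis by (rule continuous_on_eq) (rule D(1))
  qed
  then show ?thesis using e assms(3) by (intro continuous_on_sroot[of J q n e]) auto
qed

lemma poly_sum_atMost: "degree p \<le> n \<Longrightarrow> poly p z = (\<Sum>i\<le>n. coeff p i * z ^ i)"
  for p :: "'a::comm_semiring_1 poly"
  unfolding poly_altdef by (intro sum.mono_neutral_left) (auto simp: coeff_eq_0)

text \<open>The Pochhammer symbol is the factor that m differentiations produce in front of the
  coefficient of z^i.\<close>

definition poly_bound :: "nat \<Rightarrow> nat \<Rightarrow> real \<Rightarrow> real \<Rightarrow> real" where
  "poly_bound n m A W = (\<Sum>i\<le>n. pochhammer (1 + real i) m * A * W ^ i)"

lemma poly_bound_nonneg: "0 \<le> A \<Longrightarrow> 0 \<le> W \<Longrightarrow> 0 \<le> poly_bound n m A W"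
  unfolding poly_bound_def by (intro sum_nonneg mult_nonneg_nonneg pochhammer_nonneg) auto

lemma poly_bound:
  assumes "degree p \<le> n" "\<And>k. \<bar>coeff p k\<bar> \<le> A" "\<bar>z\<bar> \<le> W"
  shows "\<bar>poly ((pderiv ^^ m) p) z\<bar> \<le> poly_bound n m A W"
proof -
  have A: "0 \<le> A" using assms(2)[of 0] by linarith
  have W: "0 \<le> W" using assms(3) by linarith
  have "degree ((pderiv ^^ m) p) \<le> n" using assms(1) by (simp add: degree_higher_pderiv)
  then have "poly ((pderiv ^^ m) p) z = (\<Sum>i\<le>n. coeff ((pderiv ^^ m) p) i * z ^ i)" by (rule poly_sum_atMost)
  also have "\<bar>\<dots>\<bar> \<le> (\<Sum>i\<le>n. \<bar>coeff ((pderiv ^^ m) p) i * z ^ i\<bar>)" by (rule sum_abs)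
  also have "\<dots> \<le> poly_bound n m A W" unfolding poly_bound_def
  proof (rule sum_mono)
    fix i
    have "\<bar>coeff ((pderiv ^^ m) p) i\<bar> \<le> pochhammer (1 + real i) m * A"
      unfolding coeff_higher_pderiv abs_mult using assms(2)[of "i + m"]
      by (intro mult_mono) (auto simp: pochhammer_nonneg)
    moreover have "\<bar>z\<bar> ^ i \<le> W ^ i" using assms(3) by (intro power_mono) auto
    ultimately show "\<bar>coeff ((pderiv ^^ m) p) i * z ^ i\<bar> \<le> pochhammer (1 + real i) m * A * W ^ i"
      unfolding abs_mult power_abs using A
      by (intro mult_mono mult_nonneg_nonneg pochhammer_nonneg) auto
  qed
  finally show ?thesis .
qed

text \<open>Provides the time derivatives of the polynomial at a fixed point x, the function D of
  the key estimate.\<close>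

lemma smooth_coeffs_poly:
  assumes q: "smooth_coeffs m A J q" and n: "\<And>t. t \<in> J \<Longrightarrow> degree (q t) \<le> n" and x: "\<bar>x\<bar> \<le> W" and A: "0 \<le> A"
  shows "\<exists>D::nat \<Rightarrow> real \<Rightarrow> real. (\<forall>t\<in>J. D 0 t = poly (q t) x) \<and>
     (\<forall>j<m. \<forall>t\<in>J. (D j has_real_derivative D (Suc j) t) (at t)) \<and>
     (\<forall>t\<in>J. \<bar>D m t\<bar> \<le> poly_bound n 0 A W)"
proof -
  obtain D where D: "\<And>k t. t \<in> J \<Longrightarrow> D k 0 t = coeff (q t) k"
    "\<And>k j t. j < m \<Longrightarrow> t \<in> J \<Longrightarrow> (D k j has_real_derivative D k (Suc j) t) (at t)"
    "\<And>k j t. j \<le> m \<Longrightarrow> t \<in> J \<Longrightarrow> \<bar>D k j t\<bar> \<le> A"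
    using q by (rule smooth_coeffsE) blast
  define E where "E j t = (\<Sum>k\<le>n. D k j t * x ^ k)" for j t
  show ?thesis
  proof (intro exI[of _ E] conjI ballI allI impI)
    fix t assume t: "t \<in> J"
    show "E 0 t = poly (q t) x" unfolding E_def using D(1)[OF t] poly_sum_atMost[OF n[OF t], of x] by simp
    have "\<bar>E m t\<bar> \<le> (\<Sum>k\<le>n. \<bar>D k m t * x ^ k\<bar>)" unfolding E_def by (rule sum_abs)
    also have "\<dots> \<le> (\<Sum>k\<le>n. A * W ^ k)"
    proof (rule sum_mono)
      fix k
      have "\<bar>x\<bar> ^ k \<le> W ^ k" using x by (intro power_mono) auto
      then show "\<bar>D k m t * x ^ k\<bar> \<le> A * W ^ k"
        unfolding abs_mult power_abs using D(3)[of m t k] t A by (intro mult_mono) auto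
    qed
    finally show "\<bar>E m t\<bar> \<le> poly_bound n 0 A W" by (simp add: poly_bound_def)
  next
    fix j t assume "j < m" "t \<in> J"
    then show "(E j has_real_derivative E (Suc j) t) (at t)"
      unfolding E_def by (auto intro!: derivative_eq_intros D(2) sum.cong)
  qed
qed

text \<open>Between neighbouring roots the sign is decided by the number of larger roots, which is
  \<open>degree p - Suc i\<close> with indices from 0. The weak inequality also covers coinciding
  roots.\<close>

lemma sroot_sign:
  assumes p: "real_rooted p" "lead_coeff p > 0" and i: "Suc i < degree p"
    and z: "sroot p i \<le> z" "z \<le> sroot p (Suc i)"
  shows "0 \<le> (- 1) ^ (degree p - Suc i) * poly p z"
proof -
  let ?n = "degree p" and ?X = "\<Prod>j\<le>i. z - sroot p j" and ?Y = "\<Prod>j=Suc i..<degree p. sroot p j - z"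
  have S: "{..<?n} = {..i} \<union> {Suc i..<?n}" using i by auto
  have "(\<Prod>j\<in>{..i} \<union> {Suc i..<?n}. z - sroot p j) = ?X * (\<Prod>j=Suc i..<?n. z - sroot p j)"
    by (rule prod.union_disjoint) auto
  also have "(\<Prod>j=Suc i..<?n. z - sroot p j) = (\<Prod>j=Suc i..<?n. (-1) * (sroot p j - z))" by simp
  also have "\<dots> = (-1) ^ (?n - Suc i) * ?Y" unfolding prod.distrib by simp
  finally have "(\<Prod>j<?n. z - sroot p j) = ?X * ((-1) ^ (?n - Suc i) * ?Y)" unfolding S .
  then have "(-1) ^ (?n - Suc i) * poly p z = ((-1) ^ (?n - Suc i) * (-1) ^ (?n - Suc i)) * (lead_coeff p * (?X * ?Y))"
    by (simp only: poly_real_rooted[OF p(1)] mult_ac)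
  then have "(-1) ^ (?n - Suc i) * poly p z = lead_coeff p * (?X * ?Y)"
    by (simp flip: power_mult_distrib)
  moreover have "0 \<le> ?X"
    using i z by (intro prod_nonneg) (auto intro: order_trans[OF sroot_mono[OF p(1)]])
  moreover have "0 \<le> ?Y"
    using i z by (intro prod_nonneg) (auto intro: order_trans[OF _ sroot_mono[OF p(1)]])
  ultimately show ?thesis using p(2) by simp
qed

section \<open>The uniform slope bound\<close>

text \<open>L precedes q, t1, Z and i0, so one constant serves a whole family of rescaled curves.
  The critical points of a cluster form a smaller cluster of the derivative, whose slopes the
  induction hypothesis bounds. The induction generalizes n, d and A, since the derivative changes n
  and A and the windows shrink.\<close>

theorem root_cluster_slope:
  assumes c: "0 < c" and d: "0 < d" and A: "0 \<le> A" and W: "0 < W"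
  shows "\<exists>L\<ge>0. \<forall>q t1 Z i0 i. root_cluster n (Suc m) c A W {t1-d<..<t1+d} Z i0 q \<longrightarrow> i0 \<le> i \<longrightarrow> i \<le> i0 + m \<longrightarrow>
    eventually (\<lambda>t. \<bar>sroot (q t) i - sroot (q t1) i\<bar> \<le> L * \<bar>t - t1\<bar>) (at t1)"
  using d A
proof (induction m arbitrary: n d A)
  case 0
  \<comment> \<open>A single root: the space derivative is at least c on Z, so the mean value
    theorem in t and in z gives the slope A1 / c.\<close>
  note d = 0(1) and A = 0(2)
  define A1 where "A1 = poly_bound n 0 A W"
  have A10: "0 \<le> A1" unfolding A1_def using A W by (intro poly_bound_nonneg) auto
  have "eventually (\<lambda>t. \<bar>sroot (q t) i - sroot (q t1) i\<bar> \<le> A1 / c * \<bar>t - t1\<bar>) (at t1)"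
    if q: "root_cluster n (Suc 0) c A W {t1-d<..<t1+d} Z i0 q" and i: "i0 \<le> i" "i \<le> i0 + 0" for q t1 Z i0 i
  proof -
    let ?J = "{t1-d<..<t1+d}"
    note q' = q[unfolded root_cluster_def]
    have rr: "real_rooted (q t)" "degree (q t) = n" if "t \<in> ?J" for t
      using q' that unfolding real_rooted_curve_def by blast+
    define x where "x = sroot (q t1) i"
    have t1: "t1 \<in> ?J" using d by simp
    have sZ: "sroot (q t) i \<in> Z" "poly (q t) (sroot (q t) i) = 0" if "t \<in> ?J" for t
      using q' i that rr[OF that] by (auto intro!: poly_sroot)
    have "x \<in> {-W..W}" using sZ(1)[OF t1] q' unfolding x_def by blast
    then have xW: "\<bar>x\<bar> \<le> W" by auto
    obtain D :: "nat \<Rightarrow> real \<Rightarrow> real" where D: "\<forall>t\<in>?J. D 0 t = poly (q t) x"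
      "\<forall>j<Suc 0. \<forall>t\<in>?J. (D j has_real_derivative D (Suc j) t) (at t)" "\<forall>t\<in>?J. \<bar>D (Suc 0) t\<bar> \<le> A1"
      using smooth_coeffs_poly[of "Suc 0" A ?J q n x W] q' rr xW A unfolding A1_def by auto
    have main: "\<bar>sroot (q t) i - x\<bar> \<le> A1 / c * \<bar>t - t1\<bar>" if t: "t \<in> ?J" for t
    proof -
      have "norm (D 0 t - D 0 t1) \<le> A1 * norm (t - t1)"
      proof (rule field_differentiable_bound[of ?J "D 0" "D 1"])
        show "(D 0 has_field_derivative D 1 z) (at z within ?J)" if "z \<in> ?J" for z
          using D(2) that by (auto intro: has_field_derivative_at_within)
      qed (use D t t1 in auto)
      then have f: "\<bar>poly (q t) x\<bar> \<le> A1 * \<bar>t - t1\<bar>" using D(1) t t1 sZ(2)[OF t1] by (simp add: x_def)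
      obtain \<xi> where \<xi>: "\<xi> \<in> closed_segment (sroot (q t) i) x"
        "poly (q t) x - poly (q t) (sroot (q t) i) = (x - sroot (q t) i) * poly (pderiv (q t)) \<xi>"
        using poly_MVT_segment by blast
      have "closed_segment (sroot (q t) i) x \<subseteq> Z"
        using sZ(1)[OF t] sZ(1)[OF t1] q' by (intro closed_segment_subset is_interval_convex) (auto simp: x_def)
      then have "c \<le> \<bar>poly (pderiv (q t)) \<xi>\<bar>" using \<xi>(1) q' t by auto
      then have "\<bar>x - sroot (q t) i\<bar> * c \<le> \<bar>x - sroot (q t) i\<bar> * \<bar>poly (pderiv (q t)) \<xi>\<bar>"
        by (intro mult_left_mono) auto
      also have "\<dots> = \<bar>poly (q t) x\<bar>" using \<xi>(2) sZ(2)[OF t] by (simp add: abs_mult)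
      finally show ?thesis using f c by (simp add: field_simps abs_minus_commute)
    qed
    show ?thesis unfolding eventually_at x_def[symmetric]
      by (intro exI[of _ d]) (use main d in \<open>auto simp: dist_real_def abs_less_iff\<close>)
  qed
  then show ?case using A10 c by (intro exI[of _ "A1 / c"]) auto
next
  case (Suc m)
  note d = Suc.prems(1) and A = Suc.prems(2)
  obtain L' where L': "L' \<ge> 0" "\<And>q t1 Z i0 i. root_cluster (n - 1) (Suc m) c (real n * A) W {t1-d/2<..<t1+d/2} Z i0 q \<Longrightarrow>
      i0 \<le> i \<Longrightarrow> i \<le> i0 + m \<Longrightarrow> eventually (\<lambda>t. \<bar>sroot (q t) i - sroot (q t1) i\<bar> \<le> L' * \<bar>t - t1\<bar>) (at t1)"
    using Suc.IH[of "d/2" "real n * A" "n - 1"] d A by auto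
  define L1 where "L1 = max 1 L'"
  define gl where "gl = c / fact (Suc m)"
  define gu where "gu = poly_bound n (Suc (Suc m)) A W / fact (Suc m)"
  define A1 where "A1 = poly_bound n 0 A W"
  have cs: "1 \<le> Suc m" "0 < gl" "0 \<le> gu" "1 \<le> L1" "0 < d / 4" "0 < 2 * W" "0 \<le> A1"
    using c d A W unfolding gl_def gu_def A1_def L1_def
    by (auto intro!: divide_nonneg_pos poly_bound_nonneg)
  obtain L where L: "L \<ge> 0" and crit: "\<forall>(q::real \<Rightarrow> real poly) (\<mu>::nat \<Rightarrow> real \<Rightarrow> real) K Z x1 t2 \<sigma> \<nu> D.
     finite K \<longrightarrow> card K = Suc m \<longrightarrow> is_interval Z \<longrightarrow> (\<forall>y\<in>Z. \<forall>z\<in>Z. \<bar>y - z\<bar> \<le> 2 * W) \<longrightarrow> x1 \<in> Z \<longrightarrow>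
     (\<forall>k\<in>K. x1 \<noteq> \<mu> k t2) \<longrightarrow>
     (\<forall>t z. \<bar>t - t2\<bar> < d / 4 \<longrightarrow> z \<in> Z \<longrightarrow>
        (\<exists>G. gl \<le> \<bar>G\<bar> \<and> \<bar>G\<bar> \<le> gu \<and> poly (pderiv (q t)) z = (\<Prod>k\<in>K. z - \<mu> k t) * G)) \<longrightarrow>
     (\<forall>t k. \<bar>t - t2\<bar> < d / 4 \<longrightarrow> k \<in> K \<longrightarrow> \<bar>\<mu> k t - \<mu> k t2\<bar> \<le> L1 * \<bar>t - t2\<bar>) \<longrightarrow>
     (\<forall>t k. \<bar>t - t2\<bar> < d / 4 \<longrightarrow> k \<in> K \<longrightarrow> \<mu> k t \<in> Z) \<longrightarrow>
     (\<forall>t k. \<bar>t - t2\<bar> < d / 4 \<longrightarrow> k \<in> K \<longrightarrow> 0 \<le> \<sigma> k * poly (q t) (\<mu> k t)) \<longrightarrow> (\<forall>k\<in>K. \<bar>\<sigma> k\<bar> = (1::real)) \<longrightarrow>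
     (\<forall>t a b. \<bar>t - t2\<bar> < d / 4 \<longrightarrow> a \<in> K \<longrightarrow> b \<in> K \<longrightarrow> a \<noteq> b \<longrightarrow>
         (\<exists>y\<in>closed_segment (\<mu> a t) (\<mu> b t). poly (q t) y = 0)) \<longrightarrow>
     (\<forall>t. \<bar>t - t2\<bar> < d / 4 \<longrightarrow> \<nu> t \<in> Z \<and> poly (q t) (\<nu> t) = 0) \<longrightarrow> \<nu> t2 = x1 \<longrightarrow> isCont \<nu> t2 \<longrightarrow>
     (\<forall>t. \<bar>t - t2\<bar> < d / 4 \<longrightarrow> D 0 t = poly (q t) x1) \<longrightarrow>
     (\<forall>j<Suc (Suc m). \<forall>t. \<bar>t - t2\<bar> < d / 4 \<longrightarrow> (D j has_real_derivative D (Suc j) t) (at t)) \<longrightarrow>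
     (\<forall>t. \<bar>t - t2\<bar> < d / 4 \<longrightarrow> \<bar>D (Suc (Suc m)) t\<bar> \<le> A1) \<longrightarrow>
     eventually (\<lambda>t. \<bar>\<nu> t - \<nu> t2\<bar> \<le> L * \<bar>t - t2\<bar>) (at t2)"
    using critical_point_estimate[OF cs] by (elim exE conjE) (rule that, assumption, assumption)
  define M where "M = max L L1"
  have "eventually (\<lambda>t. \<bar>sroot (q t) i - sroot (q t1) i\<bar> \<le> M * \<bar>t - t1\<bar>) (at t1)"
    if q: "root_cluster n (Suc (Suc m)) c A W {t1-d<..<t1+d} Z i0 q" and i: "i0 \<le> i" "i \<le> i0 + Suc m" for q t1 Z i0 i
  proof -
    \<comment> \<open>The data live on radius d. On radius d/2 the critical points are Lipschitz, as
      each of their slope bounds needs a window of radius d/2. Around a point of J3 the window of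
      radius d/4 for the key estimate lies in J2.\<close>
    define J J2 J3 where "J = {t1-d<..<t1+d}" and "J2 = {t1-d/2<..<t1+d/2}" and "J3 = {t1-d/4<..<t1+d/4}"
    have JJ: "J2 \<subseteq> J" "J3 \<subseteq> J2" using d by (auto simp: J_def J2_def J3_def)
    note q' = q[unfolded root_cluster_def J_def[symmetric]]
    obtain e where e: "0 < e" "\<And>t. t \<in> J \<Longrightarrow> real_rooted (q t) \<and> degree (q t) = n \<and> lead_coeff (q t) = e"
      using q' unfolding real_rooted_curve_def by blast
    have rr: "real_rooted (q t)" "degree (q t) = n" "lead_coeff (q t) > 0" if "t \<in> J" for t
      using e that by auto
    have in0: "i0 + Suc (Suc m) \<le> n" using q' by auto
    define \<mu> where "\<mu> k t = sroot (pderiv (q t)) k" for k t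
    define K where "K = {i0..<i0 + Suc m}"
    have q1: "root_cluster (n - 1) (Suc m) c (real n * A) W J Z i0 (\<lambda>t. pderiv (q t))"
      using root_cluster_pderiv[OF q A] by (simp add: J_def)
    note q1' = q1[unfolded root_cluster_def]
    have J: "open J" "open J2" "open J3" "is_interval J3" by (auto simp: J_def J2_def J3_def is_interval_oo)
    have \<mu>c: "continuous_on J (\<mu> k)" if "k \<in> K" for k
      unfolding \<mu>_def using q1' that in0 J(1) by (intro continuous_on_sroot_curve[of "n - 1" J _ "Suc m"]) (auto simp: K_def)
    have \<mu>loc: "eventually (\<lambda>t. \<bar>\<mu> k t - \<mu> k s\<bar> \<le> L1 * \<bar>t - s\<bar>) (at s)" if "k \<in> K" "s \<in> J2" for k s
    proof -
      have "{s-d/2<..<s+d/2} \<subseteq> J" using that(2) by (auto simp: J_def J2_def)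
      then have "eventually (\<lambda>t. \<bar>\<mu> k t - \<mu> k s\<bar> \<le> L' * \<bar>t - s\<bar>) (at s)"
        unfolding \<mu>_def using that(1) by (intro L'(2)[OF root_cluster_subset[OF q1]]) (auto simp: K_def)
      then show ?thesis
      proof eventually_elim
        case (elim t)
        have "L' * \<bar>t - s\<bar> \<le> L1 * \<bar>t - s\<bar>" by (intro mult_right_mono) (auto simp: L1_def)
        then show ?case using elim by linarith
      qed
    qed
    have \<mu>lip: "\<bar>\<mu> k s - \<mu> k t\<bar> \<le> L1 * \<bar>s - t\<bar>" if k: "k \<in> K" and st: "s \<in> J2" "t \<in> J2" for k s t
    proof -
      have *: "\<bar>\<mu> k v - \<mu> k u\<bar> \<le> L1 * (v - u)" if "u \<le> v" "u \<in> J2" "v \<in> J2" for u v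
        by (rule lipschitz_of_local[OF that(1)]) (use \<mu>loc[OF k] that in \<open>auto simp: J2_def\<close>)
      show ?thesis
      proof (cases "s \<le> t")
        case True
        then show ?thesis using *[of s t] st by (simp add: abs_minus_commute)
      next
        case False
        then show ?thesis using *[of t s] st by simp
      qed
    qed
    \<comment> \<open>The cofactor of the critical points in Z is a divided difference of order m +
      1 of the derivative. The cluster condition bounds it from below and the coefficient bound from
      above, both up to (m + 1)!.\<close>
    have fac: "\<exists>G. gl \<le> \<bar>G\<bar> \<and> \<bar>G\<bar> \<le> gu \<and> poly (pderiv (q t)) z = (\<Prod>k\<in>K. z - \<mu> k t) * G"
      if t: "t \<in> J" and z: "z \<in> Z" for t z
    proof -
      have "\<exists>\<xi>\<in>Z. poly (pderiv (q t)) z = (\<Prod>k=i0..<i0+Suc m. z - \<mu> k t) * (poly ((pderiv ^^ Suc m) (pderiv (q t))) \<xi> / fact (Suc m))"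
        unfolding \<mu>_def
      proof (rule divided_difference)
        show "real_rooted (pderiv (q t))" using rr[OF t] in0 by (intro real_rooted_pderiv) auto
        show "i0 + Suc m \<le> degree (pderiv (q t))" using rr[OF t] in0 by (simp add: degree_pderiv)
      qed (use q1' z t in auto)
      then obtain \<xi> where \<xi>: "\<xi> \<in> Z" "poly (pderiv (q t)) z = (\<Prod>k\<in>K. z - \<mu> k t) * (poly ((pderiv ^^ Suc (Suc m)) (q t)) \<xi> / fact (Suc m))"
        unfolding K_def by (auto simp: funpow_Suc_right simp del: funpow.simps)
      have "c \<le> \<bar>poly ((pderiv ^^ Suc (Suc m)) (q t)) \<xi>\<bar>" using q' t \<xi>(1) by blast
      moreover have "\<bar>poly ((pderiv ^^ Suc (Suc m)) (q t)) \<xi>\<bar> \<le> poly_bound n (Suc (Suc m)) A W"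
      proof (rule poly_bound)
        show "\<bar>coeff (q t) k\<bar> \<le> A" for k
          by (rule smooth_coeffs_bound[of "Suc (Suc m)" A J q]) (use q' t in auto)
        have "\<xi> \<in> {-W..W}" using \<xi>(1) q' by blast
        then show "\<bar>\<xi>\<bar> \<le> W" by auto
      qed (use rr[OF t] in auto)
      ultimately show ?thesis using \<xi>(2) unfolding gl_def gu_def
        by (intro exI[of _ "poly ((pderiv ^^ Suc (Suc m)) (q t)) \<xi> / fact (Suc m)"])
          (auto simp: divide_right_mono simp del: fact_Suc funpow.simps)
    qed
    define \<nu> where "\<nu> t = sroot (q t) i" for t
    have \<nu>c: "continuous_on J \<nu>"
      unfolding \<nu>_def using q' i in0 J(1) by (intro continuous_on_sroot_curve[of n J _ "Suc (Suc m)"]) auto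
    have \<nu>Z: "\<nu> t \<in> Z \<and> poly (q t) (\<nu> t) = 0" if "t \<in> J" for t
      using q' i that rr[OF that] in0 by (auto intro!: poly_sroot simp: \<nu>_def)
    have off: "eventually (\<lambda>s. \<bar>\<nu> s - \<nu> t2\<bar> \<le> M * \<bar>s - t2\<bar>) (at t2)"
      if t2: "t2 \<in> J3" and ne: "\<forall>k\<in>K. \<nu> t2 \<noteq> \<mu> k t2" for t2
    proof -
      have near: "t \<in> J2" "t \<in> J" if "\<bar>t - t2\<bar> < d / 4" for t
      proof -
        have "t1 - d / 4 < t2" "t2 < t1 + d / 4" using t2 by (simp_all add: J3_def)
        then have "t1 - d / 2 < t" "t < t1 + d / 2" using that by linarith+
        then show "t \<in> J2" by (simp add: J2_def)
        then show "t \<in> J" using JJ by blast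
      qed
      \<comment> \<open>The sign does not depend on t: the critical point with index k stays between
        the roots with indices k and k + 1.\<close>
      define \<sigma> :: "nat \<Rightarrow> real" where "\<sigma> k = (-1) ^ (n - Suc k)" for k
      have "\<nu> t2 \<in> {-W..W}" using \<nu>Z[of t2] t2 JJ q' by blast
      then have xW: "\<bar>\<nu> t2\<bar> \<le> W" by auto
      obtain D :: "nat \<Rightarrow> real \<Rightarrow> real" where D: "\<forall>t\<in>J. D 0 t = poly (q t) (\<nu> t2)"
        "\<forall>j<Suc (Suc m). \<forall>t\<in>J. (D j has_real_derivative D (Suc j) t) (at t)" "\<forall>t\<in>J. \<bar>D (Suc (Suc m)) t\<bar> \<le> A1"
        using smooth_coeffs_poly[of "Suc (Suc m)" A J q n "\<nu> t2" W] q' rr xW A unfolding A1_def by auto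
      have il: "sroot (q t) k \<le> \<mu> k t" "\<mu> k t \<le> sroot (q t) (Suc k)" if "t \<in> J" "k \<in> K" for t k
        unfolding \<mu>_def using sroot_interlace[OF rr(1)[OF that(1)], of k] rr(2)[OF that(1)] that(2) in0 by (auto simp: K_def)
      have "eventually (\<lambda>s. \<bar>\<nu> s - \<nu> t2\<bar> \<le> L * \<bar>s - t2\<bar>) (at t2)"
      proof (rule crit[rule_format, of K Z "\<nu> t2" \<mu> t2 q \<sigma> \<nu> D])
        show "finite K" "card K = Suc m" by (auto simp: K_def)
        show "is_interval Z" using q' by auto
        show "\<bar>y - z\<bar> \<le> 2 * W" if "y \<in> Z" "z \<in> Z" for y z
        proof -
          have "Z \<subseteq> {-W..W}" using q' by auto
          then have "y \<in> {-W..W}" "z \<in> {-W..W}" using that by auto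
          then show ?thesis by auto
        qed
        show "\<nu> t2 \<in> Z" using \<nu>Z t2 JJ by auto
        show "\<nu> t2 \<noteq> \<mu> k t2" if "k \<in> K" for k using ne that by auto
        show "\<exists>G. gl \<le> \<bar>G\<bar> \<and> \<bar>G\<bar> \<le> gu \<and> poly (pderiv (q t)) z = (\<Prod>k\<in>K. z - \<mu> k t) * G"
          if "\<bar>t - t2\<bar> < d / 4" "z \<in> Z" for t z using fac near that by auto
        show "\<bar>\<mu> k t - \<mu> k t2\<bar> \<le> L1 * \<bar>t - t2\<bar>" if "\<bar>t - t2\<bar> < d / 4" "k \<in> K" for t k
          using \<mu>lip[OF that(2)] near[OF that(1)] t2 JJ by auto
        show "\<mu> k t \<in> Z" if "\<bar>t - t2\<bar> < d / 4" "k \<in> K" for t k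
          using q1' near(2)[OF that(1)] that(2) by (auto simp: \<mu>_def K_def)
        show "0 \<le> \<sigma> k * poly (q t) (\<mu> k t)" if "\<bar>t - t2\<bar> < d / 4" "k \<in> K" for t k
          using sroot_sign[of "q t" k "\<mu> k t"] il[OF near(2)[OF that(1)] that(2)] rr[OF near(2)[OF that(1)]] that(2) in0
          by (auto simp: \<sigma>_def K_def)
        show "\<bar>\<sigma> k\<bar> = 1" for k by (simp add: \<sigma>_def power_abs)
        show "\<exists>y\<in>closed_segment (\<mu> a t) (\<mu> b t). poly (q t) y = 0"
          if t: "\<bar>t - t2\<bar> < d / 4" and ab: "a \<in> K" "b \<in> K" "a \<noteq> b" for t a b
        proof -
          \<comment> \<open>By interlacing, the root with index b separates the critical points a
            and b when a < b.\<close>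
          have *: "\<exists>y. \<mu> a t \<le> y \<and> y \<le> \<mu> b t \<and> poly (q t) y = 0" if "a < b" "a \<in> K" "b \<in> K" for a b
          proof (intro exI[of _ "sroot (q t) b"] conjI)
            note tJ = near(2)[OF t]
            show "sroot (q t) b \<le> \<mu> b t" using il tJ that by auto
            have "\<mu> a t \<le> sroot (q t) (Suc a)" using il tJ that by auto
            also have "\<dots> \<le> sroot (q t) b" using that rr[OF tJ] in0 by (intro sroot_mono) (auto simp: K_def)
            finally show "\<mu> a t \<le> sroot (q t) b" .
            show "poly (q t) (sroot (q t) b) = 0" using that rr[OF tJ] in0 by (intro poly_sroot) (auto simp: K_def)
          qed
          show ?thesis
          proof (cases "a < b")
            case True
            then show ?thesis using *[of a b] ab by (auto simp: closed_segment_eq_real_ivl)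
          next
            case False
            then show ?thesis using *[of b a] ab by (auto simp: closed_segment_eq_real_ivl)
          qed
        qed
        show "\<nu> t \<in> Z \<and> poly (q t) (\<nu> t) = 0" if "\<bar>t - t2\<bar> < d / 4" for t using \<nu>Z near that by auto
        show "isCont \<nu> t2" using \<nu>c t2 JJ J(1) by (auto simp: continuous_on_eq_continuous_at)
      qed (use D near in auto)
      then show ?thesis
      proof eventually_elim
        case (elim t)
        have "L * \<bar>t - t2\<bar> \<le> M * \<bar>t - t2\<bar>" by (intro mult_right_mono) (auto simp: M_def)
        then show ?case using elim by linarith
      qed
    qed
    have "eventually (\<lambda>s. \<bar>\<nu> s - \<nu> t1\<bar> \<le> M * \<bar>s - t1\<bar>) (at t1)"
    proof (rule lipschitz_glue[of J3 \<nu> K \<mu> M])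
      show "continuous_on J3 \<nu>" using \<nu>c JJ by (auto intro: continuous_on_subset)
      show "continuous_on J3 (\<mu> k)" if "k \<in> K" for k using \<mu>c[OF that] JJ by (auto intro: continuous_on_subset)
      show "\<bar>\<mu> k s - \<mu> k t\<bar> \<le> M * \<bar>s - t\<bar>" if "k \<in> K" "s \<in> J3" "t \<in> J3" for k s t
      proof -
        have "L1 * \<bar>s - t\<bar> \<le> M * \<bar>s - t\<bar>" by (intro mult_right_mono) (auto simp: M_def)
        moreover have "\<bar>\<mu> k s - \<mu> k t\<bar> \<le> L1 * \<bar>s - t\<bar>" using that JJ by (intro \<mu>lip) auto
        ultimately show ?thesis by linarith
      qed
      show "t1 \<in> J3" using d by (simp add: J3_def)
    qed (use J off in \<open>auto simp: K_def\<close>)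
    then show ?thesis by (simp add: \<nu>_def)
  qed
  then show ?case using L by (intro exI[of _ M]) (auto simp: M_def)
qed

section \<open>Functions with several continuous derivatives\<close>

text \<open>Carrying some derivative function, instead of iterating \<open>deriv\<close>, makes
  closure under sums, products and affine substitution an induction on m.\<close>

primrec Cn :: "nat \<Rightarrow> real set \<Rightarrow> (real \<Rightarrow> real) \<Rightarrow> bool" where
  "Cn 0 J f \<longleftrightarrow> continuous_on J f"
| "Cn (Suc m) J f \<longleftrightarrow> (\<exists>f'. (\<forall>t\<in>J. (f has_real_derivative f' t) (at t)) \<and> Cn m J f')"

lemma Cn_Suc_imp_Cn: "Cn (Suc m) J f \<Longrightarrow> Cn m J f"
proof (induction m arbitrary: f)
  case 0
  then obtain f' where "\<forall>t\<in>J. (f has_real_derivative f' t) (at t)" by auto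
  then show ?case by (auto intro!: DERIV_continuous_on[of J f f'] intro: has_field_derivative_at_within)
next
  case (Suc m)
  then obtain f' where "\<forall>t\<in>J. (f has_real_derivative f' t) (at t)" "Cn (Suc m) J f'" by auto
  then show ?case using Suc.IH[of f'] by auto
qed

lemma Cn_le: "Cn m J f \<Longrightarrow> k \<le> m \<Longrightarrow> Cn k J f"
  by (induction m) (auto simp: le_Suc_eq simp del: Cn.simps dest: Cn_Suc_imp_Cn)

lemma Cn_continuous_on: "Cn m J f \<Longrightarrow> continuous_on J f"
  using Cn_le[of m J f 0] by simp

lemma Cn_const [simp]: "Cn m J (\<lambda>t. c)"
  by (induction m arbitrary: c) (auto intro!: exI[of _ "\<lambda>t. 0"])

lemma Cn_linear: "Cn m J (\<lambda>t. a + b * t)"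
  by (cases m) (auto intro!: continuous_intros exI[of _ "\<lambda>t. b"] derivative_eq_intros)

lemma Cn_add: "Cn m J f \<Longrightarrow> Cn m J g \<Longrightarrow> Cn m J (\<lambda>t. f t + g t)"
proof (induction m arbitrary: f g)
  case (Suc m)
  then obtain f' g' where "\<forall>t\<in>J. (f has_real_derivative f' t) (at t)" "Cn m J f'"
    "\<forall>t\<in>J. (g has_real_derivative g' t) (at t)" "Cn m J g'" by auto
  then show ?case using Suc.IH[of f' g'] by (auto intro!: exI[of _ "\<lambda>t. f' t + g' t"] DERIV_add)
qed (auto intro: continuous_intros)

lemma Cn_mult: "Cn m J f \<Longrightarrow> Cn m J g \<Longrightarrow> Cn m J (\<lambda>t. f t * g t)"
proof (induction m arbitrary: f g)
  case (Suc m)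
  then obtain f' g' where fg: "\<forall>t\<in>J. (f has_real_derivative f' t) (at t)" "Cn m J f'"
    "\<forall>t\<in>J. (g has_real_derivative g' t) (at t)" "Cn m J g'" by auto
  have "Cn m J f" "Cn m J g" using Suc.prems by (blast intro: Cn_Suc_imp_Cn)+
  then have "Cn m J (\<lambda>t. f' t * g t + g' t * f t)"
    using fg by (intro Cn_add Suc.IH)
  then show ?case using fg by (auto intro!: exI[of _ "\<lambda>t. f' t * g t + g' t * f t"] DERIV_mult)
qed (auto intro: continuous_intros)

lemma Cn_power: "Cn m J f \<Longrightarrow> Cn m J (\<lambda>t. f t ^ k)"
  by (induction k) (auto intro: Cn_mult)

lemma Cn_sum: "(\<And>i. i \<in> A \<Longrightarrow> Cn m J (f i)) \<Longrightarrow> Cn m J (\<lambda>t. \<Sum>i\<in>A. f i t)"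
  by (induction A rule: infinite_finite_induct) (auto intro: Cn_add)

lemma Cn_affine:
  assumes "Cn m J f" "\<And>t. t \<in> J' \<Longrightarrow> a + b * t \<in> J"
  shows "Cn m J' (\<lambda>t. f (a + b * t))"
  using assms(1)
proof (induction m arbitrary: f)
  case 0
  then show ?case using assms(2)
    by (auto intro!: continuous_on_compose2[of J f J' "\<lambda>t. a + b * t"] continuous_intros)
next
  case (Suc m)
  then obtain f' where f': "\<forall>t\<in>J. (f has_real_derivative f' t) (at t)" "Cn m J f'" by auto
  have "((\<lambda>t. f (a + b * t)) has_real_derivative f' (a + b * t) * b) (at t)" if "t \<in> J'" for t
    using f'(1) assms(2)[OF that] by (intro DERIV_chain2[of f "f' (a + b * t)" "\<lambda>t. a + b * t" t b]) (auto intro!: derivative_eq_intros)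
  moreover have "Cn m J' (\<lambda>t. f' (a + b * t) * b)" using Suc.IH[OF f'(2)] by (intro Cn_mult) auto
  ultimately show ?case by (auto intro!: exI[of _ "\<lambda>t. f' (a + b * t) * b"])
qed

lemma Cn_transform:
  assumes "Cn m J f" "\<And>t. t \<in> J \<Longrightarrow> f t = g t" "open J"
  shows "Cn m J g"
proof (cases m)
  case 0
  then show ?thesis using assms by (auto intro: continuous_on_eq)
next
  case (Suc k)
  then obtain f' where f': "\<forall>t\<in>J. (f has_real_derivative f' t) (at t)" "Cn k J f'" using assms(1) by auto
  have "(g has_real_derivative f' t) (at t)" if "t \<in> J" for t
    by (rule has_field_derivative_transform_within_open[of f _ t J]) (use f'(1) that assms(2,3) in auto)
  then show ?thesis using f'(2) Suc by auto
qed

lemma Cn_iff_derivatives: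
  "Cn m J f \<longleftrightarrow> (\<exists>D :: nat \<Rightarrow> real \<Rightarrow> real. D 0 = f \<and> (\<forall>j<m. \<forall>t\<in>J. (D j has_real_derivative D (Suc j) t) (at t)) \<and>
     continuous_on J (D m))"
proof (induction m arbitrary: f)
  case 0
  show ?case by (auto intro: exI[of _ "\<lambda>_. f"])
next
  case (Suc m)
  show ?case
  proof
    assume "Cn (Suc m) J f"
    then obtain f' where f': "\<forall>t\<in>J. (f has_real_derivative f' t) (at t)" "Cn m J f'" by auto
    then obtain D where D: "D 0 = f'" "\<forall>j<m. \<forall>t\<in>J. (D j has_real_derivative D (Suc j) t) (at t)" "continuous_on J (D m)"
      using Suc.IH[of f'] by blast
    show "\<exists>D. D 0 = f \<and> (\<forall>j<Suc m. \<forall>t\<in>J. (D j has_real_derivative D (Suc j) t) (at t)) \<and> continuous_on J (D (Suc m))"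
      by (rule exI[of _ "case_nat f D"]) (use D f' in \<open>auto split: nat.split\<close>)
  next
    assume "\<exists>D. D 0 = f \<and> (\<forall>j<Suc m. \<forall>t\<in>J. (D j has_real_derivative D (Suc j) t) (at t)) \<and> continuous_on J (D (Suc m))"
    then obtain D where D: "D 0 = f" "\<forall>j<Suc m. \<forall>t\<in>J. (D j has_real_derivative D (Suc j) t) (at t)" "continuous_on J (D (Suc m))"
      by blast
    have "\<exists>E. E 0 = D 1 \<and> (\<forall>j<m. \<forall>t\<in>J. (E j has_real_derivative E (Suc j) t) (at t)) \<and> continuous_on J (E m)"
      by (rule exI[of _ "\<lambda>j. D (Suc j)"]) (use D in auto)
    then have "Cn m J (D 1)" using Suc.IH[of "D 1"] by blast
    then show "Cn (Suc m) J f" using D by auto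
  qed
qed

lemma Cn_derivatives:
  assumes "Cn m J f"
  obtains D :: "nat \<Rightarrow> real \<Rightarrow> real" where "D 0 = f"
    "\<And>j t. j < m \<Longrightarrow> t \<in> J \<Longrightarrow> (D j has_real_derivative D (Suc j) t) (at t)"
    "\<And>j. j \<le> m \<Longrightarrow> continuous_on J (D j)"
proof -
  obtain D where D: "D 0 = f" "\<forall>j<m. \<forall>t\<in>J. (D j has_real_derivative D (Suc j) t) (at t)" "continuous_on J (D m)"
    using assms unfolding Cn_iff_derivatives by blast
  show ?thesis
  proof (rule that[of D])
    fix j assume "j \<le> m"
    then consider "j = m" | "j < m" by linarith
    then show "continuous_on J (D j)"
      using D by cases (auto intro!: DERIV_continuous_on intro: has_field_derivative_at_within)
  qed (use D in auto)
qed

lemma Ck_on_imp_Cn: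
  assumes "Ck_on m f J"
  shows "Cn m J f"
  unfolding Cn_iff_derivatives
  by (rule exI[of _ "\<lambda>j. (deriv ^^ j) f"])
    (use assms in \<open>auto simp: Ck_on_def DERIV_deriv_iff_field_differentiable\<close>)

text \<open>Continuous derivatives are bounded on the compact interval [u, v]; this turns the
  qualitative smoothness into the constant A.\<close>

lemma smooth_coeffs_of_Cn:
  assumes q: "\<And>k. Cn m J (\<lambda>t. coeff (q t) k)" and n: "\<And>t. t \<in> J \<Longrightarrow> degree (q t) \<le> n" and sub: "{u..v} \<subseteq> J"
  shows "\<exists>A\<ge>0. smooth_coeffs m A {u<..<v} q"
proof -
  have "\<exists>D :: nat \<Rightarrow> real \<Rightarrow> real. D 0 = (\<lambda>t. coeff (q t) k) \<and> (\<forall>j<m. \<forall>t\<in>J. (D j has_real_derivative D (Suc j) t) (at t)) \<and>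
      (\<forall>j\<le>m. continuous_on J (D j))" for k
    using Cn_derivatives[OF q[of k]] by metis
  then obtain D0 :: "nat \<Rightarrow> nat \<Rightarrow> real \<Rightarrow> real" where D0: "\<And>k. D0 k 0 = (\<lambda>t. coeff (q t) k)"
    "\<And>k j t. j < m \<Longrightarrow> t \<in> J \<Longrightarrow> (D0 k j has_real_derivative D0 k (Suc j) t) (at t)"
    "\<And>k j. j \<le> m \<Longrightarrow> continuous_on J (D0 k j)"
    by metis
  \<comment> \<open>One A has to serve all k. Above the degree bound the derivatives are replaced by
    0, which leaves finitely many functions to bound.\<close>
  define D where "D k = (if k \<le> n then D0 k else (\<lambda>j t. 0))" for k
  have ex: "\<exists>B. j \<le> m \<longrightarrow> (\<forall>t\<in>{u..v}. \<bar>D0 k j t\<bar> \<le> B)" for k j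
  proof (cases "j \<le> m")
    case True
    note that = this
    have "compact (D0 k j ` {u..v})"
      by (intro compact_continuous_image) (use D0(3)[OF that] sub in \<open>auto intro: continuous_on_subset\<close>)
    then have "bounded (D0 k j ` {u..v})" by (rule compact_imp_bounded)
    then show ?thesis by (auto simp: bounded_iff)
  qed auto
  define B where "B k j = (SOME b. j \<le> m \<longrightarrow> (\<forall>t\<in>{u..v}. \<bar>D0 k j t\<bar> \<le> b))" for k j
  have B: "\<bar>D0 k j t\<bar> \<le> B k j" if "j \<le> m" "t \<in> {u..v}" for k j t
    using someI_ex[OF ex[of j k]] that unfolding B_def by blast
  define A where "A = (\<Sum>k\<le>n. \<Sum>j\<le>m. \<bar>B k j\<bar>)"
  have A0: "0 \<le> A" unfolding A_def by (intro sum_nonneg) auto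
  have "\<bar>D k j t\<bar> \<le> A" if "j \<le> m" "t \<in> {u<..<v}" for k j t
  proof (cases "k \<le> n")
    case True
    have "\<bar>B k j\<bar> \<le> (\<Sum>j\<le>m. \<bar>B k j\<bar>)" using that by (intro member_le_sum) auto
    also have "\<dots> \<le> A" unfolding A_def using True
      by (intro member_le_sum[of k "{..n}" "\<lambda>k. \<Sum>j\<le>m. \<bar>B k j\<bar>"]) (auto intro: sum_nonneg)
    finally show ?thesis using B[OF that(1), of t k] that(2) True by (simp add: D_def)
  qed (use A0 in \<open>simp add: D_def\<close>)
  note DA = this
  have J: "t \<in> J" if "t \<in> {u<..<v}" for t using that sub by auto
  have "smooth_coeffs m A {u<..<v} q"
    unfolding smooth_coeffs_def
  proof (intro exI[of _ D] allI conjI ballI impI)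
    fix k t assume t: "t \<in> {u<..<v}"
    show "D k 0 t = coeff (q t) k"
    proof (cases "k \<le> n")
      case False
      then have "coeff (q t) k = 0" using n[OF J[OF t]] by (intro coeff_eq_0) simp
      then show ?thesis using False by (simp add: D_def)
    qed (simp add: D_def D0(1))
  next
    fix k j t assume "j < m" "t \<in> {u<..<v}"
    then show "(D k j has_real_derivative D k (Suc j) t) (at t)"
      using D0(2) J by (simp add: D_def)
  qed (rule DA)
  then show ?thesis using A0 by blast
qed

section \<open>Affine substitutions and limits at a point\<close>

lemma
  fixes p :: "real poly"
  assumes p: "real_rooted p" and c: "c \<noteq> 0" and w: "w > 0"
  shows real_rooted_affine: "real_rooted (smult c (pcompose p [:a, w:]))"
    and degree_affine: "degree (smult c (pcompose p [:a, w:])) = degree p"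
    and lead_coeff_affine: "lead_coeff (smult c (pcompose p [:a, w:])) = c * lead_coeff p * w ^ degree p"
    and sroot_affine: "i < degree p \<Longrightarrow> sroot (smult c (pcompose p [:a, w:])) i = (sroot p i - a) / w"
proof -
  let ?q = "smult c (pcompose p [:a, w:])" and ?e = "c * lead_coeff p * w ^ degree p"
  have *: "?q = smult ?e (\<Prod>i<degree p. [:- ((sroot p i - a) / w), 1:])"
  proof (rule poly_ext)
    fix z
    have "(\<Prod>i<degree p. a + w * z - sroot p i) = (\<Prod>i<degree p. w * (z - (sroot p i - a) / w))"
      using w by (intro prod.cong) (auto simp: field_simps)
    then show "poly ?q z = poly (smult ?e (\<Prod>i<degree p. [:- ((sroot p i - a) / w), 1:])) z"
      by (simp add: poly_pcompose poly_real_rooted[OF p] poly_prod prod.distrib mult_ac)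
  qed
  have e: "?e \<noteq> 0" using p c w by (auto simp: real_rooted_def)
  show "real_rooted ?q" by (rule real_rooted_prod_linear[OF * e])
  show "degree ?q = degree p" by (rule degree_prod_linear[OF * e])
  show "lead_coeff ?q = ?e" by (rule lead_coeff_prod_linear[OF * e])
  show "sroot ?q i = (sroot p i - a) / w" if "i < degree p"
    by (rule sroot_prod_linear[OF * e _ that]) (use w sroot_mono[OF p] in \<open>auto simp: divide_right_mono\<close>)
qed

text \<open>Taylor's theorem at 0. Growth of order |t|^r makes the derivatives below order r vanish
  at 0 one after another, because \<open>D 0 t / t ^ i\<close> tends both to 0 and to
  \<open>D i 0 / fact i\<close>. In the expansion of D j only the term with D r is left.\<close>

lemma derivatives_of_bigo_power:
  fixes D :: "nat \<Rightarrow> real \<Rightarrow> real"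
  assumes \<delta>: "0 < \<delta>" and D: "\<And>j t. j < r \<Longrightarrow> \<bar>t\<bar> < \<delta> \<Longrightarrow> (D j has_real_derivative D (Suc j) t) (at t)"
    and cont: "\<And>j. j \<le> r \<Longrightarrow> isCont (D j) 0" and O: "eventually (\<lambda>t. \<bar>D 0 t\<bar> \<le> C * \<bar>t\<bar> ^ r) (at 0)"
    and j: "j \<le> r"
  shows "((\<lambda>t. D j t / t ^ (r - j)) \<longlongrightarrow> D r 0 / fact (r - j)) (at 0)"
proof -
  have lim: "((\<lambda>t. D j t / t ^ k) \<longlongrightarrow> D (j + k) 0 / fact k) (at 0)"
    if jk: "j + k \<le> r" and van: "\<And>i. i < k \<Longrightarrow> D (j + i) 0 = 0" for j k
  proof (cases "k = 0")
    case True
    then show ?thesis using cont[of j] jk by (auto simp: isCont_def)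
  next
    case False
    have "\<exists>\<xi>. \<bar>\<xi>\<bar> \<le> \<bar>t\<bar> \<and> D j t / t ^ k = D (j + k) \<xi> / fact k" if t: "t \<noteq> 0" "\<bar>t\<bar> < \<delta>" for t
    proof -
      have "\<exists>\<xi>. (if t < 0 then t < \<xi> \<and> \<xi> < 0 else 0 < \<xi> \<and> \<xi> < t) \<and>
        D j t = (\<Sum>i<k. (D (j + i) 0 / fact i) * (t - 0) ^ i) + (D (j + k) \<xi> / fact k) * (t - 0) ^ k"
        by (rule Taylor[of k "\<lambda>i. D (j + i)" "D j" "- \<bar>t\<bar>" "\<bar>t\<bar>"]) (use False t jk D in auto)
      then obtain \<xi> where \<xi>: "if t < 0 then t < \<xi> \<and> \<xi> < 0 else 0 < \<xi> \<and> \<xi> < t"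
        "D j t = (\<Sum>i<k. (D (j + i) 0 / fact i) * (t - 0) ^ i) + (D (j + k) \<xi> / fact k) * (t - 0) ^ k" by blast
      have "(\<Sum>i<k. (D (j + i) 0 / fact i) * (t - 0) ^ i) = 0" using van by simp
      then have "D j t = D (j + k) \<xi> / fact k * t ^ k" using \<xi>(2) by simp
      then show ?thesis using t \<xi>(1) by (intro exI[of _ \<xi>]) (auto split: if_splits)
    qed
    then obtain \<xi> where \<xi>: "\<And>t. t \<noteq> 0 \<Longrightarrow> \<bar>t\<bar> < \<delta> \<Longrightarrow> \<bar>\<xi> t\<bar> \<le> \<bar>t\<bar> \<and> D j t / t ^ k = D (j + k) (\<xi> t) / fact k" by metis
    have ev: "eventually (\<lambda>t::real. t \<noteq> 0 \<and> \<bar>t\<bar> < \<delta>) (at 0)"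
      unfolding eventually_at using \<delta> by (intro exI[of _ \<delta>]) auto
    have "(\<xi> \<longlongrightarrow> 0) (at 0)"
    proof (rule Lim_null_comparison)
      show "eventually (\<lambda>t. norm (\<xi> t) \<le> \<bar>t\<bar>) (at 0)" using ev by eventually_elim (use \<xi> in auto)
      show "((\<lambda>t::real. \<bar>t\<bar>) \<longlongrightarrow> 0) (at 0)" by (intro tendsto_eq_intros) auto
    qed
    then have "((\<lambda>t. D (j + k) (\<xi> t) / fact k) \<longlongrightarrow> D (j + k) 0 / fact k) (at 0)"
      by (intro tendsto_intros isCont_tendsto_compose[OF cont[OF jk]]) auto
    then show ?thesis
      by (rule Lim_transform_eventually) (use ev in eventually_elim, use \<xi> in auto)
  qed
  have van: "D i 0 = 0" if "i < r" for i
    using that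
  proof (induction i rule: less_induct)
    case (less i)
    have l: "((\<lambda>t. D 0 t / t ^ i) \<longlongrightarrow> D (0 + i) 0 / fact i) (at 0)" by (rule lim) (use less in auto)
    have "((\<lambda>t. D 0 t / t ^ i) \<longlongrightarrow> 0) (at 0)"
    proof (rule Lim_null_comparison)
      have "eventually (\<lambda>t::real. t \<noteq> 0) (at 0)" by (simp add: eventually_at_filter)
      then show "eventually (\<lambda>t. norm (D 0 t / t ^ i) \<le> C * \<bar>t\<bar> ^ (r - i)) (at 0)"
        using O
      proof eventually_elim
        case (elim t)
        have "\<bar>t\<bar> ^ r = \<bar>t\<bar> ^ (r - i) * \<bar>t\<bar> ^ i" using less.prems by (simp flip: power_add)
        then show ?case using elim by (simp add: abs_mult power_abs divide_le_eq)
      qed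
      show "((\<lambda>t. C * \<bar>t\<bar> ^ (r - i)) \<longlongrightarrow> 0) (at 0)"
        by (intro tendsto_eq_intros) (use less.prems in \<open>auto simp: power_0_left\<close>)
    qed
    from LIM_unique[OF l this] show ?case by simp
  qed
  show ?thesis using lim[of j "r - j"] van j by auto
qed

text \<open>Let l be the limit of g along some sequence. Arbitrarily close to l on both sides there
  are points at which K does not vanish. Near 0 the function g cannot take these values, and since
  the image of an interval is connected, g stays between them.\<close>

lemma limit_of_poly_limit_zero:
  fixes g :: "real \<Rightarrow> real" and K :: "real poly"
  assumes K: "K \<noteq> 0" and \<delta>: "0 < \<delta>" and g: "continuous_on {0<..<\<delta>} g"
    and bdd: "\<And>h. 0 < h \<Longrightarrow> h < \<delta> \<Longrightarrow> \<bar>g h\<bar> \<le> B" and lim: "((\<lambda>h. poly K (g h)) \<longlongrightarrow> 0) (at_right 0)"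
  shows "\<exists>l. (g \<longlongrightarrow> l) (at_right 0)"
proof -
  define u where "u k = \<delta> / real (k + 2)" for k
  have u: "0 < u k" "u k < \<delta>" for k
  proof -
    show "0 < u k" using \<delta> by (simp add: u_def)
    have "\<delta> / real (k + 2) < \<delta> / 1" using \<delta> by (intro divide_strict_left_mono) auto
    then show "u k < \<delta>" by (simp add: u_def)
  qed
  have u0: "u \<longlonglongrightarrow> 0"
    unfolding u_def using LIMSEQ_ignore_initial_segment[OF lim_const_over_n[of \<delta>], of 2] by simp
  have "bounded (range (\<lambda>k. g (u k)))" unfolding bounded_iff using bdd u by auto
  then obtain l s where s: "strict_mono (s :: nat \<Rightarrow> nat)" "((\<lambda>k. g (u k)) \<circ> s) \<longlonglongrightarrow> l"
    using bounded_imp_convergent_subsequence by blast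
  have us: "(\<lambda>k. u (s k)) \<longlonglongrightarrow> 0" using LIMSEQ_subseq_LIMSEQ[OF u0 s(1)] by (simp add: o_def)
  have nonroot: "\<exists>y. a < y \<and> y < b \<and> poly K y \<noteq> 0" if "a < b" for a b
  proof (rule ccontr)
    assume "\<not> ?thesis"
    then have "{a<..<b} \<subseteq> {y. poly K y = 0}" by auto
    then have "finite {a<..<b}" using poly_roots_finite[OF K] finite_subset by blast
    then show False using that by (simp add: infinite_Ioo)
  qed
  have "(g \<longlongrightarrow> l) (at_right 0)"
  proof (rule tendstoI)
    fix e :: real assume e: "e > 0"
    obtain y1 where y1: "l < y1" "y1 < l + e" "poly K y1 \<noteq> 0" using nonroot[of l "l + e"] e by auto
    obtain y2 where y2: "l - e < y2" "y2 < l" "poly K y2 \<noteq> 0" using nonroot[of "l - e" l] e by auto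
    define \<kappa> where "\<kappa> = min \<bar>poly K y1\<bar> \<bar>poly K y2\<bar>"
    have "\<kappa> > 0" using y1 y2 by (simp add: \<kappa>_def)
    then have "eventually (\<lambda>h. \<bar>poly K (g h)\<bar> < \<kappa>) (at_right 0)" using lim by (auto simp: tendsto_iff)
    then obtain d where d: "d > 0" "\<And>h. 0 < h \<Longrightarrow> h < d \<Longrightarrow> \<bar>poly K (g h)\<bar> < \<kappa>"
      unfolding eventually_at_right_field by auto
    define d' where "d' = min d \<delta>"
    have d': "d' > 0" using d \<delta> by (simp add: d'_def)
    have avoid: "g h \<noteq> y1 \<and> g h \<noteq> y2" if "0 < h" "h < d'" for h
      using d(2)[of h] that by (auto simp: d'_def \<kappa>_def)
    have "eventually (\<lambda>k. u (s k) < d') sequentially" using us d' by (rule order_tendstoD)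
    moreover have "eventually (\<lambda>k. g (u (s k)) < y1) sequentially" "eventually (\<lambda>k. y2 < g (u (s k))) sequentially"
      using s(2) y1 y2 unfolding o_def by (auto intro: order_tendstoD)
    ultimately have "eventually (\<lambda>k. u (s k) < d' \<and> g (u (s k)) < y1 \<and> y2 < g (u (s k))) sequentially"
      by eventually_elim auto
    then obtain k where k: "u (s k) < d'" "g (u (s k)) < y1" "y2 < g (u (s k))"
      unfolding eventually_sequentially by blast
    have con: "connected (g ` {0<..<d'})"
      by (intro connected_continuous_image continuous_on_subset[OF g]) (auto simp: d'_def)
    have gk: "g (u (s k)) \<in> g ` {0<..<d'}" using u k by auto
    have "dist (g h) l < e" if h: "0 < h" "h < d'" for h
    proof -
      have gh: "g h \<in> g ` {0<..<d'}" using h by auto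
      have "g h < y1"
      proof (rule ccontr)
        assume "\<not> ?thesis"
        then have "y1 \<in> g ` {0<..<d'}"
          using con[unfolded connected_iff_interval, rule_format, OF gk gh, of y1] k by auto
        then obtain x where "0 < x" "x < d'" "g x = y1" by auto
        then show False using avoid by blast
      qed
      moreover have "y2 < g h"
      proof (rule ccontr)
        assume "\<not> ?thesis"
        then have "y2 \<in> g ` {0<..<d'}"
          using con[unfolded connected_iff_interval, rule_format, OF gh gk, of y2] k by auto
        then obtain x where "0 < x" "x < d'" "g x = y2" by auto
        then show False using avoid by blast
      qed
      ultimately show ?thesis using y1 y2 by (auto simp: dist_real_def abs_less_iff)
    qed
    then show "eventually (\<lambda>h. dist (g h) l < e) (at_right 0)"
      unfolding eventually_at_right_field using d' by blast
  qed
  then show ?thesis by blast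
qed

section \<open>A multiple root at parameter 0\<close>

text \<open>Each root 0 contributes a factor z, so the number of zero roots is the index of the
  lowest nonzero coefficient.\<close>

lemma coeff_prod_linear_zero_roots:
  fixes x :: "'a \<Rightarrow> real"
  assumes N: "finite N"
  defines "A \<equiv> {i\<in>N. x i = 0}"
  shows "k < card A \<Longrightarrow> coeff (smult c (\<Prod>i\<in>N. [:- x i, 1:])) k = 0"
    and "coeff (smult c (\<Prod>i\<in>N. [:- x i, 1:])) (card A) = c * (\<Prod>i\<in>N - A. - x i)"
proof -
  have "(\<Prod>i\<in>N. [:- x i, 1:]) = (\<Prod>i\<in>N - A. [:- x i, 1:]) * (\<Prod>i\<in>A. [:- x i, 1:])"
    by (rule prod.subset_diff) (use N in \<open>auto simp: A_def\<close>)
  also have "(\<Prod>i\<in>A. [:- x i, 1:]) = (\<Prod>i\<in>A. [:0, 1:])" by (intro prod.cong) (auto simp: A_def)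
  also have "\<dots> = monom 1 (card A)" by (simp add: monom_altdef)
  finally have *: "smult c (\<Prod>i\<in>N. [:- x i, 1:]) = monom 1 (card A) * smult c (\<Prod>i\<in>N - A. [:- x i, 1:])"
    by (simp add: mult.commute)
  show "k < card A \<Longrightarrow> coeff (smult c (\<Prod>i\<in>N. [:- x i, 1:])) k = 0"
    unfolding * by (simp add: coeff_monom_mult)
  have "coeff (\<Prod>i\<in>N - A. [:- x i, 1:]) 0 = (\<Prod>i\<in>N - A. - x i)"
    unfolding poly_0_coeff_0[symmetric] poly_prod by simp
  then show "coeff (smult c (\<Prod>i\<in>N. [:- x i, 1:])) (card A) = c * (\<Prod>i\<in>N - A. - x i)"
    unfolding * by (simp add: coeff_monom_mult)
qed

lemma isCont_tendsto_nhds: "isCont f x \<Longrightarrow> (f \<longlongrightarrow> f x) (nhds x)"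
  unfolding isCont_def by (rule tendsto_at_iff_tendsto_nhds[THEN iffD1])

text \<open>At 0 the m-th derivative is m! times the coefficient, and the mean value theorem bounds
  its change up to z. This is the way to verify the last condition of \<open>root_cluster\<close>
  near 0.\<close>

lemma higher_pderiv_lower_bound:
  assumes "degree p \<le> n" "\<And>k. \<bar>coeff p k\<bar> \<le> A" "\<bar>z\<bar> \<le> W" "W \<le> 1"
  shows "fact m * \<bar>coeff p m\<bar> - W * poly_bound n (Suc m) A 1 \<le> \<bar>poly ((pderiv ^^ m) p) z\<bar>"
proof -
  let ?p = "(pderiv ^^ m) p"
  have "poly ?p 0 = fact m * coeff p m"
    by (simp add: poly_0_coeff_0 coeff_higher_pderiv pochhammer_fact)
  then have 0: "\<bar>poly ?p 0\<bar> = fact m * \<bar>coeff p m\<bar>" by (simp add: abs_mult)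
  obtain \<xi> where \<xi>: "\<xi> \<in> closed_segment 0 z" "poly ?p z - poly ?p 0 = (z - 0) * poly (pderiv ?p) \<xi>"
    using poly_MVT_segment by blast
  have "\<bar>\<xi>\<bar> \<le> 1" using \<xi>(1) assms(3,4) by (auto simp: closed_segment_eq_real_ivl split: if_splits)
  then have "\<bar>poly (pderiv ?p) \<xi>\<bar> \<le> poly_bound n (Suc m) A 1"
    using poly_bound[OF assms(1,2), of \<xi> 1 "Suc m"] by simp
  then have "\<bar>z\<bar> * \<bar>poly (pderiv ?p) \<xi>\<bar> \<le> W * poly_bound n (Suc m) A 1"
    using assms(3) by (intro mult_mono) auto
  then have "\<bar>poly ?p z - poly ?p 0\<bar> \<le> W * poly_bound n (Suc m) A 1" unfolding \<xi>(2) by (simp add: abs_mult)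
  then show ?thesis using 0 by linarith
qed

text \<open>Sorted roots with another value at s stay away from l by continuity, so near s the root
  l only takes values of sorted roots through \<open>l s\<close>. The index may change with
  t.\<close>

lemma eventually_root_eq_sroot:
  assumes q: "real_rooted_curve n J q" and J: "open J" "s \<in> J"
    and cont: "\<And>i. i < n \<Longrightarrow> isCont (\<lambda>t. sroot (q t) i) s"
    and l: "isCont l s" "\<And>t. t \<in> J \<Longrightarrow> poly (q t) (l t) = 0"
  shows "eventually (\<lambda>t. \<exists>i<n. sroot (q s) i = l s \<and> l t = sroot (q t) i) (at s)"
proof -
  have rr: "real_rooted (q t)" "degree (q t) = n" if "t \<in> J" for t
    using q that unfolding real_rooted_curve_def by blast+
  have "eventually (\<lambda>t. \<forall>i\<in>{i. i < n \<and> sroot (q s) i \<noteq> l s}. l t \<noteq> sroot (q t) i) (at s)"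
  proof (intro eventually_ball_finite ballI)
    fix i assume i: "i \<in> {i. i < n \<and> sroot (q s) i \<noteq> l s}"
    have "((\<lambda>t. l t - sroot (q t) i) \<longlongrightarrow> l s - sroot (q s) i) (at s)"
      using l(1) cont i by (intro tendsto_diff) (auto simp: isCont_def)
    then have "eventually (\<lambda>t. l t - sroot (q t) i \<noteq> 0) (at s)"
      by (rule tendsto_imp_eventually_ne) (use i in auto)
    then show "eventually (\<lambda>t. l t \<noteq> sroot (q t) i) (at s)" by simp
  qed simp
  moreover have "eventually (\<lambda>t. t \<in> J) (at s)" using J by (rule eventually_at_in_open')
  ultimately show ?thesis
  proof eventually_elim
    case (elim t)
    then obtain i where "i < n" "l t = sroot (q t) i"
      using l(2)[of t] poly_real_rooted_eq_0_iff[OF rr(1)[of t]] rr(2)[of t] by auto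
    then show ?case using elim by blast
  qed
qed

section \<open>Normal form and tangent polynomial\<close>

text \<open>Both the parameter and the root are moved to 0. The roots of \<open>q 0\<close> at 0
  occupy m consecutive sorted positions, and the number of derivatives demanded is exactly their
  multiplicity m.\<close>

locale root_at_zero =
  fixes q :: "real \<Rightarrow> real poly" and n m i0 :: nat and \<delta> :: real
  assumes \<delta>: "0 < \<delta>" and curve: "real_rooted_curve n {-\<delta><..<\<delta>} q"
    and coeffs: "\<And>k. Cn m {-\<delta><..<\<delta>} (\<lambda>t. coeff (q t) k)"
    and block: "\<And>i. i < n \<Longrightarrow> sroot (q 0) i = 0 \<longleftrightarrow> i0 \<le> i \<and> i < i0 + m"
    and i0m: "i0 + m \<le> n" and m: "0 < m"
begin

abbreviation "J \<equiv> {-\<delta><..<\<delta>}"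

lemma J: "open J" "0 \<in> J" "\<And>t. t \<in> J \<longleftrightarrow> \<bar>t\<bar> < \<delta>"
  using \<delta> by auto

lemma rr: "t \<in> J \<Longrightarrow> real_rooted (q t)" "t \<in> J \<Longrightarrow> degree (q t) = n"
  using curve unfolding real_rooted_curve_def by blast+

lemma continuous_on_sroots: "i < n \<Longrightarrow> continuous_on J (\<lambda>t. sroot (q t) i)"
proof -
  assume i: "i < n"
  obtain e where e: "e > 0" "\<And>t. t \<in> J \<Longrightarrow> real_rooted (q t) \<and> degree (q t) = n \<and> lead_coeff (q t) = e"
    using curve unfolding real_rooted_curve_def by blast
  show ?thesis
    by (rule continuous_on_sroot[of J q n e]) (use e i Cn_continuous_on[OF coeffs] in auto)
qed

lemma isCont_sroot: "i < n \<Longrightarrow> t \<in> J \<Longrightarrow> isCont (\<lambda>t. sroot (q t) i) t"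
  using continuous_on_sroots J(1) by (simp add: continuous_on_eq_continuous_at)

lemma eventually_J: "eventually (\<lambda>t. t \<in> J) (nhds 0)" "eventually (\<lambda>t. t \<in> J) (at 0)"
  using eventually_nhds_in_open[OF J(1,2)] eventually_at_in_open'[OF J(1,2)] by auto

lemma coeff_m_nonzero: "coeff (q 0) m \<noteq> 0"
proof -
  have A: "{i \<in> {..<n}. sroot (q 0) i = 0} = {i0..<i0+m}" using block i0m by auto
  have q0: "q 0 = smult (lead_coeff (q 0)) (\<Prod>i\<in>{..<n}. [:- sroot (q 0) i, 1:])"
    using real_rooted_factor[OF rr(1)[OF J(2)]] rr(2)[OF J(2)] by simp
  have "coeff (q 0) m = lead_coeff (q 0) * (\<Prod>i\<in>{..<n} - {i0..<i0+m}. - sroot (q 0) i)"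
    using coeff_prod_linear_zero_roots(2)[OF finite_lessThan[of n], where x = "sroot (q 0)" and c = "lead_coeff (q 0)"]
    unfolding A q0[symmetric] by simp
  also have "\<dots> \<noteq> 0" using rr(1)[OF J(2)] block by (auto simp: real_rooted_def)
  finally show ?thesis .
qed

text \<open>The uniform slope bound at the parameter 0. The m-th derivative of \<open>q 0\<close>
  does not vanish at 0, hence the last cluster condition holds on a small rectangle around the
  origin.\<close>

lemma sroot_bigo: "\<exists>L\<ge>0. eventually (\<lambda>h. \<forall>i\<in>{i0..<i0+m}. \<bar>sroot (q h) i\<bar> \<le> L * \<bar>h\<bar>) (at 0)"
proof -
  have "\<exists>A\<ge>0. smooth_coeffs m A {-(\<delta>/2)<..<\<delta>/2} q"
    by (rule smooth_coeffs_of_Cn[where n = n, OF coeffs]) (use rr \<delta> in auto)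
  then obtain A where A: "0 \<le> A" "smooth_coeffs m A {-(\<delta>/2)<..<\<delta>/2} q" by blast
  define PB where "PB = poly_bound n (Suc m) A 1"
  have PB: "0 \<le> PB" unfolding PB_def using A by (intro poly_bound_nonneg) auto
  define c0 where "c0 = fact m * \<bar>coeff (q 0) m\<bar>"
  have c0: "0 < c0" using coeff_m_nonzero by (simp add: c0_def)
  \<comment> \<open>c0 is the size of the m-th derivative at the origin. At least half of it
    survives for small t, and at most another quarter is lost for |z| \<le> W; this leaves the c0 /
    4 used for the cluster.\<close>
  define W where "W = min 1 (c0 / 4 / (PB + 1))"
  have W: "0 < W" "W \<le> 1" using c0 PB by (auto simp: W_def)
  have "W * PB \<le> c0 / 4 / (PB + 1) * (PB + 1)" using PB c0 W by (intro mult_mono) (auto simp: W_def)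
  also have "\<dots> = c0 / 4"
  proof -
    have "x / y * y = x" if "y \<noteq> 0" for x y :: real using that by simp
    then show ?thesis using PB by (metis add_nonneg_pos less_numeral_extra(1) less_numeral_extra(3))
  qed
  finally have WPB: "W * PB \<le> c0 / 4" .
  have "isCont (\<lambda>t. coeff (q t) m) 0"
    using Cn_continuous_on[OF coeffs] J by (simp add: continuous_on_eq_continuous_at)
  then have "((\<lambda>t. fact m * \<bar>coeff (q t) m\<bar>) \<longlongrightarrow> c0) (nhds 0)"
    unfolding c0_def by (intro tendsto_intros isCont_tendsto_nhds)
  then have "eventually (\<lambda>t. fact m * \<bar>coeff (q t) m\<bar> > c0 / 2) (nhds 0)"
    using c0 by (intro order_tendstoD) auto
  moreover have "eventually (\<lambda>t. \<forall>i\<in>{i0..<i0+m}. \<bar>sroot (q t) i\<bar> < W) (nhds 0)"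
  proof (intro eventually_ball_finite ballI)
    fix i assume i: "i \<in> {i0..<i0+m}"
    then have "isCont (\<lambda>t. sroot (q t) i) 0" using J(2) i0m by (intro isCont_sroot) auto
    then have "((\<lambda>t. \<bar>sroot (q t) i\<bar>) \<longlongrightarrow> \<bar>sroot (q 0) i\<bar>) (nhds 0)"
      by (intro tendsto_rabs isCont_tendsto_nhds)
    moreover have "\<bar>sroot (q 0) i\<bar> < W" using block[of i] i i0m W by simp
    ultimately show "eventually (\<lambda>t. \<bar>sroot (q t) i\<bar> < W) (nhds 0)" by (rule order_tendstoD)
  qed simp
  moreover have "eventually (\<lambda>t::real. t \<in> {-(\<delta>/2)<..<\<delta>/2}) (nhds 0)"
    using \<delta> by (intro eventually_nhds_in_open) auto
  ultimately have "eventually (\<lambda>t. fact m * \<bar>coeff (q t) m\<bar> > c0 / 2 \<and> (\<forall>i\<in>{i0..<i0+m}. \<bar>sroot (q t) i\<bar> < W) \<and> t \<in> {-(\<delta>/2)<..<\<delta>/2}) (nhds 0)"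
    by eventually_elim auto
  then obtain d where d: "d > 0" "\<And>t. dist t 0 < d \<Longrightarrow> fact m * \<bar>coeff (q t) m\<bar> > c0 / 2 \<and> (\<forall>i\<in>{i0..<i0+m}. \<bar>sroot (q t) i\<bar> < W) \<and> t \<in> {-(\<delta>/2)<..<\<delta>/2}"
    unfolding eventually_nhds_metric by blast
  have td: "dist t 0 < d" if "t \<in> {0-d<..<0+d}" for t using that by auto
  have tJ: "t \<in> J" if "t \<in> {0-d<..<0+d}" for t using d(2)[OF td[OF that]] \<delta> by auto
  have sub: "{0-d<..<0+d} \<subseteq> {-(\<delta>/2)<..<\<delta>/2}" using d(2)[OF td] by blast
  have sc: "smooth_coeffs m A {0-d<..<0+d} q"
    using A(2) sub by (rule smooth_coeffs_subset)
  have cA: "\<bar>coeff (q t) k\<bar> \<le> A" if "t \<in> {0-d<..<0+d}" for t k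
    using sc that by (rule smooth_coeffs_bound)
  have rc: "root_cluster n m (c0 / 4) A 1 {0-d<..<0+d} {-W..W} i0 q"
    unfolding root_cluster_def
  proof (intro conjI ballI allI impI)
    show "{-W..W} \<subseteq> {-1..1}" using W by auto
    show "is_interval {-W..W}" by (rule is_interval_cc)
    show "real_rooted_curve n {0-d<..<0+d} q"
      using curve tJ unfolding real_rooted_curve_def by blast
    show "sroot (q t) i \<in> {-W..W}" if "t \<in> {0-d<..<0+d}" "i0 \<le> i" "i < i0 + m" for t i
    proof -
      have "\<bar>sroot (q t) i\<bar> < W" using d(2)[OF td[OF that(1)]] that by auto
      then show ?thesis by auto
    qed
    show "c0 / 4 \<le> \<bar>poly ((pderiv ^^ m) (q t)) z\<bar>" if t: "t \<in> {0-d<..<0+d}" and z: "z \<in> {-W..W}" for t z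
    proof -
      have "fact m * \<bar>coeff (q t) m\<bar> - W * PB \<le> \<bar>poly ((pderiv ^^ m) (q t)) z\<bar>"
        unfolding PB_def by (rule higher_pderiv_lower_bound) (use rr(2)[OF tJ[OF t]] cA[OF t] z W in auto)
      then show ?thesis using d(2)[OF td[OF t]] WPB by auto
    qed
  qed (use i0m sc in auto)
  obtain m' where m': "m = Suc m'" using m by (cases m) auto
  obtain L where L: "L \<ge> 0" "\<And>i. i0 \<le> i \<Longrightarrow> i \<le> i0 + m' \<Longrightarrow>
      eventually (\<lambda>t. \<bar>sroot (q t) i - sroot (q 0) i\<bar> \<le> L * \<bar>t - 0\<bar>) (at 0)"
    using root_cluster_slope[of "c0/4" d A 1 n m'] rc c0 d(1) A(1) unfolding m' by fastforce
  have "eventually (\<lambda>h. \<forall>i\<in>{i0..<i0+m}. \<bar>sroot (q h) i\<bar> \<le> L * \<bar>h\<bar>) (at 0)"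
  proof (intro eventually_ball_finite ballI)
    fix i assume i: "i \<in> {i0..<i0+m}"
    then have "sroot (q 0) i = 0" using block[of i] i0m by auto
    then show "eventually (\<lambda>h. \<bar>sroot (q h) i\<bar> \<le> L * \<bar>h\<bar>) (at 0)" using L(2)[of i] i m' by simp
  qed simp
  then show ?thesis using L(1) by blast
qed

text \<open>The m roots near 0 are O(h) and the others stay bounded, so the polynomial at h w is
  O(h^m) uniformly for w in [0, 1]. Its coefficients in w are \<open>coeff (q h) k * h ^ k\<close>,
  and \<open>coeff_bound_interval\<close> applies to them.\<close>

lemma coeff_bigo:
  assumes k: "k \<le> n"
  shows "\<exists>C. eventually (\<lambda>h. \<bar>coeff (q h) k\<bar> * \<bar>h\<bar> ^ k \<le> C * \<bar>h\<bar> ^ m) (at 0)"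
proof -
  obtain L where L: "L \<ge> 0" "eventually (\<lambda>h. \<forall>i\<in>{i0..<i0+m}. \<bar>sroot (q h) i\<bar> \<le> L * \<bar>h\<bar>) (at 0)"
    using sroot_bigo by blast
  obtain e where e: "e > 0" "\<And>t. t \<in> J \<Longrightarrow> real_rooted (q t) \<and> degree (q t) = n \<and> lead_coeff (q t) = e"
    using curve unfolding real_rooted_curve_def by blast
  define far where "far = {..<n} - {i0..<i0+m}"
  define B where "B = (\<Prod>i\<in>far. 2 + \<bar>sroot (q 0) i\<bar>)"
  obtain C where C: "C \<ge> 0" "\<And>c B. (\<forall>x\<in>{0..1::real}. \<bar>\<Sum>j<Suc n. c j * x ^ j\<bar> \<le> B) \<Longrightarrow> (\<forall>j<Suc n. \<bar>c j\<bar> \<le> C * B)"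
    using coeff_bound_interval[of "Suc n"] by blast
  have "eventually (\<lambda>t. \<forall>i\<in>far. \<bar>sroot (q t) i\<bar> < 1 + \<bar>sroot (q 0) i\<bar>) (at 0)"
  proof (intro eventually_ball_finite ballI)
    fix i assume i: "i \<in> far"
    then have "((\<lambda>t. \<bar>sroot (q t) i\<bar>) \<longlongrightarrow> \<bar>sroot (q 0) i\<bar>) (at 0)"
      using isCont_sroot[of i 0] J by (intro tendsto_intros) (auto simp: isCont_def far_def)
    then show "eventually (\<lambda>t. \<bar>sroot (q t) i\<bar> < 1 + \<bar>sroot (q 0) i\<bar>) (at 0)" by (rule order_tendstoD) simp
  qed (simp add: far_def)
  moreover have "eventually (\<lambda>h::real. \<bar>h\<bar> \<le> 1) (at 0)"
    unfolding eventually_at by (intro exI[of _ 1]) auto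
  ultimately have "eventually (\<lambda>h. \<bar>coeff (q h) k\<bar> * \<bar>h\<bar> ^ k \<le> (C * (e * (L + 1) ^ m * B)) * \<bar>h\<bar> ^ m) (at 0)"
    using L(2) eventually_J(2)
  proof eventually_elim
    case (elim h)
    have "\<bar>\<Sum>j<Suc n. (coeff (q h) j * h ^ j) * w ^ j\<bar> \<le> e * (((L + 1) * \<bar>h\<bar>) ^ m * B)" if w: "w \<in> {0..1}" for w
    proof -
      have hw: "\<bar>h * w\<bar> \<le> \<bar>h\<bar>" using w by (auto simp: abs_mult mult_left_le)
      have "(\<Sum>j<Suc n. (coeff (q h) j * h ^ j) * w ^ j) = poly (q h) (h * w)"
        using poly_sum_atMost[of "q h" n "h * w"] e(2) elim by (simp add: power_mult_distrib mult_ac lessThan_Suc_atMost)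
      also have "\<dots> = e * (\<Prod>i<n. h * w - sroot (q h) i)"
        using e(2)[of h] elim poly_real_rooted[of "q h" "h * w"] by metis
      also have "\<bar>\<dots>\<bar> = e * (\<Prod>i<n. \<bar>h * w - sroot (q h) i\<bar>)"
        using e(1) by (simp add: abs_mult abs_prod)
      also have "(\<Prod>i<n. \<bar>h * w - sroot (q h) i\<bar>) = (\<Prod>i\<in>far. \<bar>h * w - sroot (q h) i\<bar>) * (\<Prod>i=i0..<i0+m. \<bar>h * w - sroot (q h) i\<bar>)"
        unfolding far_def by (rule prod.subset_diff) (use i0m in auto)
      also have "\<dots> \<le> B * (\<Prod>i=i0..<i0+m. (L + 1) * \<bar>h\<bar>)"
        unfolding B_def
      proof (intro mult_mono prod_mono conjI)
        fix i assume "i \<in> far"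
        then have "\<bar>sroot (q h) i\<bar> < 1 + \<bar>sroot (q 0) i\<bar>" using elim by auto
        then show "\<bar>h * w - sroot (q h) i\<bar> \<le> 2 + \<bar>sroot (q 0) i\<bar>" using hw elim by linarith
      next
        fix i assume "i \<in> {i0..<i0+m}"
        then have "\<bar>sroot (q h) i\<bar> \<le> L * \<bar>h\<bar>" using elim by auto
        then show "\<bar>h * w - sroot (q h) i\<bar> \<le> (L + 1) * \<bar>h\<bar>" using hw by (simp add: algebra_simps)
      qed (use L(1) in \<open>auto intro: prod_nonneg\<close>)
      finally show ?thesis using e(1) by (simp add: mult_ac)
    qed
    then have "\<bar>coeff (q h) k * h ^ k\<bar> \<le> C * (e * (((L + 1) * \<bar>h\<bar>) ^ m * B))"
      using C(2)[of "\<lambda>j. coeff (q h) j * h ^ j" "e * (((L + 1) * \<bar>h\<bar>) ^ m * B)"] k by simp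
    then show ?case by (simp add: abs_mult power_abs power_mult_distrib mult_ac)
  qed
  then show ?thesis by blast
qed

end

lemma proots_prod_linear_image:
  fixes R :: "'a \<Rightarrow> real"
  assumes "finite A" "c \<noteq> 0"
  shows "proots (smult c (\<Prod>j\<in>A. [:- R j, 1:])) = image_mset R (mset_set A)"
proof -
  have "proots (\<Prod>j\<in>A. [:- R j, 1:]) = (\<Sum>j\<in>A. proots [:- R j, 1:])" by (rule proots_prod) auto
  also have "\<dots> = image_mset R (mset_set A)" using assms(1) by (induction A) auto
  finally show ?thesis using assms(2) by simp
qed

context root_at_zero
begin

lemma coeff_below_m: "k < m \<Longrightarrow> coeff (q 0) k = 0"
proof -
  have A: "{i \<in> {..<n}. sroot (q 0) i = 0} = {i0..<i0+m}" using block i0m by auto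
  have q0: "q 0 = smult (lead_coeff (q 0)) (\<Prod>i\<in>{..<n}. [:- sroot (q 0) i, 1:])"
    using real_rooted_factor[OF rr(1)[OF J(2)]] rr(2)[OF J(2)] by simp
  show "k < m \<Longrightarrow> coeff (q 0) k = 0"
    using coeff_prod_linear_zero_roots(1)[OF finite_lessThan[of n], where x = "sroot (q 0)" and c = "lead_coeff (q 0)" and k = k]
    unfolding A q0[symmetric] by simp
qed

text \<open>The scaled time derivatives of the coefficients converge as well, which keeps the
  blow-up smooth in the rescaled time. For k + j < m this is Taylor's theorem for a function of
  order m - k at 0. For fixed k < m all limits are multiples of the single number
  \<open>D k (m - k) 0\<close>, so they vanish together with \<gamma> k 0.\<close>

lemma coeff_limits:
  "\<exists>(D :: nat \<Rightarrow> nat \<Rightarrow> real \<Rightarrow> real) (\<gamma> :: nat \<Rightarrow> nat \<Rightarrow> real). (\<forall>k. D k 0 = (\<lambda>t. coeff (q t) k)) \<and>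
     (\<forall>k j t. j < m \<longrightarrow> t \<in> J \<longrightarrow> (D k j has_real_derivative D k (Suc j) t) (at t)) \<and>
     (\<forall>k\<le>n. \<forall>j\<le>m. ((\<lambda>h. D k j h * h ^ (k + j) / h ^ m) \<longlongrightarrow> \<gamma> k j) (at 0)) \<and>
     (\<forall>k<m. \<forall>j. \<gamma> k 0 = 0 \<longrightarrow> \<gamma> k j = 0) \<and> \<gamma> m 0 = coeff (q 0) m"
proof -
  have "\<exists>D :: nat \<Rightarrow> real \<Rightarrow> real. D 0 = (\<lambda>t. coeff (q t) k) \<and> (\<forall>j<m. \<forall>t\<in>J. (D j has_real_derivative D (Suc j) t) (at t)) \<and>
      (\<forall>j\<le>m. continuous_on J (D j))" for k
    using Cn_derivatives[OF coeffs[of k]] by metis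
  then obtain D :: "nat \<Rightarrow> nat \<Rightarrow> real \<Rightarrow> real" where D: "\<And>k. D k 0 = (\<lambda>t. coeff (q t) k)"
    "\<And>k j t. j < m \<Longrightarrow> t \<in> J \<Longrightarrow> (D k j has_real_derivative D k (Suc j) t) (at t)"
    "\<And>k j. j \<le> m \<Longrightarrow> continuous_on J (D k j)"
    by metis
  define \<gamma> :: "nat \<Rightarrow> nat \<Rightarrow> real" where "\<gamma> k j = (if m < k + j then 0 else D k (m - k) 0 / fact (m - k - j))" for k j
  have cD: "isCont (D k j) 0" if "j \<le> m" for k j
    using D(3)[OF that] J by (simp add: continuous_on_eq_continuous_at)
  have nz: "eventually (\<lambda>h::real. h \<noteq> 0) (at 0)" by (simp add: eventually_at_filter)
  have lim: "((\<lambda>h. D k j h * h ^ (k + j) / h ^ m) \<longlongrightarrow> \<gamma> k j) (at 0)" if k: "k \<le> n" and j: "j \<le> m" for k j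
  proof (cases "m \<le> k + j")
    case True
    have "((\<lambda>h. D k j h * h ^ (k + j - m)) \<longlongrightarrow> D k j 0 * 0 ^ (k + j - m)) (at 0)"
      using cD[OF j] by (intro tendsto_intros) (simp add: isCont_def)
    moreover have "D k j 0 * 0 ^ (k + j - m) = \<gamma> k j"
      using True by (cases "m = k + j") (auto simp: \<gamma>_def power_0_left)
    ultimately have "((\<lambda>h. D k j h * h ^ (k + j - m)) \<longlongrightarrow> \<gamma> k j) (at 0)" by simp
    then show ?thesis
    proof (rule Lim_transform_eventually)
      show "eventually (\<lambda>h. D k j h * h ^ (k + j - m) = D k j h * h ^ (k + j) / h ^ m) (at 0)"
        using nz
      proof eventually_elim
        case (elim h)
        have "h ^ (k + j) = h ^ (k + j - m) * h ^ m" using True by (simp flip: power_add)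
        then show ?case using elim by simp
      qed
    qed
  next
    case False
    define r where "r = m - k"
    have r: "r \<le> m" "j \<le> r" using False by (auto simp: r_def)
    obtain C where C: "eventually (\<lambda>h. \<bar>coeff (q h) k\<bar> * \<bar>h\<bar> ^ k \<le> C * \<bar>h\<bar> ^ m) (at 0)"
      using coeff_bigo[OF k] by blast
    have "((\<lambda>t. D k j t / t ^ (r - j)) \<longlongrightarrow> D k r 0 / fact (r - j)) (at 0)"
    proof (rule derivatives_of_bigo_power[OF \<delta>])
      show "eventually (\<lambda>t. \<bar>D k 0 t\<bar> \<le> C * \<bar>t\<bar> ^ r) (at 0)"
        using C nz
      proof eventually_elim
        case (elim h)
        have "\<bar>h\<bar> ^ m = \<bar>h\<bar> ^ r * \<bar>h\<bar> ^ k" using False by (simp add: r_def flip: power_add)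
        then have "\<bar>coeff (q h) k\<bar> * \<bar>h\<bar> ^ k \<le> (C * \<bar>h\<bar> ^ r) * \<bar>h\<bar> ^ k" using elim by (simp add: mult_ac)
        then show ?case using elim by (simp add: D(1) mult_le_cancel_right)
      qed
    qed (use D(2) cD r J(3) in auto)
    moreover have "D k r 0 / fact (r - j) = \<gamma> k j" using False by (simp add: \<gamma>_def r_def)
    ultimately have "((\<lambda>t. D k j t / t ^ (r - j)) \<longlongrightarrow> \<gamma> k j) (at 0)" by simp
    then show ?thesis
    proof (rule Lim_transform_eventually)
      show "eventually (\<lambda>h. D k j h / h ^ (r - j) = D k j h * h ^ (k + j) / h ^ m) (at 0)"
        using nz
      proof eventually_elim
        case (elim h)
        have "h ^ m = h ^ (r - j) * h ^ (k + j)" using False by (simp add: r_def flip: power_add)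
        then show ?case using elim by simp
      qed
    qed
  qed
  have "\<gamma> k j = 0" if "k < m" "\<gamma> k 0 = 0" for k j using that by (simp add: \<gamma>_def split: if_splits)
  moreover have "\<gamma> m 0 = coeff (q 0) m" by (simp add: \<gamma>_def D(1))
  ultimately show ?thesis using D lim by blast
qed

text \<open>The limit of the scaled polynomial, taken coefficient by coefficient. \<open>Lim\<close>
  is two-sided here, so one polynomial describes both sides of 0; the limits exist by
  \<open>coeff_limits\<close>.\<close>

definition tangent_poly :: "real poly" where
  "tangent_poly = (\<Sum>k\<le>n. monom (Lim (at 0) (\<lambda>h. coeff (q h) k * h ^ k / h ^ m)) k)"

lemma coeff_tangent_poly: "k \<le> n \<Longrightarrow> coeff tangent_poly k = Lim (at 0) (\<lambda>h. coeff (q h) k * h ^ k / h ^ m)"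
  unfolding tangent_poly_def by (simp add: coeff_sum)

lemma degree_tangent_poly: "degree tangent_poly \<le> n"
  unfolding tangent_poly_def by (intro degree_sum_le) (auto intro: order_trans[OF degree_monom_le])

lemma tangent_poly_limits:
  shows tendsto_coeff_tangent_poly: "k \<le> n \<Longrightarrow> ((\<lambda>h. coeff (q h) k * h ^ k / h ^ m) \<longlongrightarrow> coeff tangent_poly k) (at 0)"
    and tangent_poly_nonzero: "tangent_poly \<noteq> 0"
proof -
  obtain D :: "nat \<Rightarrow> nat \<Rightarrow> real \<Rightarrow> real" and \<gamma> :: "nat \<Rightarrow> nat \<Rightarrow> real" where D: "\<forall>k. D k 0 = (\<lambda>t. coeff (q t) k)"
     "\<forall>k\<le>n. \<forall>j\<le>m. ((\<lambda>h. D k j h * h ^ (k + j) / h ^ m) \<longlongrightarrow> \<gamma> k j) (at 0)"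
     "\<gamma> m 0 = coeff (q 0) m"
    using coeff_limits by blast
  have lim: "((\<lambda>h. coeff (q h) k * h ^ k / h ^ m) \<longlongrightarrow> \<gamma> k 0) (at 0)" if "k \<le> n" for k
    using D(2)[rule_format, OF that, of 0] D(1) by simp
  have eq: "coeff tangent_poly k = \<gamma> k 0" if "k \<le> n" for k
    using tendsto_Lim[OF _ lim[OF that]] that by (simp add: coeff_tangent_poly)
  show "((\<lambda>h. coeff (q h) k * h ^ k / h ^ m) \<longlongrightarrow> coeff tangent_poly k) (at 0)" if "k \<le> n"
    using lim[OF that] eq[OF that] by simp
  have "coeff tangent_poly m \<noteq> 0" using eq[of m] D(3) coeff_m_nonzero i0m by simp
  then show "tangent_poly \<noteq> 0" by auto
qed

text \<open>Convergence of the coefficients is uniform on bounded arguments, so the argument may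
  vary with h. The general filter F covers the two one-sided limits.\<close>

lemma tendsto_tangent_poly:
  assumes F: "F \<le> at 0" and w: "eventually (\<lambda>h. \<bar>w h\<bar> \<le> B) F"
  shows "((\<lambda>h. poly (q h) (h * w h) / h ^ m - poly tangent_poly (w h)) \<longlongrightarrow> 0) F"
proof -
  have "((\<lambda>h. \<Sum>k\<le>n. (coeff (q h) k * h ^ k / h ^ m - coeff tangent_poly k) * w h ^ k) \<longlongrightarrow> (\<Sum>k\<le>n. 0)) F"
  proof (rule tendsto_sum)
    fix k assume k: "k \<in> {..n}"
    have "((\<lambda>h. coeff (q h) k * h ^ k / h ^ m - coeff tangent_poly k) \<longlongrightarrow> 0) F"
      using tendsto_coeff_tangent_poly[of k] k F by (auto intro: tendsto_mono simp: LIM_zero_iff)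
    moreover have "eventually (\<lambda>h. norm (w h ^ k) \<le> B ^ k) F"
      using w by eventually_elim (simp add: power_abs power_mono)
    ultimately show "((\<lambda>h. (coeff (q h) k * h ^ k / h ^ m - coeff tangent_poly k) * w h ^ k) \<longlongrightarrow> 0) F"
      by (rule lim_null_mult_right_bounded)
  qed
  then have "((\<lambda>h. \<Sum>k\<le>n. (coeff (q h) k * h ^ k / h ^ m - coeff tangent_poly k) * w h ^ k) \<longlongrightarrow> 0) F" by simp
  then show ?thesis
  proof (rule Lim_transform_eventually)
    have "eventually (\<lambda>h. h \<in> J) F" using eventually_J(2) F by (rule filter_leD[rotated])
    then show "eventually (\<lambda>h. (\<Sum>k\<le>n. (coeff (q h) k * h ^ k / h ^ m - coeff tangent_poly k) * w h ^ k)
        = poly (q h) (h * w h) / h ^ m - poly tangent_poly (w h)) F"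
    proof eventually_elim
      case (elim h)
      have "poly (q h) (h * w h) = (\<Sum>k\<le>n. coeff (q h) k * (h * w h) ^ k)"
        using rr(2)[OF elim] by (intro poly_sum_atMost) simp
      moreover have "poly tangent_poly (w h) = (\<Sum>k\<le>n. coeff tangent_poly k * w h ^ k)"
        using degree_tangent_poly by (rule poly_sum_atMost)
      ultimately show ?case
        unfolding sum_divide_distrib sum_subtractf[symmetric]
        by (simp only: sum_divide_distrib sum_subtractf[symmetric], intro sum.cong refl)
          (simp add: left_diff_distrib power_mult_distrib)
    qed
  qed
qed

text \<open>The quotient l h / h is bounded by \<open>sroot_bigo\<close>, and
  \<open>tangent_poly\<close> along it tends to 0 because \<open>q h\<close> vanishes at
  \<open>l h\<close>. Existence of the limit follows from \<open>limit_of_poly_limit_zero\<close>,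
  on the left after a reflection.\<close>

lemma root_one_sided_derivatives:
  assumes l: "continuous_on J l" "l 0 = 0" "\<And>t. t \<in> J \<Longrightarrow> poly (q t) (l t) = 0"
  shows "\<exists>\<nu>. ((\<lambda>h. l h / h) \<longlongrightarrow> \<nu>) (at_right 0)" "\<exists>\<nu>. ((\<lambda>h. l h / h) \<longlongrightarrow> \<nu>) (at_left 0)"
proof -
  obtain L where L: "L \<ge> 0" "eventually (\<lambda>h. \<forall>i\<in>{i0..<i0+m}. \<bar>sroot (q h) i\<bar> \<le> L * \<bar>h\<bar>) (at 0)"
    using sroot_bigo by blast
  have "isCont l 0" using l(1) J by (simp add: continuous_on_eq_continuous_at)
  then have "eventually (\<lambda>t. \<exists>i<n. sroot (q 0) i = l 0 \<and> l t = sroot (q t) i) (at 0)"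
    using curve J isCont_sroot l by (intro eventually_root_eq_sroot[of n J q]) auto
  then have "eventually (\<lambda>h. \<bar>l h\<bar> \<le> L * \<bar>h\<bar>) (at 0)"
    using L(2)
  proof eventually_elim
    case (elim h)
    then obtain i where i: "i < n" "sroot (q 0) i = 0" "l h = sroot (q h) i" using l(2) by auto
    then have "i \<in> {i0..<i0+m}" using block by auto
    then show ?case using elim i by auto
  qed
  then obtain d0 where d0: "d0 > 0" "\<And>h. h \<noteq> 0 \<Longrightarrow> dist h 0 < d0 \<Longrightarrow> \<bar>l h\<bar> \<le> L * \<bar>h\<bar>"
    unfolding eventually_at by auto
  define d where "d = min d0 \<delta>"
  have d: "d > 0" using d0 \<delta> by (simp add: d_def)
  have bd: "\<bar>l h / h\<bar> \<le> L" if "h \<noteq> 0" "\<bar>h\<bar> < d" for h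
    using d0(2)[of h] that by (simp add: d_def divide_le_eq)
  have ev: "eventually (\<lambda>h. \<bar>l h / h\<bar> \<le> L) (at 0)"
    unfolding eventually_at using bd d by (intro exI[of _ d]) auto
  have "((\<lambda>h. poly (q h) (h * (l h / h)) / h ^ m - poly tangent_poly (l h / h)) \<longlongrightarrow> 0) (at 0)"
    by (rule tendsto_tangent_poly[OF order_refl ev])
  then have "((\<lambda>h. - poly tangent_poly (l h / h)) \<longlongrightarrow> 0) (at 0)"
  proof (rule Lim_transform_eventually)
    have "eventually (\<lambda>h::real. h \<noteq> 0) (at 0)" by (simp add: eventually_at_filter)
    then show "eventually (\<lambda>h. poly (q h) (h * (l h / h)) / h ^ m - poly tangent_poly (l h / h) = - poly tangent_poly (l h / h)) (at 0)"
      using eventually_J(2) by eventually_elim (use l(3) in auto)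
  qed
  then have K: "((\<lambda>h. poly tangent_poly (l h / h)) \<longlongrightarrow> 0) (at 0)"
    using tendsto_minus[of "\<lambda>h. - poly tangent_poly (l h / h)" 0 "at 0"] by simp
  show "\<exists>\<nu>. ((\<lambda>h. l h / h) \<longlongrightarrow> \<nu>) (at_right 0)"
  proof (rule limit_of_poly_limit_zero[OF tangent_poly_nonzero d])
    show "continuous_on {0<..<d} (\<lambda>h. l h / h)"
      by (intro continuous_intros continuous_on_subset[OF l(1)]) (auto simp: d_def)
    show "((\<lambda>h. poly tangent_poly (l h / h)) \<longlongrightarrow> 0) (at_right 0)"
      using K by (rule tendsto_mono[rotated]) (simp add: at_le)
    show "\<bar>l h / h\<bar> \<le> L" if "0 < h" "h < d" for h using bd[of h] that by simp
  qed
  have "\<exists>\<nu>. ((\<lambda>h. l (- h) / (- h)) \<longlongrightarrow> \<nu>) (at_right 0)"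
  proof (rule limit_of_poly_limit_zero[OF tangent_poly_nonzero d])
    show "continuous_on {0<..<d} (\<lambda>h. l (- h) / (- h))"
      by (intro continuous_intros continuous_on_compose2[OF l(1)]) (auto simp: d_def)
    have "((\<lambda>h. poly tangent_poly (l h / h)) \<longlongrightarrow> 0) (at_left 0)"
      using K by (rule tendsto_mono[rotated]) (simp add: at_le)
    then show "((\<lambda>h. poly tangent_poly (l (- h) / (- h))) \<longlongrightarrow> 0) (at_right 0)"
      by (simp add: filterlim_at_left_to_right)
    show "\<bar>l (- h) / (- h)\<bar> \<le> L" if "0 < h" "h < d" for h using bd[of "- h"] that by simp
  qed
  then show "\<exists>\<nu>. ((\<lambda>h. l h / h) \<longlongrightarrow> \<nu>) (at_left 0)"
    by (simp add: filterlim_at_left_to_right)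
qed

text \<open>For fixed w the scaled product splits into m factors w - L j h / h of the roots through
  0 and the other factors, which tend to - L j 0. The roots are not assumed to be sorted, since the
  result is applied to arbitrary continuous systems.\<close>

lemma tangent_poly_roots:
  fixes L :: "'a \<Rightarrow> real \<Rightarrow> real"
  assumes N: "finite N" and e: "e \<noteq> 0" and q: "\<And>h. h \<in> J \<Longrightarrow> q h = smult e (\<Prod>j\<in>N. [:- L j h, 1:])"
    and cont: "\<And>j. j \<in> N \<Longrightarrow> isCont (L j) 0" and F: "F \<le> at 0" "F \<noteq> bot"
    and R: "\<And>j. j \<in> N \<Longrightarrow> L j 0 = 0 \<Longrightarrow> ((\<lambda>h. L j h / h) \<longlongrightarrow> R j) F"
  defines "A \<equiv> {j\<in>N. L j 0 = 0}"
  shows "card A = m" "tangent_poly = smult (e * (\<Prod>j\<in>N - A. - L j 0)) (\<Prod>j\<in>A. [:- R j, 1:])"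
proof -
  have q0: "q 0 = smult e (\<Prod>j\<in>N. [:- L j 0, 1:])" using q J(2) by blast
  have "(\<Prod>j\<in>N - A. - L j 0) \<noteq> 0" using N by (auto simp: A_def)
  then have "coeff (q 0) (card A) \<noteq> 0"
    using coeff_prod_linear_zero_roots(2)[OF N, of e "\<lambda>j. L j 0"] e by (simp add: q0 A_def)
  moreover have "coeff (q 0) k = 0" if "k < card A" for k
    using coeff_prod_linear_zero_roots(1)[OF N, of k "\<lambda>j. L j 0" e] that by (simp add: q0 A_def)
  \<comment> \<open>Both numbers are the index of the lowest nonzero coefficient of
    \<open>q 0\<close>.\<close>
  ultimately show cA: "card A = m"
    using coeff_m_nonzero coeff_below_m by (metis linorder_neqE_nat)
  show "tangent_poly = smult (e * (\<Prod>j\<in>N - A. - L j 0)) (\<Prod>j\<in>A. [:- R j, 1:])"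
  proof (rule poly_ext)
    fix w
    have "((\<lambda>h. poly (q h) (h * w) / h ^ m - poly tangent_poly w) \<longlongrightarrow> 0) F"
      by (rule tendsto_tangent_poly[OF F(1), of _ "\<bar>w\<bar>"]) simp
    then have 1: "((\<lambda>h. poly (q h) (h * w) / h ^ m) \<longlongrightarrow> poly tangent_poly w) F"
      by (simp add: LIM_zero_iff)
    have F0: "((\<lambda>h. h) \<longlongrightarrow> 0) F" using F(1) by (rule tendsto_mono) (rule tendsto_ident_at)
    have "((\<lambda>h. e * ((\<Prod>j\<in>A. w - L j h / h) * (\<Prod>j\<in>N - A. h * w - L j h)))
        \<longlongrightarrow> e * ((\<Prod>j\<in>A. w - R j) * (\<Prod>j\<in>N - A. 0 * w - L j 0))) F"
      using cont F(1) R by (intro tendsto_intros F0) (auto simp: A_def isCont_def intro: tendsto_mono)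
    then have "((\<lambda>h. poly (q h) (h * w) / h ^ m) \<longlongrightarrow> e * ((\<Prod>j\<in>A. w - R j) * (\<Prod>j\<in>N - A. 0 * w - L j 0))) F"
    proof (rule Lim_transform_eventually)
      have "eventually (\<lambda>h. h \<in> J) (at 0)" "eventually (\<lambda>h::real. h \<noteq> 0) (at 0)"
        using eventually_J(2) by (auto simp: eventually_at_filter)
      then have "eventually (\<lambda>h. h \<in> J) F" "eventually (\<lambda>h::real. h \<noteq> 0) F"
        using F(1) by (auto intro: filter_leD)
      then show "eventually (\<lambda>h. e * ((\<Prod>j\<in>A. w - L j h / h) * (\<Prod>j\<in>N - A. h * w - L j h)) = poly (q h) (h * w) / h ^ m) F"
      proof eventually_elim
        case (elim h)
        have "(\<Prod>j\<in>A. w - L j h / h) * h ^ m = (\<Prod>j\<in>A. (w - L j h / h) * h)"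
          by (simp add: prod.distrib cA)
        also have "\<dots> = (\<Prod>j\<in>A. h * w - L j h)" using elim by (intro prod.cong) (auto simp: field_simps)
        finally have a: "(\<Prod>j\<in>A. h * w - L j h) / h ^ m = (\<Prod>j\<in>A. w - L j h / h)"
          using elim by (simp add: field_simps)
        have "poly (q h) (h * w) = e * (\<Prod>j\<in>N. h * w - L j h)"
          using q elim by (simp add: poly_prod)
        also have "(\<Prod>j\<in>N. h * w - L j h) = (\<Prod>j\<in>N - A. h * w - L j h) * (\<Prod>j\<in>A. h * w - L j h)"
          by (rule prod.subset_diff) (use N in \<open>auto simp: A_def\<close>)
        finally have b: "poly (q h) (h * w) = e * ((\<Prod>j\<in>N - A. h * w - L j h) * (\<Prod>j\<in>A. h * w - L j h))" .
        have "e * (X / c * Y) = e * (Y * X) / c" for X Y c :: real by simp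
        then show ?case unfolding a[symmetric] b .
      qed
    qed
    from tendsto_unique[OF F(2) 1 this]
    show "poly tangent_poly w = poly (smult (e * (\<Prod>j\<in>N - A. - L j 0)) (\<Prod>j\<in>A. [:- R j, 1:])) w"
      by (simp add: poly_prod mult_ac)
  qed
qed

text \<open>One polynomial is factored with the right and with the left derivatives. A single branch
  may have two different derivatives; only the multisets agree.\<close>

lemma left_right_derivatives_eq:
  fixes L :: "'a \<Rightarrow> real \<Rightarrow> real"
  assumes N: "finite N" and e: "e \<noteq> 0" and q: "\<And>h. h \<in> J \<Longrightarrow> q h = smult e (\<Prod>j\<in>N. [:- L j h, 1:])"
    and cont: "\<And>j. j \<in> N \<Longrightarrow> isCont (L j) 0"
    and R: "\<And>j. j \<in> N \<Longrightarrow> L j 0 = 0 \<Longrightarrow> ((\<lambda>h. L j h / h) \<longlongrightarrow> R j) (at_right 0)"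
    and R': "\<And>j. j \<in> N \<Longrightarrow> L j 0 = 0 \<Longrightarrow> ((\<lambda>h. L j h / h) \<longlongrightarrow> R' j) (at_left 0)"
  shows "image_mset R (mset_set {j\<in>N. L j 0 = 0}) = image_mset R' (mset_set {j\<in>N. L j 0 = 0})"
proof -
  let ?A = "{j\<in>N. L j 0 = 0}" and ?c = "e * (\<Prod>j\<in>N - {j\<in>N. L j 0 = 0}. - L j 0)"
  have c: "?c \<noteq> 0" using e N by auto
  have 1: "tangent_poly = smult ?c (\<Prod>j\<in>?A. [:- R j, 1:])"
    by (rule tangent_poly_roots(2)[OF N e q cont _ _ R]) (auto simp: at_le)
  have 2: "tangent_poly = smult ?c (\<Prod>j\<in>?A. [:- R' j, 1:])"
    by (rule tangent_poly_roots(2)[OF N e q cont _ _ R']) (auto simp: at_le)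
  have fA: "finite ?A" using N by simp
  have "proots tangent_poly = image_mset R (mset_set ?A)"
    by (subst 1) (rule proots_prod_linear_image[OF fA c])
  moreover have "proots tangent_poly = image_mset R' (mset_set ?A)"
    by (subst 2) (rule proots_prod_linear_image[OF fA c])
  ultimately show ?thesis by (rule trans[OF sym])
qed

end

lemma convex_nat_set:
  fixes B :: "nat set"
  assumes B: "finite B" "B \<noteq> {}" and conv: "\<And>i j k. i \<in> B \<Longrightarrow> k \<in> B \<Longrightarrow> i \<le> j \<Longrightarrow> j \<le> k \<Longrightarrow> j \<in> B"
  shows "B = {Min B..<Min B + card B}"
proof -
  have "{Min B..Max B} \<subseteq> B" using conv[OF Min_in[OF B] Max_in[OF B]] by auto
  moreover have "B \<subseteq> {Min B..Max B}" using B by auto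
  ultimately have *: "B = {Min B..Max B}" by (rule subset_antisym[rotated])
  have "card B = card {Min B..Max B}" using * by (rule arg_cong)
  moreover have "Min B \<le> Max B" using B by simp
  ultimately have "Min B + card B = Suc (Max B)" by simp
  then show ?thesis using * by (metis atLeastLessThanSuc_atLeastAtMost)
qed

context root_at_zero
begin

(* The rescaling t = s (1 + x), z = eta s v turns the roots that are o(t) into a cluster to which
   the a-priori slope bound applies with constants independent of s and eta. *)
lemma slope_of_flat_roots:
  assumes R: "\<And>i. i \<in> {i0..<i0+m} \<Longrightarrow> ((\<lambda>h. sroot (q h) i / h) \<longlongrightarrow> R i) (at_right 0)" and \<epsilon>: "0 < \<epsilon>"
  shows "eventually (\<lambda>s. \<forall>i\<in>{i0..<i0+m}. R i = 0 \<longrightarrow>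
     eventually (\<lambda>t. \<bar>sroot (q t) i - sroot (q s) i\<bar> \<le> \<epsilon> * \<bar>t - s\<bar>) (at s)) (at_right 0)"
proof -
  define B where "B = {i\<in>{i0..<i0+m}. R i = 0}"
  define l where "l = card B"
  show ?thesis
  proof (cases "B = {}")
    case True
    then show ?thesis by (auto simp: B_def)
  next
    case False
    have fB: "finite B" by (simp add: B_def)
    have evJ: "eventually (\<lambda>h. h \<in> J) (at_right 0)" using eventually_J(2) by (rule filter_leD[rotated]) (simp add: at_le)
    \<comment> \<open>For h > 0 division by h preserves the order of the sorted roots. The limits R
      therefore increase with the index, and the indices with R i = 0 form a block.\<close>
    have Rmono: "R i \<le> R j" if "i \<in> {i0..<i0+m}" "j \<in> {i0..<i0+m}" "i \<le> j" for i j
    proof (rule tendsto_le[OF _ R[OF that(2)] R[OF that(1)]])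
      show "eventually (\<lambda>h. sroot (q h) i / h \<le> sroot (q h) j / h) (at_right 0)"
        using evJ eventually_at_right_less
      proof eventually_elim
        case (elim h)
        have "sroot (q h) i \<le> sroot (q h) j"
          using rr[OF elim(1)] that i0m by (intro sroot_mono) auto
        then show ?case using elim by (intro divide_right_mono) auto
      qed
    qed simp
    define i1 where "i1 = Min B"
    have Beq: "B = {i1..<i1 + l}" unfolding i1_def l_def
    proof (rule convex_nat_set[OF fB False])
      fix i j k assume "i \<in> B" "k \<in> B" "i \<le> j" "j \<le> k"
      then show "j \<in> B" using Rmono[of i j] Rmono[of j k] by (auto simp: B_def)
    qed
    have l0: "0 < l" using False fB by (auto simp: l_def card_gt_0_iff)
    have "l \<le> card {i0..<i0+m}" unfolding l_def B_def by (intro card_mono) auto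
    then have lm: "l \<le> m" by simp
    have ln: "l \<le> n" using lm i0m by simp
    have i1n: "i1 + l \<le> n"
    proof -
      have "i1 + l - 1 \<in> B" using Beq l0 by auto
      then show ?thesis using i0m l0 by (auto simp: B_def)
    qed
    obtain e where e: "e > 0" "\<And>t. t \<in> J \<Longrightarrow> real_rooted (q t) \<and> degree (q t) = n \<and> lead_coeff (q t) = e"
      using curve unfolding real_rooted_curve_def by blast
    have Aeq: "{j \<in> {..<n}. sroot (q 0) j = 0} = {i0..<i0+m}" using block i0m by auto
    have T: "tangent_poly = smult (e * (\<Prod>j\<in>{..<n} - {i0..<i0+m}. - sroot (q 0) j)) (\<Prod>j\<in>{i0..<i0+m}. [:- R j, 1:])"
      unfolding Aeq[symmetric]
    proof (rule tangent_poly_roots(2)[where F = "at_right 0"])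
      show "q h = smult e (\<Prod>j<n. [:- sroot (q h) j, 1:])" if "h \<in> J" for h
        using real_rooted_factor[of "q h"] e(2)[OF that] by metis
      show "isCont (\<lambda>h. sroot (q h) j) 0" if "j \<in> {..<n}" for j using isCont_sroot J that by auto
      show "((\<lambda>h. sroot (q h) j / h) \<longlongrightarrow> R j) (at_right 0)" if "j \<in> {..<n}" "sroot (q 0) j = 0" for j
        using R[of j] block[of j] that by auto
    qed (use e in \<open>auto simp: at_le\<close>)
    have T0: "coeff tangent_poly k = 0" if "k < l" for k
      unfolding T using that by (intro coeff_prod_linear_zero_roots(1)) (auto simp: l_def B_def)
    have T1: "coeff tangent_poly l \<noteq> 0"
    proof -
      have "coeff tangent_poly l = e * (\<Prod>j\<in>{..<n} - {i0..<i0+m}. - sroot (q 0) j) * (\<Prod>i\<in>{i0..<i0+m} - B. - R i)"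
        unfolding T l_def B_def by (rule coeff_prod_linear_zero_roots(2)) simp
      then show ?thesis using e(1) block by (auto simp: B_def)
    qed
    obtain D :: "nat \<Rightarrow> nat \<Rightarrow> real \<Rightarrow> real" and \<gamma> :: "nat \<Rightarrow> nat \<Rightarrow> real" where D': "\<forall>k. D k 0 = (\<lambda>t. coeff (q t) k)"
     "\<forall>k j t. j < m \<longrightarrow> t \<in> J \<longrightarrow> (D k j has_real_derivative D k (Suc j) t) (at t)"
     "\<forall>k\<le>n. \<forall>j\<le>m. ((\<lambda>h. D k j h * h ^ (k + j) / h ^ m) \<longlongrightarrow> \<gamma> k j) (at 0)"
     "\<forall>k<m. \<forall>j. \<gamma> k 0 = 0 \<longrightarrow> \<gamma> k j = 0"
      using coeff_limits by (elim exE conjE) (rule that, assumption+)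
    note D = D'[rule_format]
    have \<gamma>T: "\<gamma> k 0 = coeff tangent_poly k" if "k \<le> n" for k
      using tendsto_unique[OF _ D(3)[OF that, of 0]] tendsto_coeff_tangent_poly[OF that] D(1) by simp
    \<comment> \<open>\<open>tangent_poly\<close> vanishes at 0 to order exactly l. Hence below l
      the scaled coefficients tend to 0 with all their time derivatives, which pays for the division
      by \<eta>^l in the rescaling.\<close>
    have \<gamma>0: "\<gamma> k j = 0" if "k < l" for k j using D(4)[of k j] \<gamma>T[of k] T0[OF that] that lm ln by simp
    define \<beta> where "\<beta> = \<bar>\<gamma> l 0\<bar>"
    have \<beta>: "0 < \<beta>" using \<gamma>T[OF ln] T1 by (simp add: \<beta>_def)
    define CB where "CB = 1 + (\<Sum>k\<le>n. \<Sum>j\<le>m. \<bar>\<gamma> k j\<bar>)"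
    have CB1: "1 \<le> CB" unfolding CB_def by (simp add: sum_nonneg)
    have CB: "\<bar>\<gamma> k j\<bar> \<le> CB - 1" if "k \<le> n" "j \<le> m" for k j
    proof -
      have "\<bar>\<gamma> k j\<bar> \<le> (\<Sum>j\<le>m. \<bar>\<gamma> k j\<bar>)" using that by (intro member_le_sum) auto
      also have "\<dots> \<le> CB - 1" unfolding CB_def using that
        by (simp add: member_le_sum[of k "{..n}" "\<lambda>k. \<Sum>j\<le>m. \<bar>\<gamma> k j\<bar>"] sum_nonneg)
      finally show ?thesis .
    qed
    \<comment> \<open>The powers of 2 account for parameters between s / 2 and 2 s. A, c0 and W do
      not involve \<eta>, so L can be obtained from them before \<eta> is adjusted to L.\<close>
    define A where "A = CB * 2 ^ (n + 2 * m)"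
    have A0: "0 \<le> A" using CB1 by (simp add: A_def)
    define c0 where "c0 = fact l * (\<beta> / 2 / 2 ^ (l + m))"
    have c0: "0 < c0" using \<beta> by (simp add: c0_def)
    define PB where "PB = poly_bound n (Suc l) A 1"
    have PB: "0 \<le> PB" unfolding PB_def using A0 by (intro poly_bound_nonneg) auto
    define W where "W = min 1 (c0 / 2 / (PB + 1))"
    have W: "0 < W" "W \<le> 1" using c0 PB by (auto simp: W_def)
    have WPB: "W * PB \<le> c0 / 2"
    proof -
      have "W * PB \<le> c0 / 2 / (PB + 1) * (PB + 1)" using PB c0 W by (intro mult_mono) (auto simp: W_def)
      moreover have "x / y * y = x" if "y \<noteq> 0" for x y :: real using that by simp
      ultimately show ?thesis using PB by (metis add_nonneg_pos less_numeral_extra(1) less_numeral_extra(3))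
    qed
    obtain l' where l': "l = Suc l'" using l0 by (cases l) auto
    obtain L where L: "L \<ge> 0" "\<And>Q i. root_cluster n l (c0 / 2) A 1 {0-1/2<..<0+1/2} {-W..W} i1 Q \<Longrightarrow> i \<in> B \<Longrightarrow>
      eventually (\<lambda>x. \<bar>sroot (Q x) i - sroot (Q 0) i\<bar> \<le> L * \<bar>x - 0\<bar>) (at 0)"
      using root_cluster_slope[of "c0/2" "1/2" A 1 n l'] c0 A0 unfolding l' Beq by fastforce
    define \<eta> where "\<eta> = min 1 (\<epsilon> / (L + 1))"
    have \<eta>: "0 < \<eta>" "\<eta> \<le> 1" using \<epsilon> L(1) by (auto simp: \<eta>_def)
    have \<eta>L: "\<eta> * L \<le> \<epsilon>"
    proof -
      have "\<eta> * L \<le> \<epsilon> / (L + 1) * (L + 1)" using L(1) \<epsilon> \<eta> by (intro mult_mono) (auto simp: \<eta>_def)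
      then show ?thesis using L(1) by simp
    qed
    have DR: "((\<lambda>h. \<bar>D k j h * h ^ (k + j) / h ^ m\<bar>) \<longlongrightarrow> \<bar>\<gamma> k j\<bar>) (at_right 0)" if "k \<le> n" "j \<le> m" for k j
      by (rule tendsto_rabs[OF tendsto_mono[OF at_le[OF subset_UNIV] D(3)[OF that]]])
    have E1: "eventually (\<lambda>h. \<forall>k\<in>{..n}. \<forall>j\<in>{..m}. \<bar>D k j h * h ^ (k + j) / h ^ m\<bar> < CB) (at_right 0)"
      by (intro eventually_ball_finite ballI order_tendstoD(2)[OF DR]) (use CB in force)+
    have E2: "eventually (\<lambda>h. \<forall>k\<in>{..<l}. \<forall>j\<in>{..m}. \<bar>D k j h * h ^ (k + j) / h ^ m\<bar> < \<eta> ^ l) (at_right 0)"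
      by (intro eventually_ball_finite ballI order_tendstoD(2)[OF DR]) (use \<gamma>0 \<eta> ln in auto)
    have E3: "eventually (\<lambda>h. \<bar>D l 0 h * h ^ (l + 0) / h ^ m\<bar> > \<beta> / 2) (at_right 0)"
      by (intro order_tendstoD(1)[OF DR]) (use \<beta> ln in \<open>auto simp: \<beta>_def\<close>)
    have E4: "eventually (\<lambda>h. \<forall>i\<in>B. \<bar>sroot (q h) i / h\<bar> < W * \<eta> / 2) (at_right 0)"
    proof (intro eventually_ball_finite ballI fB)
      fix i assume "i \<in> B"
      then have "((\<lambda>h. \<bar>sroot (q h) i / h\<bar>) \<longlongrightarrow> \<bar>0\<bar>) (at_right 0)"
        using R[of i] by (intro tendsto_rabs) (auto simp: B_def)
      then show "eventually (\<lambda>h. \<bar>sroot (q h) i / h\<bar> < W * \<eta> / 2) (at_right 0)"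
        by (rule order_tendstoD) (use W \<eta> in simp)
    qed
    define P where "P h \<longleftrightarrow> (\<forall>k\<in>{..n}. \<forall>j\<in>{..m}. \<bar>D k j h * h ^ (k + j) / h ^ m\<bar> < CB) \<and>
      (\<forall>k\<in>{..<l}. \<forall>j\<in>{..m}. \<bar>D k j h * h ^ (k + j) / h ^ m\<bar> < \<eta> ^ l) \<and>
      \<bar>D l 0 h * h ^ (l + 0) / h ^ m\<bar> > \<beta> / 2 \<and> (\<forall>i\<in>B. \<bar>sroot (q h) i / h\<bar> < W * \<eta> / 2) \<and> h \<in> J" for h
    have "eventually P (at_right 0)"
      using E1 E2 E3 E4 evJ by eventually_elim (simp add: P_def)
    then obtain d0 where d0: "d0 > 0" "\<And>h. 0 < h \<Longrightarrow> h < d0 \<Longrightarrow> P h"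
      unfolding eventually_at_right_field by auto
    have main: "eventually (\<lambda>t. \<bar>sroot (q t) i - sroot (q s) i\<bar> \<le> \<epsilon> * \<bar>t - s\<bar>) (at s)"
      if s: "0 < s" "s < d0 / 2" and i: "i \<in> B" for s i
    proof -
      define h where "h x = s + s * x" for x
      let ?J = "{0-1/2<..<0+1/2::real}"
      have hx: "s / 2 < h x" "h x < 2 * s" "P (h x)" "0 < h x" "h x \<in> J" if "x \<in> ?J" for x
      proof -
        have "s * (1/2) < s * (1 + x)" "s * (1 + x) < s * 2" using that s by (intro mult_strict_left_mono; simp)+
        then show a: "s / 2 < h x" "h x < 2 * s" by (auto simp: h_def algebra_simps)
        then show "0 < h x" using s by linarith
        then show "P (h x)" using a s by (intro d0(2)) auto
        then show "h x \<in> J" by (simp add: P_def)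
      qed
      \<comment> \<open>The normalization keeps the coefficient with index l of the order of
        \<gamma> l 0, whatever s and \<eta> are.\<close>
      define Q where "Q x = smult (1 / (s ^ m * \<eta> ^ l)) (pcompose (q (h x)) [:0, \<eta> * s:])" for x
      have \<eta>s: "0 < \<eta> * s" and sm: "0 < s ^ m * \<eta> ^ l" using \<eta> s by auto
      have rrh: "real_rooted (q (h x))" "degree (q (h x)) = n" "lead_coeff (q (h x)) = e" if "x \<in> ?J" for x
        using e(2)[OF hx(5)[OF that]] by auto
      have Qr: "sroot (Q x) k = sroot (q (h x)) k / (\<eta> * s)" if "x \<in> ?J" "k < n" for x k
        unfolding Q_def using rrh[OF that(1)] sm \<eta>s that(2) by (subst sroot_affine) auto
      have Qc: "coeff (Q x) k = coeff (q (h x)) k * (\<eta> * s) ^ k / (s ^ m * \<eta> ^ l)" for x k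
        by (simp add: Q_def coeff_pcompose_linear)
      have curveQ: "real_rooted_curve n ?J Q"
        unfolding real_rooted_curve_def
      proof (intro exI[of _ "1 / (s ^ m * \<eta> ^ l) * e * (\<eta> * s) ^ n"] conjI ballI)
        show "0 < 1 / (s ^ m * \<eta> ^ l) * e * (\<eta> * s) ^ n" using sm e(1) \<eta>s by simp
        fix x assume x: "x \<in> ?J"
        show "real_rooted (Q x)" unfolding Q_def using rrh[OF x] sm \<eta>s by (intro real_rooted_affine) auto
        show "degree (Q x) = n" unfolding Q_def using rrh[OF x] sm \<eta>s by (subst degree_affine) auto
        show "lead_coeff (Q x) = 1 / (s ^ m * \<eta> ^ l) * e * (\<eta> * s) ^ n"
          unfolding Q_def using rrh[OF x] sm \<eta>s by (subst lead_coeff_affine) auto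
      qed
      \<comment> \<open>The factor s^j is the chain rule for \<open>h x = s + s * x\<close>.\<close>
      define E where "E k j x = (if k \<le> n then D k j (h x) * s ^ j * (\<eta> * s) ^ k / (s ^ m * \<eta> ^ l) else 0)" for k j x
      have Eb: "\<bar>E k j x\<bar> \<le> A" if x: "x \<in> ?J" and j: "j \<le> l" for k j x
      proof (cases "k \<le> n")
        case True
        note hP = hx[OF x]
        define X where "X = (if k < l then \<eta> ^ l else CB)"
        have X0: "0 \<le> X" using \<eta> CB1 by (simp add: X_def)
        have "\<bar>D k j (h x) * h x ^ (k + j) / h x ^ m\<bar> \<le> X"
          using hP(3) True j lm unfolding P_def X_def by (auto intro: less_imp_le)
        then have 1: "\<bar>D k j (h x)\<bar> * h x ^ (k + j) \<le> X * h x ^ m"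
          using hP(4) by (simp add: abs_mult power_abs divide_le_eq)
        have "s ^ (k + j) \<le> (2 * h x) ^ (k + j)" using hP(1) s by (intro power_mono) auto
        then have "\<bar>D k j (h x)\<bar> * s ^ (k + j) \<le> \<bar>D k j (h x)\<bar> * (2 * h x) ^ (k + j)" by (intro mult_left_mono) auto
        also have "\<dots> = 2 ^ (k + j) * (\<bar>D k j (h x)\<bar> * h x ^ (k + j))" by (simp add: power_mult_distrib mult_ac)
        also have "\<dots> \<le> 2 ^ (k + j) * (X * h x ^ m)" using 1 by (intro mult_left_mono) auto
        also have "\<dots> \<le> 2 ^ (k + j) * (X * (2 * s) ^ m)"
          using hP X0 by (intro mult_left_mono power_mono) auto
        also have "\<dots> = X * 2 ^ (k + j + m) * s ^ m" by (simp add: power_mult_distrib power_add mult_ac)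
        finally have 2: "\<bar>D k j (h x)\<bar> * s ^ (k + j) \<le> X * 2 ^ (k + j + m) * s ^ m" .
        have X\<eta>: "X * \<eta> ^ k \<le> CB * \<eta> ^ l"
        proof (cases "k < l")
          case True
          have "\<eta> ^ k \<le> 1" using \<eta> by (intro power_le_one) auto
          then have "\<eta> ^ l * \<eta> ^ k \<le> \<eta> ^ l * CB" using CB1 \<eta> by (intro mult_left_mono) auto
          then show ?thesis using True by (simp add: X_def mult_ac)
        next
          case False
          then have "\<eta> ^ k \<le> \<eta> ^ l" using \<eta> by (intro power_decreasing) auto
          then show ?thesis using False CB1 by (simp add: X_def)
        qed
        have "\<bar>E k j x\<bar> = \<bar>D k j (h x)\<bar> * s ^ (k + j) * \<eta> ^ k / (s ^ m * \<eta> ^ l)"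
          using True s \<eta> by (simp add: E_def abs_mult power_abs power_mult_distrib power_add mult_ac)
        also have "\<dots> \<le> (X * 2 ^ (k + j + m) * s ^ m) * \<eta> ^ k / (s ^ m * \<eta> ^ l)"
          using 2 sm \<eta> by (intro divide_right_mono mult_right_mono) auto
        also have "\<dots> = (X * \<eta> ^ k) * (2 ^ (k + j + m) / \<eta> ^ l)" using s by simp
        also have "\<dots> \<le> (CB * \<eta> ^ l) * (2 ^ (k + j + m) / \<eta> ^ l)"
          using X\<eta> \<eta> by (intro mult_right_mono) auto
        also have "\<dots> = CB * 2 ^ (k + j + m)" using \<eta> by simp
        also have "\<dots> \<le> A" unfolding A_def using CB1 True j lm by (intro mult_left_mono power_increasing) auto
        finally show ?thesis .
      qed (use A0 in \<open>simp add: E_def\<close>)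
      have smQ: "smooth_coeffs l A ?J Q"
        unfolding smooth_coeffs_def
      proof (intro exI[of _ E] allI conjI ballI impI)
        fix k x assume x: "x \<in> ?J"
        show "E k 0 x = coeff (Q x) k"
        proof (cases "k \<le> n")
          case True
          then show ?thesis by (simp add: E_def Qc D(1))
        next
          case False
          then have "coeff (q (h x)) k = 0" using rrh(2)[OF x] by (intro coeff_eq_0) simp
          then show ?thesis using False by (simp add: E_def Qc)
        qed
      next
        fix k j x assume j: "j < l" and x: "x \<in> ?J"
        show "(E k j has_real_derivative E k (Suc j) x) (at x)"
        proof (cases "k \<le> n")
          case True
          have "(D k j has_real_derivative D k (Suc j) (h x)) (at (h x))" using D(2) j lm hx(5)[OF x] by auto
          then have "((\<lambda>x. D k j (h x)) has_real_derivative D k (Suc j) (h x) * s) (at x)"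
            by (rule DERIV_chain2) (auto simp: h_def intro!: derivative_eq_intros)
          then have "((\<lambda>x. D k j (h x) * (s ^ j * (\<eta> * s) ^ k / (s ^ m * \<eta> ^ l))) has_real_derivative
              D k (Suc j) (h x) * s * (s ^ j * (\<eta> * s) ^ k / (s ^ m * \<eta> ^ l))) (at x)"
            by (rule DERIV_cmult_right)
          then show ?thesis using True by (simp add: E_def[abs_def] mult_ac)
        qed (simp add: E_def[abs_def])
      qed (rule Eb)
      have rc: "root_cluster n l (c0 / 2) A 1 ?J {-W..W} i1 Q"
        unfolding root_cluster_def
      proof (intro conjI ballI allI impI)
        show "{-W..W} \<subseteq> {-1..1}" using W by auto
        show "is_interval {-W..W}" by (rule is_interval_cc)
        show "sroot (Q x) k \<in> {-W..W}" if x: "x \<in> ?J" and k: "i1 \<le> k" "k < i1 + l" for x k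
        proof -
          have kB: "k \<in> B" using k Beq by auto
          note hP = hx[OF x]
          have "\<bar>sroot (q (h x)) k / h x\<bar> < W * \<eta> / 2" using hP(3) kB by (simp add: P_def)
          then have "\<bar>sroot (q (h x)) k\<bar> \<le> W * \<eta> / 2 * h x" using hP(4) by (simp add: divide_less_eq)
          also have "\<dots> \<le> W * \<eta> / 2 * (2 * s)" using hP W \<eta> by (intro mult_left_mono) auto
          finally have "\<bar>sroot (q (h x)) k\<bar> \<le> W * (\<eta> * s)" by simp
          then have "\<bar>sroot (q (h x)) k / (\<eta> * s)\<bar> \<le> W"
            using \<eta>s unfolding abs_divide by (simp add: pos_divide_le_eq)
          then have "\<bar>sroot (Q x) k\<bar> \<le> W" using Qr[OF x, of k] k i1n by simp
          then show ?thesis by auto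
        qed
        show "c0 / 2 \<le> \<bar>poly ((pderiv ^^ l) (Q x)) z\<bar>" if x: "x \<in> ?J" and z: "z \<in> {-W..W}" for x z
        proof -
          note hP = hx[OF x]
          have 1: "fact l * \<bar>coeff (Q x) l\<bar> - W * PB \<le> \<bar>poly ((pderiv ^^ l) (Q x)) z\<bar>"
            unfolding PB_def
          proof (rule higher_pderiv_lower_bound)
            show "degree (Q x) \<le> n" using curveQ x unfolding real_rooted_curve_def by auto
            show "\<bar>coeff (Q x) k\<bar> \<le> A" for k using smQ x by (rule smooth_coeffs_bound)
          qed (use z W in auto)
          have "\<bar>coeff (q (h x)) l * h x ^ l / h x ^ m\<bar> > \<beta> / 2" using hP(3) by (simp add: P_def D(1))
          then have 2: "\<beta> / 2 * h x ^ m \<le> \<bar>coeff (q (h x)) l\<bar> * h x ^ l"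
            using hP(4) by (simp add: abs_mult power_abs less_divide_eq)
          have "(s / 2) ^ m \<le> h x ^ m" using hP(1) s by (intro power_mono) auto
          then have "\<beta> / 2 * (s / 2) ^ m \<le> \<beta> / 2 * h x ^ m" using \<beta> by (intro mult_left_mono) auto
          also note 2
          also have "\<bar>coeff (q (h x)) l\<bar> * h x ^ l \<le> \<bar>coeff (q (h x)) l\<bar> * (2 * s) ^ l"
            using hP by (intro mult_left_mono power_mono) auto
          finally have "\<beta> / 2 / 2 ^ (l + m) * s ^ m \<le> \<bar>coeff (q (h x)) l\<bar> * s ^ l"
            by (simp add: power_mult_distrib power_divide power_add field_simps)
          then have "\<beta> / 2 / 2 ^ (l + m) \<le> \<bar>coeff (q (h x)) l\<bar> * s ^ l / s ^ m" using s by (simp add: pos_le_divide_eq)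
          also have "\<dots> = \<bar>coeff (Q x) l\<bar>" using s \<eta> by (simp add: Qc abs_mult power_abs power_mult_distrib)
          finally have "c0 \<le> fact l * \<bar>coeff (Q x) l\<bar>" unfolding c0_def by (intro mult_left_mono) auto
          then show ?thesis using 1 WPB by linarith
        qed
      qed (use i1n curveQ smQ in auto)
      from L(2)[OF rc i] obtain d1 where d1: "d1 > 0" "\<And>x. x \<noteq> 0 \<Longrightarrow> dist x 0 < d1 \<Longrightarrow> \<bar>sroot (Q x) i - sroot (Q 0) i\<bar> \<le> L * \<bar>x - 0\<bar>"
        unfolding eventually_at by auto
      have iN: "i < n" using i i0m by (auto simp: B_def)
      show ?thesis unfolding eventually_at
      proof (intro exI[of _ "s * min d1 (1/2)"] conjI ballI impI)
        show "0 < s * min d1 (1/2)" using s d1 by simp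
        fix t assume t: "t \<noteq> s \<and> dist t s < s * min d1 (1/2)"
        define x where "x = (t - s) / s"
        have tx: "t = h x" using s by (simp add: h_def x_def)
        have ax: "\<bar>x\<bar> = \<bar>t - s\<bar> / s" using s by (simp add: x_def)
        have "\<bar>t - s\<bar> < min d1 (1/2) * s" using t by (simp only: dist_real_def mult.commute)
        then have "\<bar>x\<bar> < min d1 (1/2)" unfolding ax using s by (simp only: pos_divide_less_eq)
        then have "\<bar>x\<bar> < d1" "\<bar>x\<bar> < 1/2" by simp_all
        moreover have "x \<noteq> 0" using t s by (simp add: x_def)
        moreover have "x \<in> ?J" using calculation(2) unfolding abs_less_iff greaterThanLessThan_iff by linarith
        ultimately have x: "x \<in> ?J" "dist x 0 < d1" "x \<noteq> 0" by (simp_all only: dist_real_def diff_zero not_False_eq_True)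
        have h0: "h 0 = s" by (simp add: h_def)
        \<comment> \<open>Undoing the scaling: z has unit \<eta> s and time has unit s, so the slope
          L becomes \<eta> L, which is at most \<epsilon>.\<close>
        have "\<bar>sroot (q t) i / (\<eta> * s) - sroot (q s) i / (\<eta> * s)\<bar> \<le> L * \<bar>x\<bar>"
          using d1(2)[OF x(3,2)] Qr[OF x(1) iN] Qr[of 0 i] iN by (simp add: tx h0)
        then have "\<bar>sroot (q t) i - sroot (q s) i\<bar> / (\<eta> * s) \<le> L * \<bar>x\<bar>"
          using \<eta>s by (simp flip: diff_divide_distrib add: abs_divide)
        then have "\<bar>sroot (q t) i - sroot (q s) i\<bar> \<le> L * \<bar>x\<bar> * (\<eta> * s)" using \<eta>s by (simp add: pos_divide_le_eq)
        also have "\<dots> = \<eta> * L * \<bar>t - s\<bar>" using s by (simp add: ax)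
        also have "\<dots> \<le> \<epsilon> * \<bar>t - s\<bar>" using \<eta>L by (intro mult_right_mono) auto
        finally show "\<bar>sroot (q t) i - sroot (q s) i\<bar> \<le> \<epsilon> * \<bar>t - s\<bar>" .
      qed
    qed
    show ?thesis unfolding eventually_at_right_field
    proof (intro exI[of _ "d0 / 2"] conjI allI impI ballI)
      show "0 < d0 / 2" using d0 by simp
      fix s i assume "0 < s" "s < d0 / 2" "i \<in> {i0..<i0+m}" "R i = 0"
      then show "eventually (\<lambda>t. \<bar>sroot (q t) i - sroot (q s) i\<bar> \<le> \<epsilon> * \<bar>t - s\<bar>) (at s)"
        by (intro main) (auto simp: B_def)
    qed
  qed
qed

text \<open>A flat continuous root runs only along flat sorted roots, because one with another value
  at 0 or another limit slope differs from it for small s > 0. It may switch among them, so the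
  bounds of all candidates are used together.\<close>

lemma slope_of_flat_root:
  assumes l: "continuous_on J l" "l 0 = 0" "\<And>t. t \<in> J \<Longrightarrow> poly (q t) (l t) = 0"
    and flat: "((\<lambda>h. l h / h) \<longlongrightarrow> 0) (at_right 0)" and \<epsilon>: "0 < \<epsilon>"
  shows "eventually (\<lambda>s. eventually (\<lambda>t. \<bar>l t - l s\<bar> \<le> \<epsilon> * \<bar>t - s\<bar>) (at s)) (at_right 0)"
proof -
  have "\<exists>\<nu>. ((\<lambda>h. sroot (q h) i / h) \<longlongrightarrow> \<nu>) (at_right 0)" if "i \<in> {i0..<i0+m}" for i
    using that block[of i] i0m rr
    by (intro root_one_sided_derivatives(1) continuous_on_sroots) (auto intro!: poly_sroot)
  then obtain R where R: "\<And>i. i \<in> {i0..<i0+m} \<Longrightarrow> ((\<lambda>h. sroot (q h) i / h) \<longlongrightarrow> R i) (at_right 0)"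
    by metis
  have cl: "isCont l s" if "s \<in> J" for s using l(1) J that by (simp add: continuous_on_eq_continuous_at)
  have "eventually (\<lambda>s. \<forall>i\<in>{..<n}. sroot (q s) i = l s \<longrightarrow> i \<in> {i0..<i0+m} \<and> R i = 0) (at_right 0)"
  proof (intro eventually_ball_finite ballI)
    fix i assume i: "i \<in> {..<n}"
    consider "i \<in> {i0..<i0+m}" "R i = 0" | "i \<notin> {i0..<i0+m}" | "i \<in> {i0..<i0+m}" "R i \<noteq> 0" by blast
    then show "eventually (\<lambda>s. sroot (q s) i = l s \<longrightarrow> i \<in> {i0..<i0+m} \<and> R i = 0) (at_right 0)"
    proof cases
      case 2
      have "((\<lambda>s. sroot (q s) i - l s) \<longlongrightarrow> sroot (q 0) i - l 0) (at 0)"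
        using isCont_sroot[of i 0] cl[of 0] i J(2) by (intro tendsto_diff) (auto simp: isCont_def)
      then have "eventually (\<lambda>s. sroot (q s) i - l s \<noteq> 0) (at 0)"
        by (rule tendsto_imp_eventually_ne) (use 2 block[of i] i l(2) in auto)
      then have "eventually (\<lambda>s. sroot (q s) i - l s \<noteq> 0) (at_right 0)" by (rule filter_leD[rotated]) (simp add: at_le)
      then show ?thesis by eventually_elim auto
    next
      case 3
      have "((\<lambda>s. sroot (q s) i / s - l s / s) \<longlongrightarrow> R i - 0) (at_right 0)"
        using R[OF 3(1)] flat by (intro tendsto_diff)
      then have "eventually (\<lambda>s. sroot (q s) i / s - l s / s \<noteq> 0) (at_right 0)"
        by (rule tendsto_imp_eventually_ne) (use 3 in auto)
      then show ?thesis by eventually_elim auto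
    qed auto
  qed simp
  moreover have "eventually (\<lambda>s. \<forall>i\<in>{i0..<i0+m}. R i = 0 \<longrightarrow>
     eventually (\<lambda>t. \<bar>sroot (q t) i - sroot (q s) i\<bar> \<le> \<epsilon> * \<bar>t - s\<bar>) (at s)) (at_right 0)"
    using R \<epsilon> by (rule slope_of_flat_roots)
  moreover have "eventually (\<lambda>h. h \<in> J) (at_right 0)" using eventually_J(2) by (rule filter_leD[rotated]) (simp add: at_le)
  ultimately show ?thesis
  proof eventually_elim
    case (elim s)
    have "eventually (\<lambda>t. \<exists>i<n. sroot (q s) i = l s \<and> l t = sroot (q t) i) (at s)"
      using curve J(1) elim(3) isCont_sroot cl l(3) by (intro eventually_root_eq_sroot[of n J q]) auto
    moreover have "eventually (\<lambda>t. \<forall>i\<in>{i. i < n \<and> sroot (q s) i = l s}. \<bar>sroot (q t) i - sroot (q s) i\<bar> \<le> \<epsilon> * \<bar>t - s\<bar>) (at s)"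
      by (intro eventually_ball_finite ballI) (use elim in auto)
    ultimately show ?case by eventually_elim auto
  qed
qed

end

section \<open>One-sided derivatives of the roots\<close>

lemma coeff_pcompose_shift:
  fixes p :: "real poly"
  assumes "degree p \<le> n"
  shows "coeff (pcompose p [:c, 1:]) k = (\<Sum>j\<le>n. coeff p j * (of_nat (j choose k) * c ^ (j - k)))"
proof -
  have "pcompose p [:c, 1:] = (\<Sum>j\<le>n. smult (coeff p j) ([:c, 1:] ^ j))"
  proof (rule poly_ext)
    fix x
    show "poly (pcompose p [:c, 1:]) x = poly (\<Sum>j\<le>n. smult (coeff p j) ([:c, 1:] ^ j)) x"
      using poly_sum_atMost[OF assms, of "c + x"] by (simp add: poly_pcompose poly_sum)
  qed
  moreover have "coeff ([:c, 1:] ^ j) k = of_nat (j choose k) * c ^ (j - k)" for j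
  proof (cases "k \<le> j")
    case False
    then have "coeff ([:c, 1:] ^ j) k = 0" by (intro coeff_eq_0) (simp add: degree_power_eq)
    then show ?thesis using False by simp
  qed (simp add: coeff_linear_poly_power)
  ultimately show ?thesis by (simp add: coeff_sum)
qed

lemma card_sroot_eq_order:
  assumes "real_rooted p"
  shows "card {i. i < degree p \<and> sroot p i = x} = order x p"
proof -
  have "filter_mset (\<lambda>y. y \<in> {x}) (proots p) = replicate_mset (count (proots p) x) x"
    by (simp add: filter_eq_replicate_mset)
  then have "card {i. i < degree p \<and> sroot p i \<in> {x}} = count (proots p) x"
    unfolding size_filter_sroot[OF assms, symmetric] by simp
  then show ?thesis using assms by (simp add: real_rooted_def)
qed

lemma DERIV_at_left_iff: "(f has_real_derivative d) (at_left t) \<longleftrightarrow> ((\<lambda>h. (f (t + h) - f t) / h) \<longlongrightarrow> d) (at_left 0)"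
proof -
  have "(+) t ` {..<0} = {..<t}" for t :: real
    by (auto intro!: image_eqI[of _ _ "_ - t"])
  then show ?thesis
    using DERIV_at_within_shift[of f d t 0 "{..<0}"] by (simp add: has_field_derivative_iff)
qed

lemma DERIV_at_right_iff: "(f has_real_derivative d) (at_right t) \<longleftrightarrow> ((\<lambda>h. (f (t + h) - f t) / h) \<longlongrightarrow> d) (at_right 0)"
proof -
  have "(+) t ` {0<..} = {t<..}" for t :: real
    by (auto intro!: image_eqI[of _ _ "_ - t"])
  then show ?thesis
    using DERIV_at_within_shift[of f d t 0 "{0<..}"] by (simp add: has_field_derivative_iff)
qed

text \<open>A bound on all difference quotients at u restricts every derivative at u, whether left,
  right or two-sided; S selects the side.\<close>

lemma derivative_near_of_slope:
  assumes d: "(f has_real_derivative d) (at u within S)" and S: "at u within S \<noteq> bot"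
    and slope: "eventually (\<lambda>y. \<bar>f y - f u - \<nu> * (y - u)\<bar> \<le> \<epsilon> * \<bar>y - u\<bar>) (at u)"
  shows "\<bar>d - \<nu>\<bar> \<le> \<epsilon>"
proof -
  have "((\<lambda>y. \<bar>(f y - f u) / (y - u) - \<nu>\<bar>) \<longlongrightarrow> \<bar>d - \<nu>\<bar>) (at u within S)"
    using d unfolding has_field_derivative_iff by (intro tendsto_intros)
  moreover have "eventually (\<lambda>y. \<bar>(f y - f u) / (y - u) - \<nu>\<bar> \<le> \<epsilon>) (at u)"
  proof -
    have "eventually (\<lambda>y. y \<noteq> u) (at u)" by (simp add: eventually_at_filter)
    then show ?thesis using slope
    proof eventually_elim
      case (elim y)
      have "(f y - f u) / (y - u) - \<nu> = (f y - f u - \<nu> * (y - u)) / (y - u)" using elim by (simp add: field_simps)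
      then show ?case using elim by (simp add: abs_divide pos_divide_le_eq)
    qed
  qed
  then have "eventually (\<lambda>y. \<bar>(f y - f u) / (y - u) - \<nu>\<bar> \<le> \<epsilon>) (at u within S)"
    by (rule filter_leD[rotated]) (simp add: at_le)
  ultimately show ?thesis by (intro tendsto_upperbound[OF _ _ S])
qed

section \<open>Curves of real-rooted polynomials and their local models\<close>

text \<open>The setting of the theorem in terms of sorted roots. The assumption \<open>mult\<close>
  says that the available smoothness p covers the multiplicity of every root.\<close>

locale real_rooted_family =
  fixes P :: "real \<Rightarrow> real poly" and I :: "real set" and n p :: nat
  assumes I: "open I"
    and monic: "\<And>t. t \<in> I \<Longrightarrow> real_rooted (P t) \<and> degree (P t) = n \<and> lead_coeff (P t) = 1"
    and smooth: "\<And>k. Cn p I (\<lambda>t. coeff (P t) k)"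
    and mult: "\<And>t x. t \<in> I \<Longrightarrow> poly (P t) x = 0 \<Longrightarrow> order x (P t) \<le> p"
begin

(* The sign \<sigma> selects the side of t0, and the shear turns a root with one-sided derivative
   \<sigma> \<nu> into one with derivative 0. *)
definition local_model :: "real \<Rightarrow> real \<Rightarrow> real \<Rightarrow> real \<Rightarrow> real \<Rightarrow> real poly" where
  "local_model t0 \<sigma> x0 \<nu> h = pcompose (P (t0 + \<sigma> * h)) [:x0 + \<nu> * h, 1:]"

lemma poly_local_model: "poly (local_model t0 \<sigma> x0 \<nu> h) z = poly (P (t0 + \<sigma> * h)) (x0 + \<nu> * h + z)"
  by (simp add: local_model_def poly_pcompose)

lemma continuous_on_sroot_P: "i < n \<Longrightarrow> continuous_on I (\<lambda>t. sroot (P t) i)"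
  by (rule continuous_on_sroot[of I P n 1]) (use monic Cn_continuous_on[OF smooth] in auto)

text \<open>The sorted roots equal to x0 are consecutive, and their number m is the order of x0.
  Since m \<le> p, the coefficients have the m derivatives that the normal form demands.\<close>

lemma ex_root_at_zero:
  assumes t0: "t0 \<in> I" and x0: "poly (P t0) x0 = 0" and \<sigma>: "\<bar>\<sigma>\<bar> = 1"
  shows "\<exists>m i0 \<delta>. root_at_zero (local_model t0 \<sigma> x0 \<nu>) n m i0 \<delta> \<and> (\<forall>h. \<bar>h\<bar> < \<delta> \<longrightarrow> t0 + \<sigma> * h \<in> I)"
proof -
  obtain \<delta> where \<delta>: "\<delta> > 0" "\<And>t. dist t t0 < \<delta> \<Longrightarrow> t \<in> I"
    using I t0 unfolding open_dist by blast
  have inI: "t0 + \<sigma> * h \<in> I" if "\<bar>h\<bar> < \<delta>" for h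
    using that \<sigma> by (intro \<delta>(2)) (simp add: dist_real_def abs_mult)
  define m where "m = order x0 (P t0)"
  have rr0: "real_rooted (P t0)" "degree (P t0) = n" using monic[OF t0] by auto
  define B where "B = {i. i < n \<and> sroot (P t0) i = x0}"
  have cB: "card B = m" using card_sroot_eq_order[OF rr0(1), of x0] rr0(2) by (simp add: B_def m_def)
  have m0: "0 < m" unfolding m_def using x0 rr0(1) by (simp add: real_rooted_def order_gt_0_iff)
  then have Bne: "B \<noteq> {}" using cB by auto
  have fB: "finite B" by (simp add: B_def)
  have Beq: "B = {Min B..<Min B + m}" unfolding cB[symmetric]
  proof (rule convex_nat_set[OF fB Bne])
    fix i j k assume "i \<in> B" "k \<in> B" "i \<le> j" "j \<le> k"
    then show "j \<in> B" using sroot_mono[OF rr0(1), of i j] sroot_mono[OF rr0(1), of j k] rr0(2) by (auto simp: B_def)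
  qed
  have mp: "m \<le> p" unfolding m_def using mult t0 x0 by blast
  have "Min B + m - 1 \<in> B" using Beq m0 by auto
  then have le: "Min B + m \<le> n" using m0 by (auto simp: B_def)
  have aff: "real_rooted (local_model t0 \<sigma> x0 \<nu> h)" "degree (local_model t0 \<sigma> x0 \<nu> h) = n"
    "lead_coeff (local_model t0 \<sigma> x0 \<nu> h) = 1"
    "i < n \<Longrightarrow> sroot (local_model t0 \<sigma> x0 \<nu> h) i = sroot (P (t0 + \<sigma> * h)) i - (x0 + \<nu> * h)" if "\<bar>h\<bar> < \<delta>" for h i
  proof -
    have M: "real_rooted (P (t0 + \<sigma> * h))" "degree (P (t0 + \<sigma> * h)) = n" "lead_coeff (P (t0 + \<sigma> * h)) = 1"
      using monic[OF inI[OF that]] by auto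
    note A = real_rooted_affine[OF M(1), of 1 1 "x0 + \<nu> * h"] degree_affine[OF M(1), of 1 1 "x0 + \<nu> * h"]
      lead_coeff_affine[OF M(1), of 1 1 "x0 + \<nu> * h"] sroot_affine[OF M(1), of 1 1 i "x0 + \<nu> * h"]
    show "real_rooted (local_model t0 \<sigma> x0 \<nu> h)" using A(1) by (simp add: local_model_def)
    show "degree (local_model t0 \<sigma> x0 \<nu> h) = n" using A(2) M(2) by (simp add: local_model_def)
    show "lead_coeff (local_model t0 \<sigma> x0 \<nu> h) = 1" using A(3) M(3) by (simp add: local_model_def)
    show "sroot (local_model t0 \<sigma> x0 \<nu> h) i = sroot (P (t0 + \<sigma> * h)) i - (x0 + \<nu> * h)" if "i < n"
      using A(4) M(2) that by (simp add: local_model_def)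
  qed
  have "root_at_zero (local_model t0 \<sigma> x0 \<nu>) n m (Min B) \<delta>"
  proof
    show "real_rooted_curve n {- \<delta><..<\<delta>} (local_model t0 \<sigma> x0 \<nu>)"
      unfolding real_rooted_curve_def by (intro exI[of _ 1]) (use aff in \<open>auto simp: abs_less_iff\<close>)
    show "Cn m {- \<delta><..<\<delta>} (\<lambda>h. coeff (local_model t0 \<sigma> x0 \<nu> h) k)" for k
    proof -
      have "Cn m {- \<delta><..<\<delta>} (\<lambda>h. \<Sum>j\<le>n. coeff (P (t0 + \<sigma> * h)) j * (of_nat (j choose k) * (x0 + \<nu> * h) ^ (j - k)))"
      proof (intro Cn_sum Cn_mult Cn_power Cn_linear Cn_const)
        fix j
        have "Cn p {- \<delta><..<\<delta>} (\<lambda>h. coeff (P (t0 + \<sigma> * h)) j)"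
          by (rule Cn_affine[OF smooth]) (use inI in auto)
        then show "Cn m {- \<delta><..<\<delta>} (\<lambda>h. coeff (P (t0 + \<sigma> * h)) j)" using mp by (rule Cn_le)
      qed
      then show ?thesis
      proof (rule Cn_transform)
        fix h assume "h \<in> {- \<delta><..<\<delta>}"
        then have "degree (P (t0 + \<sigma> * h)) \<le> n" using monic[OF inI] by auto
        then show "(\<Sum>j\<le>n. coeff (P (t0 + \<sigma> * h)) j * (of_nat (j choose k) * (x0 + \<nu> * h) ^ (j - k))) = coeff (local_model t0 \<sigma> x0 \<nu> h) k"
          unfolding local_model_def by (rule coeff_pcompose_shift[symmetric])
      qed simp
    qed
    show "(sroot (local_model t0 \<sigma> x0 \<nu> 0) i = 0) = (Min B \<le> i \<and> i < Min B + m)" if "i < n" for i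
    proof -
      have "sroot (local_model t0 \<sigma> x0 \<nu> 0) i = sroot (P t0) i - x0" using aff(4)[of 0 i] \<delta>(1) that by simp
      moreover have "i \<in> B \<longleftrightarrow> i \<in> {Min B..<Min B + m}" by (rule arg_cong[OF Beq])
      ultimately show ?thesis using that by (auto simp: B_def)
    qed
  qed (use \<delta> le m0 in auto)
  then show ?thesis using inI by blast
qed

lemma local_root:
  fixes l :: "real \<Rightarrow> real" and t0 \<sigma> \<nu> \<delta> :: real
  assumes l: "continuous_on I l" "\<forall>t\<in>I. poly (P t) (l t) = 0" and inI: "\<forall>h. \<bar>h\<bar> < \<delta> \<longrightarrow> t0 + \<sigma> * h \<in> I"
  defines "g \<equiv> \<lambda>h. l (t0 + \<sigma> * h) - l t0 - \<nu> * h"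
  shows "continuous_on {-\<delta><..<\<delta>} g" "g 0 = 0" "\<And>h. h \<in> {-\<delta><..<\<delta>} \<Longrightarrow> poly (local_model t0 \<sigma> (l t0) \<nu> h) (g h) = 0"
proof -
  show "continuous_on {-\<delta><..<\<delta>} g" unfolding g_def
    by (intro continuous_intros continuous_on_compose2[OF l(1)]) (use inI in auto)
  show "g 0 = 0" by (simp add: g_def)
  show "poly (local_model t0 \<sigma> (l t0) \<nu> h) (g h) = 0" if "h \<in> {-\<delta><..<\<delta>}" for h
  proof -
    have "\<bar>h\<bar> < \<delta>" using that by auto
    then have "poly (P (t0 + \<sigma> * h)) (l (t0 + \<sigma> * h)) = 0" using l(2) inI by blast
    then show ?thesis by (simp add: poly_local_model g_def)
  qed
qed

lemma one_sided_derivatives: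
  assumes l: "continuous_on I l" "\<forall>t\<in>I. poly (P t) (l t) = 0" and t0: "t0 \<in> I"
  shows "\<exists>d. (l has_real_derivative d) (at_left t0)" "\<exists>d. (l has_real_derivative d) (at_right t0)"
proof -
  have "\<bar>1::real\<bar> = 1" by simp
  from ex_root_at_zero[OF t0 l(2)[rule_format, OF t0] this]
  obtain m i0 \<delta> where r: "root_at_zero (local_model t0 1 (l t0) 0) n m i0 \<delta>" "\<forall>h. \<bar>h\<bar> < \<delta> \<longrightarrow> t0 + 1 * h \<in> I"
    by blast
  note g = local_root[OF l r(2), where \<nu> = 0]
  have "\<exists>\<nu>. ((\<lambda>h. (l (t0 + 1 * h) - l t0 - 0 * h) / h) \<longlongrightarrow> \<nu>) (at_left 0)"
    by (rule root_at_zero.root_one_sided_derivatives(2)[OF r(1)]) (fact g)+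
  moreover have "\<exists>\<nu>. ((\<lambda>h. (l (t0 + 1 * h) - l t0 - 0 * h) / h) \<longlongrightarrow> \<nu>) (at_right 0)"
    by (rule root_at_zero.root_one_sided_derivatives(1)[OF r(1)]) (fact g)+
  ultimately show "\<exists>d. (l has_real_derivative d) (at_left t0)" "\<exists>d. (l has_real_derivative d) (at_right t0)"
    by (auto simp: DERIV_at_left_iff DERIV_at_right_iff)
qed

text \<open>After the shear the root has derivative 0 at the origin, so its slopes nearby are at
  most \<epsilon>. In the original coordinates the slopes at t0 + \<sigma> s differ from \<sigma>
  \<nu> by at most \<epsilon>; the substitution is its own inverse because \<sigma>^2 = 1.\<close>

lemma slope_near:
  assumes l: "continuous_on I l" "\<forall>t\<in>I. poly (P t) (l t) = 0" and t0: "t0 \<in> I" and \<sigma>: "\<bar>\<sigma>\<bar> = 1"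
    and \<nu>: "((\<lambda>h. (l (t0 + \<sigma> * h) - l t0) / h) \<longlongrightarrow> \<nu>) (at_right 0)" and \<epsilon>: "0 < \<epsilon>"
  shows "\<exists>b>0. \<forall>s. 0 < s \<and> s < b \<longrightarrow> t0 + \<sigma> * s \<in> I \<and>
    eventually (\<lambda>y. \<bar>l y - l (t0 + \<sigma> * s) - \<sigma> * \<nu> * (y - (t0 + \<sigma> * s))\<bar> \<le> \<epsilon> * \<bar>y - (t0 + \<sigma> * s)\<bar>) (at (t0 + \<sigma> * s))"
proof -
  obtain m i0 \<delta> where r: "root_at_zero (local_model t0 \<sigma> (l t0) \<nu>) n m i0 \<delta>" "\<forall>h. \<bar>h\<bar> < \<delta> \<longrightarrow> t0 + \<sigma> * h \<in> I"
    using ex_root_at_zero[OF t0 l(2)[rule_format, OF t0] \<sigma>] by blast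
  define g where "g h = l (t0 + \<sigma> * h) - l t0 - \<nu> * h" for h
  note g = local_root[OF l r(2), where \<nu> = \<nu>, folded g_def]
  have "((\<lambda>h. (l (t0 + \<sigma> * h) - l t0) / h - \<nu>) \<longlongrightarrow> \<nu> - \<nu>) (at_right 0)" using \<nu> by (intro tendsto_intros)
  then have "((\<lambda>h. (l (t0 + \<sigma> * h) - l t0) / h - \<nu>) \<longlongrightarrow> 0) (at_right 0)" by simp
  then have flat: "((\<lambda>h. g h / h) \<longlongrightarrow> 0) (at_right 0)"
  proof (rule Lim_transform_eventually)
    show "eventually (\<lambda>h. (l (t0 + \<sigma> * h) - l t0) / h - \<nu> = g h / h) (at_right 0)"
      using eventually_at_right_less by eventually_elim (simp add: g_def field_simps)
  qed
  have "eventually (\<lambda>s. eventually (\<lambda>t. \<bar>g t - g s\<bar> \<le> \<epsilon> * \<bar>t - s\<bar>) (at s)) (at_right 0)"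
    by (rule root_at_zero.slope_of_flat_root[OF r(1)]) (fact g flat \<epsilon>)+
  then obtain b0 where b0: "b0 > 0" "\<And>s. 0 < s \<Longrightarrow> s < b0 \<Longrightarrow> eventually (\<lambda>t. \<bar>g t - g s\<bar> \<le> \<epsilon> * \<bar>t - s\<bar>) (at s)"
    unfolding eventually_at_right_field by auto
  have \<delta>: "0 < \<delta>" using r(1) by (rule root_at_zero.\<delta>)
  have \<sigma>\<sigma>: "\<sigma> * \<sigma> = 1" using \<sigma> by (metis abs_mult_self_eq mult_1)
  show ?thesis
  proof (intro exI[of _ "min b0 \<delta>"] conjI allI impI)
    show "0 < min b0 \<delta>" using b0 \<delta> by simp
    fix s assume s: "0 < s \<and> s < min b0 \<delta>"
    then show "t0 + \<sigma> * s \<in> I" using r(2)[rule_format, of s] by simp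
    obtain d where d: "d > 0" "\<And>t. t \<noteq> s \<Longrightarrow> dist t s < d \<Longrightarrow> \<bar>g t - g s\<bar> \<le> \<epsilon> * \<bar>t - s\<bar>"
      using b0(2)[of s] s unfolding eventually_at by auto
    show "eventually (\<lambda>y. \<bar>l y - l (t0 + \<sigma> * s) - \<sigma> * \<nu> * (y - (t0 + \<sigma> * s))\<bar> \<le> \<epsilon> * \<bar>y - (t0 + \<sigma> * s)\<bar>) (at (t0 + \<sigma> * s))"
      unfolding eventually_at
    proof (intro exI[of _ d] conjI ballI impI)
      fix y assume y: "y \<noteq> t0 + \<sigma> * s \<and> dist y (t0 + \<sigma> * s) < d"
      define t where "t = \<sigma> * (y - t0)"
      have yt: "y = t0 + \<sigma> * t" unfolding t_def using \<sigma>\<sigma> by (simp flip: mult.assoc)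
      have ts: "t - s = \<sigma> * (y - (t0 + \<sigma> * s))" unfolding t_def using \<sigma>\<sigma> by (simp add: algebra_simps flip: mult.assoc)
      then have ats: "\<bar>t - s\<bar> = \<bar>y - (t0 + \<sigma> * s)\<bar>" using \<sigma> by (simp add: abs_mult)
      have "t \<noteq> s" using y yt by auto
      moreover have "dist t s < d" using y ats by (simp add: dist_real_def)
      ultimately have "\<bar>g t - g s\<bar> \<le> \<epsilon> * \<bar>y - (t0 + \<sigma> * s)\<bar>" using d(2) ats by metis
      moreover have "g t - g s = l y - l (t0 + \<sigma> * s) - \<nu> * (t - s)"
        unfolding g_def yt[symmetric] by (simp add: algebra_simps)
      moreover have "\<nu> * (t - s) = \<sigma> * \<nu> * (y - (t0 + \<sigma> * s))" unfolding ts by simp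
      ultimately show "\<bar>l y - l (t0 + \<sigma> * s) - \<sigma> * \<nu> * (y - (t0 + \<sigma> * s))\<bar> \<le> \<epsilon> * \<bar>y - (t0 + \<sigma> * s)\<bar>" by simp
    qed (use d in simp)
  qed
qed

text \<open>Quantifying over S treats the left and the right derivative at u together. On the left
  of t0 the choice \<sigma> = -1 comes with the shear - \<nu>, and the two signs cancel in the
  slope.\<close>

lemma one_sided_derivatives_near:
  assumes l: "continuous_on I l" "\<forall>t\<in>I. poly (P t) (l t) = 0" and t0: "t0 \<in> I"
  shows "(l has_real_derivative \<nu>) (at_right t0) \<Longrightarrow> 0 < \<epsilon> \<Longrightarrow>
      eventually (\<lambda>u. \<forall>d S. at u within S \<noteq> bot \<longrightarrow> (l has_real_derivative d) (at u within S) \<longrightarrow> \<bar>d - \<nu>\<bar> \<le> \<epsilon>) (at_right t0)"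
    and "(l has_real_derivative \<nu>) (at_left t0) \<Longrightarrow> 0 < \<epsilon> \<Longrightarrow>
      eventually (\<lambda>u. \<forall>d S. at u within S \<noteq> bot \<longrightarrow> (l has_real_derivative d) (at u within S) \<longrightarrow> \<bar>d - \<nu>\<bar> \<le> \<epsilon>) (at_left t0)"
proof -
  assume \<nu>: "(l has_real_derivative \<nu>) (at_right t0)" and \<epsilon>: "0 < \<epsilon>"
  have "((\<lambda>h. (l (t0 + 1 * h) - l t0) / h) \<longlongrightarrow> \<nu>) (at_right 0)" using \<nu> by (simp add: DERIV_at_right_iff)
  from slope_near[OF l t0 _ this \<epsilon>]
  obtain b where b: "b > 0" "\<And>s. 0 < s \<Longrightarrow> s < b \<Longrightarrow>
    eventually (\<lambda>y. \<bar>l y - l (t0 + s) - \<nu> * (y - (t0 + s))\<bar> \<le> \<epsilon> * \<bar>y - (t0 + s)\<bar>) (at (t0 + s))" by auto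
  show "eventually (\<lambda>u. \<forall>d S. at u within S \<noteq> bot \<longrightarrow> (l has_real_derivative d) (at u within S) \<longrightarrow> \<bar>d - \<nu>\<bar> \<le> \<epsilon>) (at_right t0)"
    unfolding eventually_at_right_field
  proof (intro exI[of _ "t0 + b"] conjI allI impI)
    fix u d S assume "t0 < u" "u < t0 + b" "at u within S \<noteq> bot" "(l has_real_derivative d) (at u within S)"
    then show "\<bar>d - \<nu>\<bar> \<le> \<epsilon>" using b(2)[of "u - t0"] by (intro derivative_near_of_slope) auto
  qed (use b in simp)
next
  assume \<nu>: "(l has_real_derivative \<nu>) (at_left t0)" and \<epsilon>: "0 < \<epsilon>"
  have "((\<lambda>h. - ((l (t0 - h) - l t0) / (- h))) \<longlongrightarrow> - \<nu>) (at_right 0)"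
    using \<nu> unfolding DERIV_at_left_iff filterlim_at_left_to_right by (intro tendsto_minus) simp
  then have "((\<lambda>h. (l (t0 + (-1) * h) - l t0) / h) \<longlongrightarrow> - \<nu>) (at_right 0)" by simp
  from slope_near[OF l t0 _ this \<epsilon>]
  obtain b where b: "b > 0" "\<And>s. 0 < s \<Longrightarrow> s < b \<Longrightarrow>
    eventually (\<lambda>y. \<bar>l y - l (t0 - s) - \<nu> * (y - (t0 - s))\<bar> \<le> \<epsilon> * \<bar>y - (t0 - s)\<bar>) (at (t0 - s))" by auto
  show "eventually (\<lambda>u. \<forall>d S. at u within S \<noteq> bot \<longrightarrow> (l has_real_derivative d) (at u within S) \<longrightarrow> \<bar>d - \<nu>\<bar> \<le> \<epsilon>) (at_left t0)"
    unfolding eventually_at_left_field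
  proof (intro exI[of _ "t0 - b"] conjI allI impI)
    fix u d S assume "t0 - b < u" "u < t0" "at u within S \<noteq> bot" "(l has_real_derivative d) (at u within S)"
    then show "\<bar>d - \<nu>\<bar> \<le> \<epsilon>" using b(2)[of "t0 - u"] by (intro derivative_near_of_slope) auto
  qed (use b in simp)
qed

end

section \<open>Differentiable systems of roots\<close>

lemma count_image_mset_set:
  "finite A \<Longrightarrow> count (image_mset f (mset_set A)) y = card {j\<in>A. f j = y}"
  by (simp add: count_image_mset vimage_def Int_def conj_commute)

text \<open>The parameters at which f lies on branches in A and those at which it lies on branches
  outside A are relatively closed, disjoint by separation, and cover the connected set T.\<close>

lemma connected_branch:
  fixes f :: "real \<Rightarrow> real" and s :: "'i \<Rightarrow> real \<Rightarrow> real"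
  assumes T: "connected T" and N: "finite N" "A \<subseteq> N" and f: "continuous_on T f" and s: "\<And>i. i \<in> N \<Longrightarrow> continuous_on T (s i)"
    and cover: "\<And>t. t \<in> T \<Longrightarrow> \<exists>i\<in>N. f t = s i t"
    and sep: "\<And>t i k. t \<in> T \<Longrightarrow> i \<in> A \<Longrightarrow> k \<in> N - A \<Longrightarrow> s i t \<noteq> s k t"
    and t1: "t1 \<in> T" "\<exists>i\<in>A. f t1 = s i t1" and t: "t \<in> T"
  shows "\<exists>i\<in>A. f t = s i t"
proof -
  define E where "E B = (\<Union>i\<in>B. {t\<in>T. f t - s i t = 0})" for B
  have cl: "closedin (top_of_set T) (E B)" if "B \<subseteq> N" for B
  proof -
    have "closedin (top_of_set T) {t\<in>T. f t - s i t = 0}" if "i \<in> B" for i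
      using f s \<open>B \<subseteq> N\<close> that by (intro continuous_closedin_preimage_constant continuous_on_diff) auto
    moreover have "finite B" using N that by (auto intro: finite_subset)
    ultimately show ?thesis unfolding E_def by (intro closedin_Union) auto
  qed
  have "E A \<noteq> {}" using t1 by (auto simp: E_def)
  moreover have "T \<subseteq> E A \<union> E (N - A)" using cover N by (fastforce simp: E_def)
  moreover have "E A \<inter> E (N - A) = {}" using sep by (fastforce simp: E_def)
  moreover have "closedin (top_of_set T) (E A)" "closedin (top_of_set T) (E (N - A))" using cl N by auto
  ultimately have "E (N - A) = {}" using T unfolding connected_closedin by blast
  then show ?thesis using t \<open>T \<subseteq> E A \<union> E (N - A)\<close> by (auto simp: E_def)
qed

context real_rooted_family
begin

text \<open>The branches are grouped by their value x at t0. Within each group the left and right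
  derivatives agree as multisets, so the multisets of pairs of value and derivative coincide over N,
  and equal image multisets yield a permutation.\<close>

lemma matching_permutation:
  fixes L :: "nat \<Rightarrow> real \<Rightarrow> real"
  assumes N: "finite N" and sys: "\<forall>t\<in>I. P t = (\<Prod>j\<in>N. [:- L j t, 1:])"
    and cont: "\<forall>j\<in>N. continuous_on I (L j)" and t0: "t0 \<in> I"
  shows "\<exists>\<tau>. \<tau> permutes N \<and> (\<forall>j\<in>N. L j t0 = L (\<tau> j) t0 \<and>
     (\<exists>d. (L j has_real_derivative d) (at_left t0) \<and> (L (\<tau> j) has_real_derivative d) (at_right t0)))"
proof -
  have root: "\<forall>t\<in>I. poly (P t) (L j t) = 0" if "j \<in> N" for j
    using sys N that by (auto simp: poly_prod)
  have "\<exists>d. (L j has_real_derivative d) (at_left t0)" "\<exists>d. (L j has_real_derivative d) (at_right t0)" if "j \<in> N" for j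
    using one_sided_derivatives[OF cont[rule_format, OF that] root[OF that] t0] by auto
  then obtain Lf R where Lf: "\<And>j. j \<in> N \<Longrightarrow> (L j has_real_derivative Lf j) (at_left t0)"
    and R: "\<And>j. j \<in> N \<Longrightarrow> (L j has_real_derivative R j) (at_right t0)" by metis
  have "image_mset (\<lambda>j. (L j t0, Lf j)) (mset_set N) = image_mset (\<lambda>j. (L j t0, R j)) (mset_set N)"
  proof (rule multiset_eqI)
    fix y :: "real \<times> real"
    obtain x \<nu> where y: "y = (x, \<nu>)" by fastforce
    define A where "A = {j\<in>N. L j t0 - x = 0}"
    have fA: "finite A" using N by (simp add: A_def)
    have "image_mset Lf (mset_set A) = image_mset R (mset_set A)"
    proof (cases "A = {}")
      case False
      then have x: "poly (P t0) x = 0" using root t0 by (auto simp: A_def)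
      have "\<bar>1::real\<bar> = 1" by simp
      from ex_root_at_zero[OF t0 x this]
      obtain m i0 \<delta> where r: "root_at_zero (local_model t0 1 x 0) n m i0 \<delta>" "\<forall>h. \<bar>h\<bar> < \<delta> \<longrightarrow> t0 + 1 * h \<in> I" by blast
      have "image_mset R (mset_set {j \<in> N. L j (t0 + 0) - x = 0}) = image_mset Lf (mset_set {j \<in> N. L j (t0 + 0) - x = 0})"
      proof (rule root_at_zero.left_right_derivatives_eq[OF r(1) N, where e = 1 and L = "\<lambda>j h. L j (t0 + h) - x"])
        show "local_model t0 1 x 0 h = smult 1 (\<Prod>j\<in>N. [:- (L j (t0 + h) - x), 1:])" if "h \<in> {- \<delta><..<\<delta>}" for h
        proof (rule poly_ext)
          fix z
          have "t0 + h \<in> I" using r(2) that by (auto simp: abs_less_iff)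
          then have "P (t0 + h) = (\<Prod>j\<in>N. [:- L j (t0 + h), 1:])" using sys by blast
          then show "poly (local_model t0 1 x 0 h) z = poly (smult 1 (\<Prod>j\<in>N. [:- (L j (t0 + h) - x), 1:])) z"
            by (simp add: poly_local_model poly_prod algebra_simps)
        qed
        fix j assume j: "j \<in> N"
        show "isCont (\<lambda>h. L j (t0 + h) - x) 0"
        proof -
          have "isCont (L j) (t0 + 0)" using cont j t0 I by (simp add: continuous_on_eq_continuous_at)
          then have "isCont (\<lambda>h. L j (t0 + h)) 0" by (intro isCont_o2[where f = "\<lambda>h. t0 + h" and g = "L j"]) auto
          then show ?thesis by simp
        qed
        assume "L j (t0 + 0) - x = 0"
        then have x: "L j t0 = x" by simp
        show "((\<lambda>h. (L j (t0 + h) - x) / h) \<longlongrightarrow> R j) (at_right 0)"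
          using R[OF j] by (simp add: DERIV_at_right_iff x)
        show "((\<lambda>h. (L j (t0 + h) - x) / h) \<longlongrightarrow> Lf j) (at_left 0)"
          using Lf[OF j] by (simp add: DERIV_at_left_iff x)
      qed simp
      then show ?thesis by (simp add: A_def)
    qed simp
    then have "card {j\<in>A. Lf j = \<nu>} = card {j\<in>A. R j = \<nu>}"
      using count_image_mset_set[OF fA] by metis
    moreover have "{j\<in>A. Lf j = \<nu>} = {j\<in>N. (L j t0, Lf j) = y}" "{j\<in>A. R j = \<nu>} = {j\<in>N. (L j t0, R j) = y}"
      by (auto simp: A_def y)
    ultimately show "count (image_mset (\<lambda>j. (L j t0, Lf j)) (mset_set N)) y = count (image_mset (\<lambda>j. (L j t0, R j)) (mset_set N)) y"
      using N by (simp add: count_image_mset_set)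
  qed
  from image_mset_eq_implies_permutes[OF N this]
  obtain \<tau> where "\<tau> permutes N" "\<forall>j\<in>N. (L j t0, Lf j) = (L (\<tau> j) t0, R (\<tau> j))" by blast
  then show ?thesis using Lf R by (metis Pair_inject permutes_in_image)
qed

text \<open>At a new point s the branches are continued to the right by the permuted ones. Whole
  functions are exchanged there, so differentiability at the points treated before survives on
  either side of s.\<close>

lemma finite_differentiable_system:
  assumes "finite S" "S \<subseteq> I"
  shows "\<exists>L. (\<forall>t\<in>I. P t = (\<Prod>j\<in>{..<n}. [:- L j t, 1:])) \<and> (\<forall>j\<in>{..<n}. continuous_on I (L j)) \<and>
     (\<forall>s\<in>S. \<forall>j\<in>{..<n}. \<exists>d. (L j has_real_derivative d) (at s))"
  using assms
proof (induction S)
  case empty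
  have "P t = (\<Prod>j\<in>{..<n}. [:- sroot (P t) j, 1:])" if "t \<in> I" for t
    using real_rooted_factor[of "P t"] monic[OF that] by (metis smult_1_left)
  then show ?case using continuous_on_sroot_P by (intro exI[of _ "\<lambda>j t. sroot (P t) j"]) auto
next
  case (insert s S)
  then obtain L where L: "\<forall>t\<in>I. P t = (\<Prod>j\<in>{..<n}. [:- L j t, 1:])" "\<forall>j\<in>{..<n}. continuous_on I (L j)"
    "\<forall>s\<in>S. \<forall>j\<in>{..<n}. \<exists>d. (L j has_real_derivative d) (at s)" by auto
  have sI: "s \<in> I" using insert by simp
  obtain \<tau> where \<tau>: "\<tau> permutes {..<n}" "\<forall>j\<in>{..<n}. L j s = L (\<tau> j) s \<and>
     (\<exists>d. (L j has_real_derivative d) (at_left s) \<and> (L (\<tau> j) has_real_derivative d) (at_right s))"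
    using matching_permutation[OF finite_lessThan L(1,2) sI] by blast
  define L' where "L' j t = (if t \<le> s then L j t else L (\<tau> j) t)" for j t
  have \<tau>n: "\<tau> j \<in> {..<n}" if "j \<in> {..<n}" for j using permutes_in_image[OF \<tau>(1), of j] that by simp
  show ?case
  proof (intro exI[of _ L'] conjI ballI)
    fix t assume t: "t \<in> I"
    have "(\<Prod>j\<in>{..<n}. [:- L (\<tau> j) t, 1:]) = (\<Prod>j\<in>{..<n}. [:- L j t, 1:])"
      using prod.permute[OF \<tau>(1), of "\<lambda>j. [:- L j t, 1:]"] by (simp add: o_def)
    then show "P t = (\<Prod>j\<in>{..<n}. [:- L' j t, 1:])" using L(1) t by (cases "t \<le> s") (simp_all add: L'_def)
  next
    fix j assume j: "j \<in> {..<n}"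
    show "continuous_on I (L' j)" unfolding L'_def
      using L(2) j \<tau>n[OF j] \<tau>(2)
      by (intro continuous_on_cases_le) (auto intro: continuous_on_subset)
  next
    fix u j assume u: "u \<in> insert s S" and j: "j \<in> {..<n}"
    consider "u = s" | "u < s" "u \<in> S" | "s < u" "u \<in> S" using u by force
    then show "\<exists>d. (L' j has_real_derivative d) (at u)"
    proof cases
      case 1
      obtain d where d: "(L j has_real_derivative d) (at_left s)" "(L (\<tau> j) has_real_derivative d) (at_right s)"
        using \<tau>(2) j by blast
      have "((\<lambda>h. (L' j (s + h) - L' j s) / h) \<longlongrightarrow> d) (at_left 0)"
        using d(1) unfolding DERIV_at_left_iff
      proof (rule Lim_transform_eventually)
        have "eventually (\<lambda>h::real. h < 0) (at_left 0)" by (simp add: eventually_at_filter)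
        then show "eventually (\<lambda>h. (L j (s + h) - L j s) / h = (L' j (s + h) - L' j s) / h) (at_left 0)"
          by eventually_elim (simp add: L'_def)
      qed
      moreover have "((\<lambda>h. (L' j (s + h) - L' j s) / h) \<longlongrightarrow> d) (at_right 0)"
        using d(2) unfolding DERIV_at_right_iff
      proof (rule Lim_transform_eventually)
        show "eventually (\<lambda>h. (L (\<tau> j) (s + h) - L (\<tau> j) s) / h = (L' j (s + h) - L' j s) / h) (at_right 0)"
          using eventually_at_right_less by eventually_elim (use \<tau>(2) j in \<open>simp add: L'_def\<close>)
      qed
      ultimately have "(L' j has_real_derivative d) (at s)" unfolding DERIV_def filterlim_at_split by blast
      then show ?thesis using 1 by blast
    next
      case 2
      then obtain d where "(L j has_real_derivative d) (at u)" using L(3) j by blast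
      then have "(L' j has_real_derivative d) (at u)"
        by (rule has_field_derivative_transform_within_open[of _ _ _ "{..<s}"]) (use 2 in \<open>auto simp: L'_def\<close>)
      then show ?thesis by blast
    next
      case 3
      then obtain d where "(L (\<tau> j) has_real_derivative d) (at u)" using L(3) \<tau>n[OF j] by blast
      then have "(L' j has_real_derivative d) (at u)"
        by (rule has_field_derivative_transform_within_open[of _ _ _ "{s<..}"]) (use 3 in \<open>auto simp: L'_def\<close>)
      then show ?thesis by blast
    qed
  qed
qed

end

section \<open>Compactness and differentiability at all parameters\<close>

lemma eventually_neq_of_jets_neq:
  assumes f: "(f has_real_derivative d) (at t0 within S)" and g: "(g has_real_derivative d') (at t0 within S)"
    and ne: "(f t0, d) \<noteq> (g t0, d')"
  shows "eventually (\<lambda>t. f t \<noteq> g t) (at t0 within S)"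
proof (cases "f t0 = g t0")
  case True
  have "((\<lambda>t. (f t - f t0) / (t - t0) - (g t - g t0) / (t - t0)) \<longlongrightarrow> d - d') (at t0 within S)"
    using f g unfolding has_field_derivative_iff by (rule tendsto_diff)
  then have "eventually (\<lambda>t. (f t - f t0) / (t - t0) - (g t - g t0) / (t - t0) \<noteq> 0) (at t0 within S)"
    by (rule tendsto_imp_eventually_ne) (use ne True in auto)
  then show ?thesis by eventually_elim (auto simp: True)
next
  case False
  have "(f \<longlongrightarrow> f t0) (at t0 within S)" "(g \<longlongrightarrow> g t0) (at t0 within S)"
    using DERIV_continuous[OF f] DERIV_continuous[OF g] by (simp_all add: continuous_within)
  then have "((\<lambda>t. f t - g t) \<longlongrightarrow> f t0 - g t0) (at t0 within S)" by (rule tendsto_diff)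
  then have "eventually (\<lambda>t. f t - g t \<noteq> 0) (at t0 within S)"
    by (rule tendsto_imp_eventually_ne) (use False in auto)
  then show ?thesis by eventually_elim auto
qed

text \<open>Finitely many difference quotients converge to the same \<nu>, hence uniformly in the
  branch, so f may switch between these branches arbitrarily.\<close>

lemma derivative_of_branches:
  assumes s: "\<And>i. i \<in> A \<Longrightarrow> (s i has_real_derivative \<nu>) (at t0 within S)" and A: "finite A" "\<And>i. i \<in> A \<Longrightarrow> s i t0 = f t0"
    and f: "eventually (\<lambda>t. \<exists>i\<in>A. f t = s i t) (at t0 within S)"
  shows "(f has_real_derivative \<nu>) (at t0 within S)"
  unfolding has_field_derivative_iff
proof (rule tendstoI)
  fix e :: real assume e: "0 < e"
  have "eventually (\<lambda>t. \<forall>i\<in>A. dist ((s i t - s i t0) / (t - t0)) \<nu> < e) (at t0 within S)"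
    using A(1) s e by (intro eventually_ball_finite ballI tendstoD) (auto simp: has_field_derivative_iff)
  then show "eventually (\<lambda>t. dist ((f t - f t0) / (t - t0)) \<nu> < e) (at t0 within S)"
    using f by eventually_elim (use A(2) in force)
qed

context real_rooted_family
begin

(* Near t0 the branches with distinct one-sided 1-jets at t0 are disjoint, so differentiability
   at t0 of a continuous root becomes a condition on its values at single points, which is
   closed for pointwise convergence. *)
lemma closed_differentiability_condition:
  assumes t0: "t0 \<in> I"
  shows "\<exists>Q :: (real \<Rightarrow> real) set. closed Q \<and> (\<forall>l\<in>Q. \<exists>d. (l has_real_derivative d) (at t0)) \<and>
     (\<forall>l d. (\<forall>t\<in>I. poly (P t) (l t) = 0) \<longrightarrow> continuous_on I l \<longrightarrow> (l has_real_derivative d) (at t0) \<longrightarrow> l \<in> Q)"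
proof -
  define s where "s i t = sroot (P t) i" for i t
  have cs: "continuous_on I (s i)" if "i < n" for i unfolding s_def using that by (rule continuous_on_sroot_P)
  have rs: "\<forall>t\<in>I. poly (P t) (s i t) = 0" if "i < n" for i
    unfolding s_def using monic that by (auto intro!: poly_sroot)
  have cover: "\<exists>i\<in>{..<n}. l t = s i t" if "t \<in> I" "poly (P t) (l t) = 0" for l t
    using that poly_real_rooted_eq_0_iff[of "P t" "l t"] monic[OF that(1)] by (auto simp: s_def)
  have "\<exists>d. i < n \<longrightarrow> (s i has_real_derivative d) (at_left t0)" "\<exists>d. i < n \<longrightarrow> (s i has_real_derivative d) (at_right t0)" for i
    using one_sided_derivatives[OF cs rs t0] by blast+
  then obtain Lf R where Lf: "\<And>i. i < n \<Longrightarrow> (s i has_real_derivative Lf i) (at_left t0)"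
    and R: "\<And>i. i < n \<Longrightarrow> (s i has_real_derivative R i) (at_right t0)" by metis
  have sep: "eventually (\<lambda>t. t \<in> I \<and> (\<forall>i\<in>{..<n}. \<forall>k\<in>{..<n}. (s i t0, D i) \<noteq> (s k t0, D k) \<longrightarrow> s i t \<noteq> s k t)) (at t0 within S)"
    if "\<And>i. i < n \<Longrightarrow> (s i has_real_derivative D i) (at t0 within S)" for D S
  proof (intro eventually_conj eventually_ball_finite ballI)
    have "eventually (\<lambda>t. t \<in> I) (at t0)" using I t0 by (rule eventually_at_in_open')
    then show "eventually (\<lambda>t. t \<in> I) (at t0 within S)" by (rule filter_leD[rotated]) (simp add: at_le)
    fix i k assume "i \<in> {..<n}" "k \<in> {..<n}"
    then show "eventually (\<lambda>t. (s i t0, D i) \<noteq> (s k t0, D k) \<longrightarrow> s i t \<noteq> s k t) (at t0 within S)"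
      using eventually_neq_of_jets_neq[OF that[of i] that[of k]] by (cases "(s i t0, D i) = (s k t0, D k)") auto
  qed auto
  obtain a where a: "a < t0" "\<And>t. t \<in> {a<..<t0} \<Longrightarrow> t \<in> I \<and> (\<forall>i\<in>{..<n}. \<forall>k\<in>{..<n}. (s i t0, Lf i) \<noteq> (s k t0, Lf k) \<longrightarrow> s i t \<noteq> s k t)"
    using sep[OF Lf] unfolding eventually_at_left_field by auto
  obtain b where b: "t0 < b" "\<And>t. t \<in> {t0<..<b} \<Longrightarrow> t \<in> I \<and> (\<forall>i\<in>{..<n}. \<forall>k\<in>{..<n}. (s i t0, R i) \<noteq> (s k t0, R k) \<longrightarrow> s i t \<noteq> s k t)"
    using sep[OF R] unfolding eventually_at_right_field by auto
  \<comment> \<open>The branches with a prescribed one-sided jet at t0, on the left in AL and on the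
    right in AR; a jet is a value together with a derivative.\<close>
  define AL where "AL v = {i\<in>{..<n}. (s i t0, Lf i) = v}" for v
  define AR where "AR v = {i\<in>{..<n}. (s i t0, R i) = v}" for v
  define V where "V = (\<lambda>i. (s i t0, R i)) ` {..<n}"
  \<comment> \<open>One jet v for both sides encodes the equality of left and right derivative.
    Every condition confines the value of l at one point to a finite set, and V is finite, so Q is a
    finite union of closed sets.\<close>
  define Q where "Q = (\<Union>v\<in>V. {l. l t0 \<in> {fst v}} \<inter> (\<Inter>t\<in>{a<..<t0}. {l. l t \<in> (\<lambda>i. s i t) ` AL v}) \<inter>
      (\<Inter>t\<in>{t0<..<b}. {l. l t \<in> (\<lambda>i. s i t) ` AR v}))"
  have cl: "closed {l :: real \<Rightarrow> real. l x \<in> F}" if "finite F" for x F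
  proof -
    have "closed ((\<lambda>l :: real \<Rightarrow> real. l x) -` F)"
      by (intro closed_vimage finite_imp_closed that continuous_on_product_coordinates)
    then show ?thesis by (simp add: vimage_def)
  qed
  have "closed Q" unfolding Q_def V_def AL_def AR_def
    by (intro closed_UN closed_Int closed_INT ballI cl) auto
  moreover have "\<exists>d. (l has_real_derivative d) (at t0)" if l: "l \<in> Q" for l
  proof -
    obtain x \<nu> where v: "l t0 = x" "\<forall>t\<in>{a<..<t0}. l t \<in> (\<lambda>i. s i t) ` AL (x, \<nu>)" "\<forall>t\<in>{t0<..<b}. l t \<in> (\<lambda>i. s i t) ` AR (x, \<nu>)"
      using l unfolding Q_def by fastforce
    have "(l has_real_derivative \<nu>) (at_left t0)"
    proof (rule derivative_of_branches[of "AL (x, \<nu>)" s])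
      show "eventually (\<lambda>t. \<exists>i\<in>AL (x, \<nu>). l t = s i t) (at_left t0)"
        unfolding eventually_at_left_field using v(2) a(1) by (intro exI[of _ a]) auto
    qed (use Lf v(1) in \<open>auto simp: AL_def\<close>)
    moreover have "(l has_real_derivative \<nu>) (at_right t0)"
    proof (rule derivative_of_branches[of "AR (x, \<nu>)" s])
      show "eventually (\<lambda>t. \<exists>i\<in>AR (x, \<nu>). l t = s i t) (at_right t0)"
        unfolding eventually_at_right_field using v(3) b(1) by (intro exI[of _ b]) auto
    qed (use R v(1) in \<open>auto simp: AR_def\<close>)
    ultimately have "(l has_real_derivative \<nu>) (at t0)"
      unfolding has_field_derivative_iff filterlim_at_split by blast
    then show ?thesis by blast
  qed
  moreover have "l \<in> Q"
    if l: "\<forall>t\<in>I. poly (P t) (l t) = 0" "continuous_on I l" "(l has_real_derivative d) (at t0)" for l d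
  proof -
    \<comment> \<open>Somewhere close to t0 the root l avoids every branch with a different jet.
      Connectedness then confines it to the branches with its own jet on all of T, an interval
      chosen independently of l.\<close>
    have branch: "\<forall>t\<in>T. \<exists>i\<in>{i\<in>{..<n}. (s i t0, D i) = (l t0, d)}. l t = s i t"
      if D: "\<And>i. i < n \<Longrightarrow> (s i has_real_derivative D i) (at t0 within S)" and S: "at t0 within S \<noteq> bot"
        and T: "connected T" "eventually (\<lambda>t. t \<in> T) (at t0 within S)"
        and TI: "\<And>t. t \<in> T \<Longrightarrow> t \<in> I \<and> (\<forall>i\<in>{..<n}. \<forall>k\<in>{..<n}. (s i t0, D i) \<noteq> (s k t0, D k) \<longrightarrow> s i t \<noteq> s k t)"
      for D S T
    proof
      fix t assume t: "t \<in> T"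
      have lS: "(l has_real_derivative d) (at t0 within S)" using l(3) by (rule has_field_derivative_at_within)
      have "eventually (\<lambda>t. \<forall>i\<in>{..<n}. (s i t0, D i) \<noteq> (l t0, d) \<longrightarrow> s i t \<noteq> l t) (at t0 within S)"
      proof (intro eventually_ball_finite ballI)
        fix i assume "i \<in> {..<n}"
        then show "eventually (\<lambda>t. (s i t0, D i) \<noteq> (l t0, d) \<longrightarrow> s i t \<noteq> l t) (at t0 within S)"
          using eventually_neq_of_jets_neq[OF D[of i] lS] by (cases "(s i t0, D i) = (l t0, d)") auto
      qed simp
      then have "eventually (\<lambda>t. t \<in> T \<and> (\<forall>i\<in>{..<n}. (s i t0, D i) \<noteq> (l t0, d) \<longrightarrow> s i t \<noteq> l t)) (at t0 within S)"
        using T(2) by eventually_elim auto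
      then obtain t1 where t1: "t1 \<in> T" "\<forall>i\<in>{..<n}. (s i t0, D i) \<noteq> (l t0, d) \<longrightarrow> s i t1 \<noteq> l t1"
        using eventually_happens'[OF S] by blast
      show "\<exists>i\<in>{i\<in>{..<n}. (s i t0, D i) = (l t0, d)}. l t = s i t"
      proof (rule connected_branch[OF T(1), of "{..<n}"])
        show "continuous_on T l" using l(2) TI by (auto intro: continuous_on_subset)
        show "continuous_on T (s i)" if "i \<in> {..<n}" for i using cs[of i] TI that by (auto intro: continuous_on_subset)
        show "\<exists>i\<in>{..<n}. l t = s i t" if "t \<in> T" for t using cover[of t l] TI[OF that] l(1) by blast
        show "s i t \<noteq> s k t" if "t \<in> T" "i \<in> {i\<in>{..<n}. (s i t0, D i) = (l t0, d)}"
          "k \<in> {..<n} - {i\<in>{..<n}. (s i t0, D i) = (l t0, d)}" for t i k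
          using TI[OF that(1)] that(2,3) by auto
        show "\<exists>i\<in>{i\<in>{..<n}. (s i t0, D i) = (l t0, d)}. l t1 = s i t1"
          using cover[of t1 l] TI[OF t1(1)] l(1) t1(2) by force
      qed (use t t1 in auto)
    qed
    have 1: "\<forall>t\<in>{a<..<t0}. \<exists>i\<in>AL (l t0, d). l t = s i t" unfolding AL_def
      by (rule branch[OF Lf _ _ _ a(2)]) (use a(1) in \<open>auto simp: eventually_at_left_field intro!: exI[of _ a]\<close>)
    have 2: "\<forall>t\<in>{t0<..<b}. \<exists>i\<in>AR (l t0, d). l t = s i t" unfolding AR_def
      by (rule branch[OF R _ _ _ b(2)]) (use b(1) in \<open>auto simp: eventually_at_right_field intro!: exI[of _ b]\<close>)
    \<comment> \<open>V lists right jets, so a branch in AR, found at any point of the interval (t0,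
      b), shows that the jet of l belongs to V.\<close>
    have "AR (l t0, d) \<noteq> {}" using 2 b(1) dense[OF b(1)] by fastforce
    then obtain i where "i \<in> {..<n}" "(s i t0, R i) = (l t0, d)" by (auto simp: AR_def)
    then have "(l t0, d) \<in> V" unfolding V_def by (metis (no_types, lifting) imageI)
    then show ?thesis using 1 2 unfolding Q_def by fastforce
  qed
  ultimately show ?thesis by blast
qed

text \<open>A system is a point in a product of compact intervals, one for each pair (j, t). For
  each t0 the conditions of factorization at t0 and differentiability at t0 are closed, and
  \<open>finite_differentiable_system\<close> satisfies any finite number of them at once.\<close>

lemma differentiable_system:
  "\<exists>L. (\<forall>t\<in>I. P t = (\<Prod>j\<in>{..<n}. [:- L j t, 1:])) \<and> (\<forall>t\<in>I. \<forall>j\<in>{..<n}. \<exists>d. (L j has_real_derivative d) (at t))"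
proof -
  obtain Q :: "real \<Rightarrow> (real \<Rightarrow> real) set" where Q: "\<And>t0. t0 \<in> I \<Longrightarrow> closed (Q t0)"
    "\<And>t0 l. t0 \<in> I \<Longrightarrow> l \<in> Q t0 \<Longrightarrow> \<exists>d. (l has_real_derivative d) (at t0)"
    "\<And>t0 l d. t0 \<in> I \<Longrightarrow> \<forall>t\<in>I. poly (P t) (l t) = 0 \<Longrightarrow> continuous_on I l \<Longrightarrow> (l has_real_derivative d) (at t0) \<Longrightarrow> l \<in> Q t0"
    using closed_differentiability_condition by metis
  \<comment> \<open>Every root at t is bounded by the sum of the absolute values of all roots. Off I
    and for j \<ge> n the interval shrinks to {0}; setting a system to 0 there leaves its
    derivatives at points of the open set I unchanged.\<close>
  define b where "b j t = (if t \<in> I \<and> j < n then \<Sum>i<n. \<bar>sroot (P t) i\<bar> else 0)" for j t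
  define X :: "(nat \<times> real \<Rightarrow> real) set" where "X = PiE UNIV (\<lambda>(j, t). {- b j t..b j t})"
  define C where "C t0 = {G. (\<forall>z. poly (P t0) z = (\<Prod>j<n. z - G (j, t0))) \<and> (\<forall>j\<in>{..<n}. (\<lambda>t. G (j, t)) \<in> Q t0)}" for t0
  have coord: "continuous_on UNIV (\<lambda>G. (G :: nat \<times> real \<Rightarrow> real) x)" for x
    by (rule continuous_on_product_coordinates)
  have "compact X"
  proof -
    have "compactin (product_topology (\<lambda>i. euclidean) UNIV) X"
      unfolding X_def by (subst compactin_PiE) auto
    then show ?thesis by (simp add: euclidean_product_topology)
  qed
  moreover have "closed (C t0)" if t0: "t0 \<in> I" for t0
  proof -
    have "closed {G :: nat \<times> real \<Rightarrow> real. \<forall>z. poly (P t0) z = (\<Prod>j<n. z - G (j, t0))}"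
      by (intro closed_Collect_all closed_Collect_eq continuous_intros coord)
    moreover have "closed ((\<lambda>G :: nat \<times> real \<Rightarrow> real. \<lambda>t. G (j, t)) -` Q t0)" for j
      by (intro closed_vimage Q(1) t0 continuous_on_coordinatewise_then_product coord)
    then have "closed (\<Inter>j\<in>{..<n}. (\<lambda>G :: nat \<times> real \<Rightarrow> real. \<lambda>t. G (j, t)) -` Q t0)" by (intro closed_INT) auto
    moreover have "C t0 = {G. \<forall>z. poly (P t0) z = (\<Prod>j<n. z - G (j, t0))} \<inter> (\<Inter>j\<in>{..<n}. (\<lambda>G. \<lambda>t. G (j, t)) -` Q t0)"
      unfolding C_def by auto
    ultimately show ?thesis by (simp add: closed_Int)
  qed
  moreover have "X \<inter> (\<Inter>t0\<in>S. C t0) \<noteq> {}" if S: "finite S" "S \<subseteq> I" for S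
  proof -
    obtain L where L: "\<forall>t\<in>I. P t = (\<Prod>j\<in>{..<n}. [:- L j t, 1:])" "\<forall>j\<in>{..<n}. continuous_on I (L j)"
     "\<forall>s\<in>S. \<forall>j\<in>{..<n}. \<exists>d. (L j has_real_derivative d) (at s)"
      using finite_differentiable_system[OF S] by blast
    define G where "G = (\<lambda>(j, t). if t \<in> I \<and> j < n then L j t else 0)"
    have root: "poly (P t) (L j t) = 0" if "t \<in> I" "j < n" for t j using L(1) that by (auto simp: poly_prod)
    have GX: "G \<in> X"
    proof -
      have "\<bar>L j t\<bar> \<le> (\<Sum>i<n. \<bar>sroot (P t) i\<bar>)" if tj: "t \<in> I" "j < n" for j t
      proof -
        have "poly (P t) (L j t) = 0" using root tj by blast
        then obtain i where "i < n" "L j t = sroot (P t) i"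
          using poly_real_rooted_eq_0_iff monic[OF tj(1)] by metis
        then show ?thesis using member_le_sum[of i "{..<n}" "\<lambda>i. \<bar>sroot (P t) i\<bar>"] by auto
      qed
      then show ?thesis unfolding X_def G_def b_def by (auto simp: abs_le_iff minus_le_iff)
    qed
    have "G \<in> C t0" if t0: "t0 \<in> S" for t0
    proof -
      have tI: "t0 \<in> I" using t0 S by blast
      have "poly (P t0) z = (\<Prod>j<n. z - G (j, t0))" for z using L(1) tI by (simp add: poly_prod G_def)
      moreover have "(\<lambda>t. G (j, t)) \<in> Q t0" if j: "j \<in> {..<n}" for j
      proof -
        obtain d where "(L j has_real_derivative d) (at t0)" using L(3) t0 j by blast
        then have "((\<lambda>t. G (j, t)) has_real_derivative d) (at t0)"
          by (rule has_field_derivative_transform_within_open[OF _ I tI]) (use j in \<open>auto simp: G_def\<close>)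
        moreover have "\<forall>t\<in>I. poly (P t) (G (j, t)) = 0" using root j by (auto simp: G_def)
        moreover have "continuous_on I (\<lambda>t. G (j, t))"
          using L(2)[rule_format, OF j] by (rule continuous_on_eq) (use j in \<open>auto simp: G_def\<close>)
        ultimately show ?thesis by (intro Q(3)[OF tI])
      qed
      ultimately show ?thesis by (simp add: C_def)
    qed
    then show ?thesis using GX by blast
  qed
  ultimately have "X \<inter> (\<Inter>t0\<in>I. C t0) \<noteq> {}" by (rule compact_imp_fip_image)
  then obtain G where G: "\<And>t0. t0 \<in> I \<Longrightarrow> G \<in> C t0" by blast
  show ?thesis
  proof (intro exI[of _ "\<lambda>j t. G (j, t)"] conjI ballI)
    fix t assume t: "t \<in> I"
    show "P t = (\<Prod>j\<in>{..<n}. [:- G (j, t), 1:])"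
      by (rule poly_ext) (use G[OF t] in \<open>simp add: C_def poly_prod\<close>)
    show "\<exists>d. ((\<lambda>t. G (j, t)) has_real_derivative d) (at t)" if "j \<in> {..<n}" for j
      using G[OF t] that by (intro Q(2)[OF t]) (auto simp: C_def)
  qed
qed

end

section \<open>From coefficient functions to the family of polynomials\<close>

lemma monic_curve_coeff:
  "coeff (monic_curve n a t) k = (if k = n then 1 else 0) + (\<Sum>j=1..n. if n - j = k then a j t else 0)"
  by (simp add: monic_curve_def coeff_sum)

lemma degree_monic_curve: "degree (monic_curve n a t) = n"
proof (rule antisym)
  show "degree (monic_curve n a t) \<le> n"
    by (rule degree_le) (auto simp: monic_curve_coeff intro!: sum.neutral)
  have "(\<Sum>j=1..n. if n - j = n then a j t else 0) = 0" by (intro sum.neutral) auto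
  then have "coeff (monic_curve n a t) n \<noteq> 0" unfolding monic_curve_coeff by simp
  then show "n \<le> degree (monic_curve n a t)" by (rule le_degree)
qed

text \<open>All orders are at most n, so the set in \<open>max_multiplicity\<close> is finite and
  its \<open>Max\<close> bounds the order of every root.\<close>

lemma real_rooted_family_monic_curve:
  assumes "open I" "p = max_multiplicity I n a" "hyperbolic_curve p I n a"
  shows "real_rooted_family (monic_curve n a) I n p"
proof (rule real_rooted_family.intro)
  show "open I" by fact
  have hyp: "hyperbolic (monic_curve n a t)" if "t \<in> I" for t
    using assms(3) that by (simp add: hyperbolic_curve_def)
  show "real_rooted (monic_curve n a t) \<and> degree (monic_curve n a t) = n \<and> lead_coeff (monic_curve n a t) = 1" if "t \<in> I" for t
    using hyp[OF that] hyperbolic_imp_real_rooted[OF hyp[OF that]] degree_monic_curve by (auto simp: hyperbolic_def)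
  show "Cn p I (\<lambda>t. coeff (monic_curve n a t) k)" for k
    unfolding monic_curve_coeff
  proof (intro Cn_add Cn_const Cn_sum)
    fix j assume "j \<in> {1..n}"
    then have "Cn p I (a j)" using assms(3) by (auto simp: hyperbolic_curve_def intro: Ck_on_imp_Cn)
    then show "Cn p I (\<lambda>t. if n - j = k then a j t else 0)" by (cases "n - j = k") auto
  qed
  show "order x (monic_curve n a t) \<le> p" if "t \<in> I" "poly (monic_curve n a t) x = 0" for t x
  proof -
    let ?O = "{order x (monic_curve n a t) | t x. t \<in> I \<and> poly (monic_curve n a t) x = 0}"
    have "?O \<subseteq> {..n}"
    proof
      fix y assume "y \<in> ?O"
      then obtain t x where y: "y = order x (monic_curve n a t)" and "t \<in> I" by blast
      then have "lead_coeff (monic_curve n a t) = 1" using hyp unfolding hyperbolic_def by blast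
      then have "monic_curve n a t \<noteq> 0" by auto
      then show "y \<in> {..n}" unfolding y using order_degree[of "monic_curve n a t" x] by (simp add: degree_monic_curve)
    qed
    then have "finite ?O" by (rule finite_subset) simp
    then show ?thesis unfolding assms(2) max_multiplicity_def using that by (intro Max_ge) blast+
  qed
qed

theorem theorem2p4:
  fixes I :: "real set" and n p :: nat and a :: "nat \<Rightarrow> real \<Rightarrow> real"
  assumes "open I" and "is_interval I"
    and "p = max_multiplicity I n a"
    and "hyperbolic_curve p I n a"
  shows
    "(\<forall>l. continuous_root I n a l \<longrightarrow>
        (\<forall>t\<in>I. (\<exists>d. (l has_real_derivative d) (at_left t)) \<and>
               (\<exists>d. (l has_real_derivative d) (at_right t)))) \<and>
     (\<forall>l. continuous_root I n a l \<longrightarrow>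
        (\<forall>t0\<in>I. (left_deriv l \<longlongrightarrow> left_deriv l t0) (at_left t0) \<and>
                (right_deriv l \<longlongrightarrow> left_deriv l t0) (at_left t0) \<and>
                (left_deriv l \<longlongrightarrow> right_deriv l t0) (at_right t0) \<and>
                (right_deriv l \<longlongrightarrow> right_deriv l t0) (at_right t0))) \<and>
     (\<exists>L. differentiable_root_system I n a L) \<and>
     (\<forall>l. differentiable_root I n a l \<longrightarrow> Ck_on 1 l I)"
proof -
  interpret real_rooted_family "monic_curve n a" I n p
    using assms(1,3,4) by (rule real_rooted_family_monic_curve)
  have ex: "(l has_real_derivative left_deriv l t) (at_left t)" "(l has_real_derivative right_deriv l t) (at_right t)"
    if l: "continuous_root I n a l" and t: "t \<in> I" for l t
  proof -
    have l': "continuous_on I l" "\<forall>t\<in>I. poly (monic_curve n a t) (l t) = 0"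
      using l by (auto simp: continuous_root_def is_root_on_def)
    show "(l has_real_derivative left_deriv l t) (at_left t)" "(l has_real_derivative right_deriv l t) (at_right t)"
      using one_sided_derivatives[OF l' t] left_deriv_eq right_deriv_eq by metis+
  qed
  \<comment> \<open>Left and right derivatives at u are both derivatives within a subset of the
    line, so the single hypothesis \<open>near\<close> yields both limits.\<close>
  have lim: "(left_deriv l \<longlongrightarrow> \<nu>) F \<and> (right_deriv l \<longlongrightarrow> \<nu>) F"
    if l: "continuous_root I n a l" and FI: "eventually (\<lambda>u. u \<in> I) F"
    and near: "\<And>\<epsilon>. 0 < \<epsilon> \<Longrightarrow> eventually (\<lambda>u. \<forall>d S. at u within S \<noteq> bot \<longrightarrow> (l has_real_derivative d) (at u within S) \<longrightarrow> \<bar>d - \<nu>\<bar> \<le> \<epsilon>) F"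
    for l \<nu> and F :: "real filter"
  proof -
    have "eventually (\<lambda>u. dist (left_deriv l u) \<nu> < e \<and> dist (right_deriv l u) \<nu> < e) F" if e: "0 < e" for e
    proof -
      have "eventually (\<lambda>u. \<forall>d S. at u within S \<noteq> bot \<longrightarrow> (l has_real_derivative d) (at u within S) \<longrightarrow> \<bar>d - \<nu>\<bar> \<le> e / 2) F"
        using e by (intro near) simp
      with FI show ?thesis
    proof eventually_elim
      case (elim u)
      have "\<bar>left_deriv l u - \<nu>\<bar> \<le> e/2" "\<bar>right_deriv l u - \<nu>\<bar> \<le> e/2"
        using elim ex[OF l] trivial_limit_at_left_real[of u] trivial_limit_at_right_real[of u]
        by (auto simp: trivial_limit_def)
      then show ?case using e by (auto simp: dist_real_def)
    qed
    qed
    then show ?thesis unfolding tendsto_iff by (simp add: eventually_conj_iff)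
  qed
  have one: "(left_deriv l \<longlongrightarrow> left_deriv l t0) (at_left t0) \<and> (right_deriv l \<longlongrightarrow> left_deriv l t0) (at_left t0) \<and>
      (left_deriv l \<longlongrightarrow> right_deriv l t0) (at_right t0) \<and> (right_deriv l \<longlongrightarrow> right_deriv l t0) (at_right t0)"
    if l: "continuous_root I n a l" and t0: "t0 \<in> I" for l t0
  proof -
    have l': "continuous_on I l" "\<forall>t\<in>I. poly (monic_curve n a t) (l t) = 0"
      using l by (auto simp: continuous_root_def is_root_on_def)
    have "eventually (\<lambda>u. u \<in> I) (at t0)" using assms(1) t0 by (rule eventually_at_in_open')
    then have "eventually (\<lambda>u. u \<in> I) (at_left t0)" "eventually (\<lambda>u. u \<in> I) (at_right t0)"
      by (auto simp: eventually_at_split)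
    then show ?thesis
      using lim[OF l _ one_sided_derivatives_near(1)[OF l' t0 ex(2)[OF l t0]]]
        lim[OF l _ one_sided_derivatives_near(2)[OF l' t0 ex(1)[OF l t0]]] by blast
  qed
  have sys: "\<exists>L. differentiable_root_system I n a L"
  proof -
    obtain L where L: "\<forall>t\<in>I. monic_curve n a t = (\<Prod>j\<in>{..<n}. [:- L j t, 1:])"
      "\<forall>t\<in>I. \<forall>j\<in>{..<n}. \<exists>d. (L j has_real_derivative d) (at t)"
      using differentiable_system by blast
    \<comment> \<open>Roots are numbered from 1 in \<open>root_system\<close> and from 0 in the
      system just obtained.\<close>
    have "differentiable_root_system I n a (\<lambda>j. L (j - 1))"
      unfolding differentiable_root_system_def root_system_def
    proof (intro conjI ballI)
      fix t assume "t \<in> I"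
      have "(\<Prod>j=1..n. [:- L (j - 1) t, 1:]) = (\<Prod>j\<in>{..<n}. [:- L j t, 1:])"
        by (rule prod.reindex_bij_witness[of _ Suc "\<lambda>j. j - 1"]) auto
      then show "monic_curve n a t = (\<Prod>j=1..n. [:- L (j - 1) t, 1:])" using L(1) \<open>t \<in> I\<close> by simp
    next
      fix j assume j: "j \<in> {1..n}"
      show "L (j - 1) differentiable_on I"
        unfolding differentiable_on_def
      proof
        fix t assume "t \<in> I"
        then obtain d where "(L (j - 1) has_real_derivative d) (at t)" using L(2) j by force
        then have "L (j - 1) differentiable (at t)" by (auto simp: real_differentiable_def)
        then show "L (j - 1) differentiable (at t within I)" by (rule differentiable_at_withinI)
      qed
    qed
    then show ?thesis by blast
  qed
  have C1: "Ck_on 1 l I" if l: "differentiable_root I n a l" for l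
  proof -
    have dl: "l differentiable (at t)" if "t \<in> I" for t
      using l that assms(1) by (auto simp: differentiable_root_def differentiable_on_def at_within_open[OF that assms(1)])
    have cl: "continuous_root I n a l"
      using l by (auto simp: continuous_root_def differentiable_root_def differentiable_imp_continuous_on)
    have D: "(l has_real_derivative deriv l t) (at t)" if "t \<in> I" for t
      using dl[OF that] by (metis DERIV_deriv_iff_real_differentiable)
    have eq: "left_deriv l t = deriv l t" "right_deriv l t = deriv l t" if "t \<in> I" for t
      using D[OF that] by (auto intro!: left_deriv_eq right_deriv_eq intro: has_field_derivative_at_within)
    \<comment> \<open>On I both one-sided derivatives of l equal \<open>deriv l\<close>, so their
      one-sided limits combine to continuity.\<close>
    have "isCont (deriv l) t" if t: "t \<in> I" for t
    proof -
      have "eventually (\<lambda>u. u \<in> I) (at t)" using assms(1) t by (rule eventually_at_in_open')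
      then have ev: "eventually (\<lambda>u. left_deriv l u = deriv l u) (at_left t)" "eventually (\<lambda>u. right_deriv l u = deriv l u) (at_right t)"
        unfolding eventually_at_split by (auto elim: eventually_mono simp: eq)
      have "(deriv l \<longlongrightarrow> deriv l t) (at_left t)"
        using one[OF cl t] ev(1) eq[OF t] by (metis Lim_transform_eventually)
      moreover have "(deriv l \<longlongrightarrow> deriv l t) (at_right t)"
        using one[OF cl t] ev(2) eq[OF t] by (metis Lim_transform_eventually)
      ultimately show ?thesis by (simp add: isCont_def filterlim_at_split)
    qed
    then have "continuous_on I (deriv l)" by (simp add: continuous_at_imp_continuous_on)
    then show ?thesis using D by (auto simp: Ck_on_def field_differentiable_def)
  qed
  show ?thesis using ex one sys C1 by blast
qed

end
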